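(* Let $p$ be a prime, let $X$ be a finite connected graph, let $\alpha:\mathbf{E}_X\to\mathbb{Z}_p$ satisfy $\alpha(\bar s)=-\alpha(s)$ for all $s\in\mathbf{E}_X$, and let $\mathcal{G}=\{G_v\}_{v\in V_X}$ be a family of closed subgroups of $\mathbb{Z}_p$ indexed by $V_X$. For $n\ge 0$ let $X_n=X(\Gamma_n,\mathcal{G}_n,\alpha_n)$, where $\Gamma_n=\mathbb{Z}_p/p^n\mathbb{Z}_p$, $\pi_n:\mathbb{Z}_p\to\Gamma_n$ is the projection, $\mathcal{G}_n=\{\pi_n(G_v)\}_{v\in V_X}$ and $\alpha_n=\pi_n\circ\alpha$. Assume that all the graphs $X_n$ are connected and that $\chi(X_n)<0$ for all sufficiently large $n$. Then there exist $\mu,\lambda\in\mathbb{Z}_{\ge0}$ and $\nu\in\mathbb{Z}$ such that $$\mathrm{ord}_p(\kappa(X_n))=\mu p^n+\lambda n+\nu$$ for all sufficiently large $n$.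
   Context: Graphs are in Serre's sense: a graph $Y$ consists of a vertex set $V_Y$, a set $\mathbf{E}_Y$ of directed edges, origin and terminus maps $o,t:\mathbf{E}_Y\to V_Y$, and a fixed-point-free involution $\varepsilon\mapsto\bar\varepsilon$ on $\mathbf{E}_Y$ with $o(\bar\varepsilon)=t(\varepsilon)$; $E_Y$ denotes the set of undirected edges $\{\varepsilon,\bar\varepsilon\}$, and $\chi(Y)=|V_Y|-|E_Y|$ for finite $Y$. $\kappa(Y)$ is the number of spanning trees of $Y$, and $\mathrm{ord}_p$ is the $p$-adic valuation. Voltage graph: for an abelian group $G$ (written additively here), a function $\beta:\mathbf{E}_X\to G$ with $\beta(\bar s)=-\beta(s)$ and subgroups $H_v\le G$ ($v\in V_X$), the graph $X(G,\{H_v\},\beta)$ has vertices $(v,\sigma+H_v)$ ($v\in V_X$, $\sigma\in G$), directed edges $(s,\sigma)\in\mathbf{E}_X\times G$, with $o(s,\sigma)=(o(s),\sigma+H_{o(s)})$, $t(s,\sigma)=(t(s),\sigma+\beta(s)+H_{t(s)})$ and $\overline{(s,\sigma)}=(\bar s,\sigma+\beta(s))$. *)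

theory Defs
  imports
    "HOL-Analysis.Function_Topology"
    "HOL-Computational_Algebra.Primes"
    "Graph_Theory.Graph_Theory"
    "HOL-Algebra.Coset"
begin

section \<open>Graphs in Serre's sense\<close>

text \<open>
  A graph in Serre's sense is a \<^locale>\<open>bidirected_digraph\<close> \<open>Y\<close> with involution \<open>bar\<close>:
  \<^const>\<open>arcs\<close> are the directed edges, \<^const>\<open>tail\<close> and \<^const>\<open>head\<close> are the origin and terminus
  maps. The locale makes \<open>bar\<close> fixed-point-free on the directed edges and the identity
  off them. Loops and multiple edges are allowed.
\<close>

definition undirected_edges :: "('v, 'e) pre_digraph \<Rightarrow> ('e \<Rightarrow> 'e) \<Rightarrow> 'e set set" where
  "undirected_edges Y bar = {{e, bar e} | e. e \<in> arcs Y}"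

definition euler_char :: "('v, 'e) pre_digraph \<Rightarrow> ('e \<Rightarrow> 'e) \<Rightarrow> int" where
  "euler_char Y bar = int (card (verts Y)) - int (card (undirected_edges Y bar))"

text \<open>
  \<^const>\<open>pre_digraph.cycle\<close> (a nonempty closed walk without repeated vertices) also holds of the
  backtracking walk \<open>[e, bar e]\<close>, which is not a circuit of a Serre graph. It is
  the only kind of cycle using an edge in both directions, so the second
  conjunct below excludes exactly these. For the same reason the library's \<^const>\<open>spanning_tree\<close>,
  whose trees contain no directed cycle at all, cannot be used here.
\<close>

definition serre_circuit :: "('v, 'e) pre_digraph \<Rightarrow> ('e \<Rightarrow> 'e) \<Rightarrow> 'e list \<Rightarrow> bool" where
  "serre_circuit Y bar c \<longleftrightarrow> pre_digraph.cycle Y c \<and> (\<forall>e\<in>set c. bar e \<notin> set c)"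

definition serre_tree :: "('v, 'e) pre_digraph \<Rightarrow> ('e \<Rightarrow> 'e) \<Rightarrow> bool" where
  "serre_tree T bar \<longleftrightarrow> Digraph_Component.connected T \<and> \<not> (\<exists>c. serre_circuit T bar c)"

text \<open>
  A subgraph shares the maps \<^const>\<open>tail\<close> and \<^const>\<open>head\<close> with the ambient graph, so a spanning
  subgraph is determined by its set of directed edges, which has to be stable under \<open>bar\<close>.
\<close>

definition spanning_trees :: "('v, 'e) pre_digraph \<Rightarrow> ('e \<Rightarrow> 'e) \<Rightarrow> ('v, 'e) pre_digraph set" where
  "spanning_trees Y bar = {T. spanning T Y \<and> bar ` arcs T \<subseteq> arcs T \<and> serre_tree T bar}"

definition num_spanning_trees :: "('v, 'e) pre_digraph \<Rightarrow> ('e \<Rightarrow> 'e) \<Rightarrow> nat" where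
  "num_spanning_trees Y bar = card (spanning_trees Y bar)"


section \<open>Voltage graphs\<close>

definition voltage_graph ::
  "('v, 'e) pre_digraph \<Rightarrow> ('g, 'r) monoid_scheme \<Rightarrow> ('v \<Rightarrow> 'g set) \<Rightarrow> ('e \<Rightarrow> 'g)
    \<Rightarrow> ('v \<times> 'g set, 'e \<times> 'g) pre_digraph" where
  "voltage_graph X G H \<beta> = \<lparr>
     verts = {(v, \<sigma> <#\<^bsub>G\<^esub> H v) | v \<sigma>. v \<in> verts X \<and> \<sigma> \<in> carrier G},
     arcs = arcs X \<times> carrier G,
     tail = (\<lambda>(s, \<sigma>). (tail X s, \<sigma> <#\<^bsub>G\<^esub> H (tail X s))),
     head = (\<lambda>(s, \<sigma>). (head X s, (\<sigma> \<otimes>\<^bsub>G\<^esub> \<beta> s) <#\<^bsub>G\<^esub> H (head X s)))\<rparr>"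

definition voltage_bar ::
  "('v, 'e) pre_digraph \<Rightarrow> ('e \<Rightarrow> 'e) \<Rightarrow> ('g, 'r) monoid_scheme \<Rightarrow> ('e \<Rightarrow> 'g)
    \<Rightarrow> 'e \<times> 'g \<Rightarrow> 'e \<times> 'g" where
  "voltage_bar X bar G \<beta> = (\<lambda>(s, \<sigma>).
     if s \<in> arcs X \<and> \<sigma> \<in> carrier G then (bar s, \<sigma> \<otimes>\<^bsub>G\<^esub> \<beta> s) else (s, \<sigma>))"

lemma bidirected_voltage_graph:
  assumes X: "bidirected_digraph X bar" and G: "group G"
    and \<beta>: "\<And>s. s \<in> arcs X \<Longrightarrow> \<beta> s \<in> carrier G"
    and \<beta>_bar: "\<And>s. s \<in> arcs X \<Longrightarrow> \<beta> (bar s) = inv\<^bsub>G\<^esub> (\<beta> s)"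
  shows "bidirected_digraph (voltage_graph X G H \<beta>) (voltage_bar X bar G \<beta>)"
proof -
  interpret X: bidirected_digraph X bar by (rule X)
  interpret G: group G by (rule G)
  interpret V: wf_digraph "voltage_graph X G H \<beta>"
    by unfold_locales (use \<beta> in \<open>auto simp: voltage_graph_def intro!: G.m_closed exI\<close>)
  show ?thesis
    by (rule V.bidirected_digraphI)
      (auto simp: voltage_graph_def voltage_bar_def \<beta> \<beta>_bar G.m_assoc X.arev_neq split: if_splits)
qed


section \<open>The \<open>p\<close>-adic integers and their finite quotients\<close>

text \<open>
  The additive group of the \<open>p\<close>-adic integers as the inverse limit of the groups of residues
  modulo \<open>p^n\<close>: the \<open>n\<close>-th entry of \<open>x\<close> is the residue of \<open>x\<close> modulo \<open>p^n\<close>.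
\<close>

definition Zp :: "nat \<Rightarrow> (nat \<Rightarrow> int) monoid" where
  "Zp p = \<lparr>
     carrier = {x. \<forall>n. x n \<in> {0..<int p ^ n} \<and> x (Suc n) mod int p ^ n = x n},
     mult = (\<lambda>x y n. (x n + y n) mod int p ^ n),
     one = (\<lambda>n. 0)\<rparr>"

definition Zp_topology :: "nat \<Rightarrow> (nat \<Rightarrow> int) topology" where
  "Zp_topology p =
     subtopology (product_topology (\<lambda>n. discrete_topology {0..<int p ^ n}) UNIV) (carrier (Zp p))"

definition pow_Zp :: "nat \<Rightarrow> nat \<Rightarrow> (nat \<Rightarrow> int) set" where
  "pow_Zp p n = {x [^]\<^bsub>Zp p\<^esub> (p ^ n) | x. x \<in> carrier (Zp p)}"

definition \<Gamma> :: "nat \<Rightarrow> nat \<Rightarrow> (nat \<Rightarrow> int) set monoid" where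
  "\<Gamma> p n = Zp p Mod pow_Zp p n"

definition \<pi> :: "nat \<Rightarrow> nat \<Rightarrow> (nat \<Rightarrow> int) \<Rightarrow> (nat \<Rightarrow> int) set" where
  "\<pi> p n x = pow_Zp p n #>\<^bsub>Zp p\<^esub> x"

lemma comm_group_Zp:
  assumes "p > 0"
  shows "comm_group (Zp p)"
proof (rule comm_groupI)
  fix x y assume x: "x \<in> carrier (Zp p)" and y: "y \<in> carrier (Zp p)"
  have "(x (Suc n) + y (Suc n)) mod int p ^ Suc n mod int p ^ n = (x n + y n) mod int p ^ n" for n
  proof -
    have "(x (Suc n) + y (Suc n)) mod int p ^ Suc n mod int p ^ n
        = (x (Suc n) mod int p ^ n + y (Suc n) mod int p ^ n) mod int p ^ n"
      by (simp add: mod_mod_cancel mod_add_eq)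
    then show ?thesis using x y by (simp add: Zp_def)
  qed
  then show "x \<otimes>\<^bsub>Zp p\<^esub> y \<in> carrier (Zp p)"
    using assms by (simp add: Zp_def)
next
  fix x assume x: "x \<in> carrier (Zp p)"
  let ?y = "\<lambda>n. (- x n) mod int p ^ n"
  have "(- x (Suc n)) mod int p ^ Suc n mod int p ^ n = (- x n) mod int p ^ n" for n
  proof -
    have "(- x (Suc n)) mod int p ^ Suc n mod int p ^ n = (- (x (Suc n) mod int p ^ n)) mod int p ^ n"
      by (simp add: mod_mod_cancel mod_minus_eq)
    then show ?thesis using x by (simp add: Zp_def)
  qed
  then have "?y \<in> carrier (Zp p)"
    using assms by (simp add: Zp_def)
  moreover have "?y \<otimes>\<^bsub>Zp p\<^esub> x = \<one>\<^bsub>Zp p\<^esub>"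
    by (simp add: Zp_def fun_eq_iff mod_simps)
  ultimately show "\<exists>y\<in>carrier (Zp p). y \<otimes>\<^bsub>Zp p\<^esub> x = \<one>\<^bsub>Zp p\<^esub>" by blast
qed (use assms in \<open>auto simp: Zp_def fun_eq_iff mod_simps ac_simps\<close>)

lemma normal_pow_Zp:
  assumes "p > 0"
  shows "pow_Zp p n \<lhd> Zp p"
proof -
  interpret comm_group "Zp p" by (rule comm_group_Zp[OF assms])
  have "subgroup (pow_Zp p n) (Zp p)"
  proof (rule subgroupI)
    show "pow_Zp p n \<subseteq> carrier (Zp p)" by (auto simp: pow_Zp_def)
    show "pow_Zp p n \<noteq> {}" by (auto simp: pow_Zp_def)
    show "inv\<^bsub>Zp p\<^esub> a \<in> pow_Zp p n" if prem: "a \<in> pow_Zp p n" for a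
    proof -
      obtain x where "x \<in> carrier (Zp p)" "a = x [^]\<^bsub>Zp p\<^esub> (p ^ n)"
        using prem by (auto simp: pow_Zp_def)
      then have "inv\<^bsub>Zp p\<^esub> a = (inv\<^bsub>Zp p\<^esub> x) [^]\<^bsub>Zp p\<^esub> (p ^ n)" "inv\<^bsub>Zp p\<^esub> x \<in> carrier (Zp p)"
        by (simp_all add: nat_pow_inv)
      then show ?thesis unfolding pow_Zp_def by blast
    qed
    show "a \<otimes>\<^bsub>Zp p\<^esub> b \<in> pow_Zp p n" if prem: "a \<in> pow_Zp p n" "b \<in> pow_Zp p n" for a b
    proof -
      obtain x y where "x \<in> carrier (Zp p)" "y \<in> carrier (Zp p)"
        "a = x [^]\<^bsub>Zp p\<^esub> (p ^ n)" "b = y [^]\<^bsub>Zp p\<^esub> (p ^ n)"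
        using prem by (auto simp: pow_Zp_def)
      then have "a \<otimes>\<^bsub>Zp p\<^esub> b = (x \<otimes>\<^bsub>Zp p\<^esub> y) [^]\<^bsub>Zp p\<^esub> (p ^ n)" "x \<otimes>\<^bsub>Zp p\<^esub> y \<in> carrier (Zp p)"
        by (simp_all add: nat_pow_distrib)
      then show ?thesis unfolding pow_Zp_def by blast
    qed
  qed
  then show ?thesis by (simp add: normal_iff_subgroup)
qed

lemma Zp_pow: "(x [^]\<^bsub>Zp p\<^esub> (m::nat)) k = (int m * x k) mod int p ^ k"
proof (induction m)
  case 0
  then show ?case by (simp add: Zp_def)
next
  case (Suc m)
  then show ?case by (simp add: nat_pow_def) (simp add: Zp_def nat_pow_def algebra_simps mod_simps)
qed

lemma Zp_mod:
  assumes "x \<in> carrier (Zp p)"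
  shows "x (k + n) mod int p ^ k = x k"
proof (induction n)
  case 0
  then show ?case using assms by (simp add: Zp_def)
next
  case (Suc n)
  have "x (Suc (k + n)) mod int p ^ k = x (Suc (k + n)) mod int p ^ (k + n) mod int p ^ k"
    by (simp add: mod_mod_cancel le_imp_power_dvd)
  also have "\<dots> = x k" using Suc assms by (simp add: Zp_def)
  finally show ?case by simp
qed

lemma pow_Zp_eq:
  assumes "p > 0"
  shows "pow_Zp p n = {x \<in> carrier (Zp p). x n = 0}"
proof (intro equalityI subsetI)
  fix x assume "x \<in> pow_Zp p n"
  then obtain y where y: "y \<in> carrier (Zp p)" "x = y [^]\<^bsub>Zp p\<^esub> (p ^ n)"
    by (auto simp: pow_Zp_def)
  interpret comm_group "Zp p" by (rule comm_group_Zp[OF assms])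
  show "x \<in> {x \<in> carrier (Zp p). x n = 0}"
    using y by (simp add: Zp_pow)
next
  fix x assume "x \<in> {x \<in> carrier (Zp p). x n = 0}"
  then have x: "x \<in> carrier (Zp p)" and x0: "x n = 0" by auto
  define y where "y k = x (n + k) div int p ^ n" for k
  have y: "x (n + k) = int p ^ n * y k" for k
    using Zp_mod[OF x, of n k] x0 by (simp add: y_def mod_eq_0_iff_dvd)
  have pos: "int p ^ n > 0" using assms by simp
  have "y \<in> carrier (Zp p)"
  proof -
    have "0 \<le> y k \<and> y k < int p ^ k" for k
    proof -
      have "0 \<le> x (n + k)" "x (n + k) < int p ^ (n + k)"
        using x by (auto simp: Zp_def)
      then show ?thesis
        using pos unfolding y power_add by (simp add: zero_le_mult_iff)
    qed
    moreover have "y (Suc k) mod int p ^ k = y k" for k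
    proof -
      have "x (n + Suc k) mod int p ^ (n + k) = x (n + k)"
        using x by (simp add: Zp_def)
      then show ?thesis
        using assms unfolding y power_add by (simp add: mult_mod_right [symmetric])
    qed
    ultimately show ?thesis by (simp add: Zp_def)
  qed
  moreover have "x = y [^]\<^bsub>Zp p\<^esub> (p ^ n)"
  proof
    fix k
    have "x k = x (k + n) mod int p ^ k" using Zp_mod[OF x] by simp
    then show "x k = (y [^]\<^bsub>Zp p\<^esub> (p ^ n)) k"
      by (simp add: Zp_pow add.commute[of k n] y)
  qed
  ultimately show "x \<in> pow_Zp p n" unfolding pow_Zp_def by blast
qed

definition layer_graph ::
  "nat \<Rightarrow> ('v, 'e) pre_digraph \<Rightarrow> ('v \<Rightarrow> (nat \<Rightarrow> int) set) \<Rightarrow> ('e \<Rightarrow> nat \<Rightarrow> int) \<Rightarrow> nat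
    \<Rightarrow> ('v \<times> (nat \<Rightarrow> int) set set, 'e \<times> (nat \<Rightarrow> int) set) pre_digraph" where
  "layer_graph p X \<G> \<alpha> n = voltage_graph X (\<Gamma> p n) (\<lambda>v. \<pi> p n ` \<G> v) (\<pi> p n \<circ> \<alpha>)"

definition layer_bar ::
  "nat \<Rightarrow> ('v, 'e) pre_digraph \<Rightarrow> ('e \<Rightarrow> 'e) \<Rightarrow> ('e \<Rightarrow> nat \<Rightarrow> int) \<Rightarrow> nat
    \<Rightarrow> 'e \<times> (nat \<Rightarrow> int) set \<Rightarrow> 'e \<times> (nat \<Rightarrow> int) set" where
  "layer_bar p X bar \<alpha> n = voltage_bar X bar (\<Gamma> p n) (\<pi> p n \<circ> \<alpha>)"

lemma bidirected_layer_graph: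
  assumes "p > 0" and "bidirected_digraph X bar"
    and "\<And>s. s \<in> arcs X \<Longrightarrow> \<alpha> s \<in> carrier (Zp p)"
    and "\<And>s. s \<in> arcs X \<Longrightarrow> \<alpha> (bar s) = inv\<^bsub>Zp p\<^esub> (\<alpha> s)"
  shows "bidirected_digraph (layer_graph p X \<G> \<alpha> n) (layer_bar p X bar \<alpha> n)"
proof -
  interpret N: normal "pow_Zp p n" "Zp p" by (rule normal_pow_Zp[OF assms(1)])
  show ?thesis
    unfolding layer_graph_def layer_bar_def
  proof (rule bidirected_voltage_graph[OF assms(2)])
    show "group (\<Gamma> p n)" unfolding \<Gamma>_def by (rule N.factorgroup_is_group)
    show "(\<pi> p n \<circ> \<alpha>) s \<in> carrier (\<Gamma> p n)" if "s \<in> arcs X" for s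
      using assms(3)[OF that] by (auto simp: \<Gamma>_def \<pi>_def FactGroup_def RCOSETS_def)
    show "(\<pi> p n \<circ> \<alpha>) (bar s) = inv\<^bsub>\<Gamma> p n\<^esub> ((\<pi> p n \<circ> \<alpha>) s)" if "s \<in> arcs X" for s
    proof -
      have "pow_Zp p n #>\<^bsub>Zp p\<^esub> \<alpha> s \<in> carrier (Zp p Mod pow_Zp p n)"
        using assms(3)[OF that] by (auto simp: FactGroup_def RCOSETS_def)
      then show ?thesis
        using assms(3,4)[OF that] by (simp add: \<Gamma>_def \<pi>_def N.inv_FactGroup N.rcos_inv)
    qed
  qed
qed

end

theory Submission
  imports
    Defs
    "Jordan_Normal_Form.Determinant"
    "HOL-Computational_Algebra.Polynomial_Factorial"
begin

text \<open>
  By the matrix tree theorem the number of spanning trees of the layer \<open>X\<^sub>n\<close> is a reduced determinant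
  of its Laplacian. Adding to the Laplacian a rank one matrix supported on one fibre of \<open>X\<^sub>n \<rightarrow> X\<close>
  makes it invertible without destroying the action of \<open>\<int>/p\<^sup>n\<close>, so that its determinant is the
  product, over the characters \<open>c \<mapsto> z\<^sup>c\<close> with \<open>z ^ (p ^ n) = 1\<close>, of the determinants of small
  matrices indexed by those vertices of \<open>X\<close> on whose group the character is trivial. From some level
  on, the new characters of level \<open>n + 1\<close> only see the vertices with trivial group and contribute
  the product of \<open>f(z)\<close> over the primitive \<open>p ^ (n + 1)\<close>-th roots of unity \<open>z\<close>, where \<open>f\<close> is a
  determinant in the Iwasawa algebra. If \<open>p ^ \<mu>\<close> is the content of \<open>f\<close> and \<open>l\<close> the order of
  vanishing of \<open>f / p ^ \<mu>\<close> modulo \<open>p\<close> at \<open>z = 1\<close>, this product has valuation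
  \<open>\<mu> (p ^ (n + 1) - p ^ n) + l\<close>, and summing over \<open>n\<close> gives the formula.
\<close>

section \<open>Determinants indexed by finite sets\<close>

text \<open>The norms of the new characters live in cyclotomic fields, but no valuation is extended
  there: one computes in the complex numbers and compares with rational \<open>p\<close>-units. The
  price is an exponent \<open>phi = p^(n+1) - p^n\<close>: at a primitive root \<open>z\<close> the
  number \<open>p\<close> is a unit times \<open>(z - 1)^phi\<close>, so the norm is controlled
  after taking \<open>phi\<close>-th powers, and \<open>phi\<close> is cancelled at the end. The
  Iwasawa algebra appears only as a sequence of integer polynomials compatible modulo
  \<open>x^(p^k) - 1\<close>. The slope is \<open>l + ram_count - 1\<close>. On characters, the rows
  over \<open>v\<close> carry the order of the stabilisers over \<open>v\<close> as a factor; past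
  the last depth, taking these factors out adds \<open>ram_count\<close> at each step. The rank one
  term costs \<open>p^n\<close> at level \<open>n\<close>, hence one power of \<open>p\<close> per
  step. The slope is nonnegative: either some group is nontrivial and \<open>ram_count >= 1\<close>,
  or \<open>f\<close> is the determinant of the full twisted Laplacian, which is singular at
  \<open>z = 1\<close>, and \<open>l >= 1\<close>. That the norms do not vanish is read back from
  the positive number of spanning trees of a connected layer.\<close>

definition detS :: "'a set \<Rightarrow> ('a \<Rightarrow> 'a \<Rightarrow> 'b::comm_ring_1) \<Rightarrow> 'b" where
  "detS S A = (\<Sum>q | q permutes S. of_int (sign q) * (\<Prod>i\<in>S. A i (q i)))"

lemma detS_cong:
  assumes "\<And>i j. i \<in> S \<Longrightarrow> j \<in> S \<Longrightarrow> A i j = B i j"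
  shows "detS S A = detS S B"
  unfolding detS_def
proof (rule sum.cong[OF refl])
  fix q assume "q \<in> {q. q permutes S}"
  then have "(\<Prod>i\<in>S. A i (q i)) = (\<Prod>i\<in>S. B i (q i))"
    by (intro prod.cong refl assms) (auto simp: permutes_in_image)
  then show "of_int (sign q) * (\<Prod>i\<in>S. A i (q i)) = of_int (sign q) * (\<Prod>i\<in>S. B i (q i))"
    by simp
qed

lemma detS_empty [simp]: "detS {} A = 1"
  by (simp add: detS_def)

lemma detS_singleton [simp]: "detS {v} A = A v v"
  by (simp add: detS_def)

lemma detS_eq_det: "detS {0..<n} A = det (mat n n (\<lambda>(i, j). A i j))"
  unfolding detS_def det_def
  by (auto simp: permutes_in_image intro!: sum.cong prod.cong)

text \<open>The index sets below consist of vertices, residues, roots of unity and pairs of these,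
  none with a preferred order; this links them with one another and with matrices indexed by
  \<open>{0..<n}\<close>.\<close>

lemma detS_reindex:
  assumes f: "bij_betw f S T" and S: "finite S"
  shows "detS S (\<lambda>i j. A (f i) (f j)) = detS T A"
  unfolding detS_def
proof (rule sum.reindex_bij_witness[where i = "map_permutation T (inv_into S f)"
        and j = "map_permutation S f"])
  have inj: "inj_on f S" using f by (rule bij_betw_imp_inj_on)
  have g: "bij_betw (inv_into S f) T S" using f by (rule bij_betw_inv_into)
  fix q assume q: "q \<in> {q. q permutes S}"
  then show "map_permutation T (inv_into S f) (map_permutation S f q) = q"
    by (intro map_permutation_compose_inv[OF f]) (auto simp: inj)
  show "map_permutation S f q \<in> {q. q permutes T}"
    using map_permutation_permutes[OF f] q by auto
  have "(\<Prod>i\<in>T. A i (map_permutation S f q i)) = (\<Prod>i\<in>S. A (f i) (map_permutation S f q (f i)))"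
    by (rule prod.reindex_bij_betw[OF f, symmetric])
  then show "of_int (sign (map_permutation S f q)) * (\<Prod>i\<in>T. A i (map_permutation S f q i))
      = of_int (sign q) * (\<Prod>i\<in>S. A (f i) (f (q i)))"
    using q S by (simp add: sign_map_permutation[OF inj] map_permutation_apply[OF inj])
next
  have g: "bij_betw (inv_into S f) T S" using f by (rule bij_betw_inv_into)
  fix q assume q: "q \<in> {q. q permutes T}"
  then show "map_permutation S f (map_permutation T (inv_into S f) q) = q"
    by (intro map_permutation_compose_inv[OF g]) (auto simp: bij_betw_inv_into_right[OF f])
  show "map_permutation T (inv_into S f) q \<in> {q. q permutes S}"
    using map_permutation_permutes[OF g] q by auto
qed

lemma detS_mult:
  assumes "finite S"
  shows "detS S (\<lambda>i j. \<Sum>k\<in>S. A i k * B k j) = detS S A * detS S B"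
proof -
  obtain e where e: "bij_betw e {0..<card S} S" using ex_bij_betw_nat_finite[OF assms] by blast
  have m: "detS S C = det (mat (card S) (card S) (\<lambda>(i, j). C (e i) (e j)))" for C
    using detS_reindex[OF e, of C] by (simp add: detS_eq_det)
  have "mat (card S) (card S) (\<lambda>(i, j). \<Sum>k\<in>S. A (e i) k * B k (e j))
      = mat (card S) (card S) (\<lambda>(i, j). A (e i) (e j)) * mat (card S) (card S) (\<lambda>(i, j). B (e i) (e j))"
    by (rule eq_matI) (auto simp: scalar_prod_def sum.reindex_bij_betw[OF e, symmetric])
  then show ?thesis by (simp add: m det_mult[of _ "card S"])
qed

lemma detS_transpose:
  assumes "finite S"
  shows "detS S (\<lambda>i j. A j i) = detS S A"
proof -
  obtain e where e: "bij_betw e {0..<card S} S" using ex_bij_betw_nat_finite[OF assms] by blast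
  have m: "detS S C = det (mat (card S) (card S) (\<lambda>(i, j). C (e i) (e j)))" for C
    using detS_reindex[OF e, of C] by (simp add: detS_eq_det)
  have "mat (card S) (card S) (\<lambda>(i, j). A (e j) (e i)) = (mat (card S) (card S) (\<lambda>(i, j). A (e i) (e j)))\<^sup>T"
    by (rule eq_matI) auto
  then show ?thesis by (simp add: m det_transpose[of _ "card S"])
qed

lemma detS_block_triangular:
  fixes A :: "'a \<Rightarrow> 'a \<Rightarrow> 'b::idom"
  assumes "finite S" "finite T" "S \<inter> T = {}"
    and zero: "\<And>i j. i \<in> S \<Longrightarrow> j \<in> T \<Longrightarrow> A i j = 0"
  shows "detS (S \<union> T) A = detS S A * detS T A"
proof -
  obtain f where f: "bij_betw f {0..<card S} S" using ex_bij_betw_nat_finite[OF assms(1)] by blast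
  obtain g where g: "bij_betw g {0..<card T} T" using ex_bij_betw_nat_finite[OF assms(2)] by blast
  let ?n = "card S" and ?m = "card T"
  define e where "e k = (if k < ?n then f k else g (k - ?n))" for k
  have "bij_betw (\<lambda>k. k - ?n) {?n..<?n + ?m} {0..<?m}"
    by (rule bij_betw_byWitness[where f' = "\<lambda>k. k + ?n"]) auto
  then have "bij_betw (g \<circ> (\<lambda>k. k - ?n)) {?n..<?n + ?m} T" using g by (rule bij_betw_trans)
  then have "bij_betw e {?n..<?n + ?m} T" by (rule iffD1[OF bij_betw_cong, rotated]) (auto simp: e_def)
  moreover have "bij_betw e {0..<?n} S"
    using f by (rule iffD1[OF bij_betw_cong, rotated]) (auto simp: e_def)
  ultimately have "bij_betw e ({0..<?n} \<union> {?n..<?n + ?m}) (S \<union> T)"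
    using assms(3) by (intro bij_betw_combine) auto
  then have e: "bij_betw e {0..<?n + ?m} (S \<union> T)" by (simp add: ivl_disj_un)
  let ?M1 = "mat ?n ?n (\<lambda>(i, j). A (f i) (f j))"
    and ?M3 = "mat ?m ?n (\<lambda>(i, j). A (g i) (f j))"
    and ?M4 = "mat ?m ?m (\<lambda>(i, j). A (g i) (g j))"
  have "mat (?n + ?m) (?n + ?m) (\<lambda>(i, j). A (e i) (e j)) = four_block_mat ?M1 (0\<^sub>m ?n ?m) ?M3 ?M4"
  proof (rule eq_matI)
    fix i j assume "i < dim_row (four_block_mat ?M1 (0\<^sub>m ?n ?m) ?M3 ?M4)"
      "j < dim_col (four_block_mat ?M1 (0\<^sub>m ?n ?m) ?M3 ?M4)"
    moreover have "A (f i) (g (j - ?n)) = 0" if "i < ?n" "\<not> j < ?n" "j < ?n + ?m"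
      using that bij_betwE[OF f] bij_betwE[OF g] by (intro zero) auto
    ultimately show "mat (?n + ?m) (?n + ?m) (\<lambda>(i, j). A (e i) (e j)) $$ (i, j)
        = four_block_mat ?M1 (0\<^sub>m ?n ?m) ?M3 ?M4 $$ (i, j)"
      by (auto simp: e_def)
  qed auto
  then have "det (mat (?n + ?m) (?n + ?m) (\<lambda>(i, j). A (e i) (e j))) = det ?M1 * det ?M4"
    using det_four_block_mat_upper_right_zero[of ?M1 ?n "0\<^sub>m ?n ?m" ?m ?M3 ?M4] by simp
  then show ?thesis
    using detS_reindex[OF e, of A] detS_reindex[OF f, of A] detS_reindex[OF g, of A]
    by (simp add: detS_eq_det)
qed

lemma detS_insert_row:
  fixes A :: "'a \<Rightarrow> 'a \<Rightarrow> 'b::idom"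
  assumes "finite S" "v \<notin> S" "\<And>w. w \<in> S \<Longrightarrow> A v w = 0"
  shows "detS (insert v S) A = A v v * detS S A"
  using detS_block_triangular[of "{v}" S A] assms by auto

lemma detS_insert_column:
  fixes A :: "'a \<Rightarrow> 'a \<Rightarrow> 'b::idom"
  assumes "finite S" "v \<notin> S" "\<And>w. w \<in> S \<Longrightarrow> A w v = 0"
  shows "detS (insert v S) A = A v v * detS S A"
  using detS_block_triangular[of S "{v}" A] assms by (auto simp: mult.commute)

lemma detS_diagonal:
  fixes d :: "'a \<Rightarrow> 'b::idom"
  assumes "finite S"
  shows "detS S (\<lambda>i j. if i = j then d i else 0) = (\<Prod>i\<in>S. d i)"
  using assms
proof (induction S)
  case (insert v S)
  then show ?case by (subst detS_insert_row) auto
qed simp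

text \<open>Serves to separate characters: the first component will be a root of unity
  \<open>z\<close>, and \<open>S z\<close> the vertices it sees.\<close>

lemma detS_Sigma:
  fixes A :: "'a \<times> 'b \<Rightarrow> 'a \<times> 'b \<Rightarrow> 'c::idom"
  assumes "finite Z" "\<And>z. z \<in> Z \<Longrightarrow> finite (S z)"
    and "\<And>z z' i j. z \<noteq> z' \<Longrightarrow> A (z, i) (z', j) = 0"
  shows "detS (Sigma Z S) A = (\<Prod>z\<in>Z. detS (S z) (\<lambda>i j. A (z, i) (z, j)))"
  using assms
proof (induction Z)
  case (insert z Z)
  have "Sigma (insert z Z) S = Pair z ` S z \<union> Sigma Z S" by auto
  moreover have "detS (Pair z ` S z \<union> Sigma Z S) A = detS (Pair z ` S z) A * detS (Sigma Z S) A"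
    using insert.hyps insert.prems by (intro detS_block_triangular) (auto, metis)
  moreover have "detS (Pair z ` S z) A = detS (S z) (\<lambda>i j. A (z, i) (z, j))"
    using insert by (intro detS_reindex[symmetric] inj_on_imp_bij_betw) (auto simp: inj_on_def)
  ultimately show ?case using insert by simp
qed simp

lemma detS_eq_0I:
  fixes A :: "'a \<Rightarrow> 'a \<Rightarrow> 'b::field"
  assumes S: "finite S" and v: "v \<in> S" "x v \<noteq> 0"
    and kernel: "\<And>i. i \<in> S \<Longrightarrow> (\<Sum>j\<in>S. A i j * x j) = 0"
  shows "detS S A = 0"
proof -
  obtain e where e: "bij_betw e {0..<card S} S" using ex_bij_betw_nat_finite[OF S] by blast
  let ?M = "mat (card S) (card S) (\<lambda>(i, j). A (e i) (e j))" and ?x = "vec (card S) (\<lambda>i. x (e i))"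
  have "?M *\<^sub>v ?x = 0\<^sub>v (card S)"
  proof (rule eq_vecI)
    fix i assume "i < dim_vec (0\<^sub>v (card S) :: 'b vec)"
    then have "i < card S" by simp
    then have "e i \<in> S" using bij_betwE[OF e] by auto
    then show "(?M *\<^sub>v ?x) $ i = 0\<^sub>v (card S) $ i"
      using kernel[of "e i"] \<open>i < card S\<close>
      by (simp add: scalar_prod_def sum.reindex_bij_betw[OF e, of "\<lambda>j. A (e i) j * x j"])
  qed auto
  moreover have "?x \<noteq> 0\<^sub>v (card S)"
  proof
    obtain i where i: "i < card S" "v = e i" 
      using v(1) bij_betw_imp_surj_on[OF e] by (metis atLeastLessThan_iff imageE)
    assume "?x = 0\<^sub>v (card S)"
    then have "?x $ i = 0\<^sub>v (card S) $ i" by simp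
    then show False using i v(2) by simp
  qed
  ultimately have "det ?M = 0"
    by (subst det_0_iff_vec_prod_zero_field[of _ "card S"]) (auto intro!: exI[of _ ?x])
  then show ?thesis using detS_reindex[OF e, of A] by (simp add: detS_eq_det)
qed

lemma detS_scale_rows:
  "detS S (\<lambda>i j. c i * A i j) = (\<Prod>i\<in>S. c i) * detS S A"
  by (simp add: detS_def prod.distrib sum_distrib_left mult_ac)

lemma detS_hom:
  fixes A :: "'a \<Rightarrow> 'a \<Rightarrow> 'b::comm_ring_1" and h :: "'b \<Rightarrow> 'c::comm_ring_1"
  assumes hom_add: "\<And>x y. h (x + y) = h x + h y" and hom_mult: "\<And>x y. h (x * y) = h x * h y"
    and hom_one: "h 1 = 1"
  shows "h (detS S A) = detS S (\<lambda>i j. h (A i j))"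
proof -
  have zero: "h 0 = 0" using hom_add[of 0 0] by simp
  have "h (x + - x) = h x + h (- x)" for x by (rule hom_add)
  then have minus: "h (- x) = - h x" for x using zero by (simp add: eq_neg_iff_add_eq_0 add.commute)
  have prod: "h (prod g T) = prod (\<lambda>i. h (g i)) T" for g and T :: "'a set"
    by (induction T rule: infinite_finite_induct) (simp_all add: hom_one hom_mult)
  have sum: "h (sum g T) = sum (\<lambda>i. h (g i)) T" for g and T :: "('a \<Rightarrow> 'a) set"
    by (induction T rule: infinite_finite_induct) (simp_all add: zero hom_add)
  have "h (of_int (sign q)) = of_int (sign q)" for q :: "'a \<Rightarrow> 'a"
    by (auto simp: sign_def hom_one minus)
  then show ?thesis by (simp add: detS_def sum prod hom_mult)
qed

text \<open>The determinant is an integer polynomial in the entries, and congruences respect these.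
  The moduli will be the prime \<open>p\<close> and the polynomial
  \<open>x^(p^n) - 1\<close>.\<close>

lemma detS_dvd_diff:
  assumes S: "finite S" and dvd: "\<And>i j. i \<in> S \<Longrightarrow> j \<in> S \<Longrightarrow> m dvd A i j - B i j"
  shows "m dvd detS S A - detS S B"
proof -
  have prod: "m dvd prod f T - prod g T" if "finite T" "\<And>i. i \<in> T \<Longrightarrow> m dvd f i - g i"
    for f g and T :: "'a set"
    using that
  proof (induction T)
    case (insert i T)
    have "prod f (insert i T) - prod g (insert i T)
        = (f i - g i) * prod f T + g i * (prod f T - prod g T)"
      using insert by (simp add: algebra_simps)
    then show ?case using insert by simp
  qed simp
  have "detS S A - detS S B = (\<Sum>q | q permutes S.
      of_int (sign q) * ((\<Prod>i\<in>S. A i (q i)) - (\<Prod>i\<in>S. B i (q i))))"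
    by (simp add: detS_def sum_subtractf right_diff_distrib)
  also have "m dvd \<dots>"
  proof (intro dvd_sum dvd_mult prod[OF S] dvd)
    fix q i assume "q \<in> {q. q permutes S}" "i \<in> S"
    then show "q i \<in> S" by (simp add: permutes_in_image)
  qed
  finally show ?thesis .
qed

text \<open>Multilinearity in the rows; for the Laplacian it selects one outgoing edge at each
  vertex.\<close>

lemma detS_sum_rows:
  assumes "finite S" "\<And>i. i \<in> S \<Longrightarrow> finite (C i)"
  shows "detS S (\<lambda>i j. \<Sum>c\<in>C i. A i c j) = (\<Sum>f\<in>Pi\<^sub>E S C. detS S (\<lambda>i j. A i (f i) j))"
  unfolding detS_def
  by (subst sum.swap) (simp add: prod_sum_PiE[OF assms] sum_distrib_left)

text \<open>\<open>F\<close> is a change of basis: with equal cardinalities the one-sided inverse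
  \<open>F'\<close> makes its determinant nonzero, so it cancels from \<open>L F = F B\<close>. The
  columns of \<open>F\<close> will be characters.\<close>

lemma detS_similar:
  fixes L :: "'a \<Rightarrow> 'a \<Rightarrow> 'c::idom" and B :: "'b \<Rightarrow> 'b \<Rightarrow> 'c"
  assumes V: "finite V" and W: "finite W" and card: "card V = card W"
    and inverse: "\<And>i j. i \<in> W \<Longrightarrow> j \<in> W \<Longrightarrow> (\<Sum>x\<in>V. F' i x * F x j) = (if i = j then 1 else 0)"
    and intertwine: "\<And>x j. x \<in> V \<Longrightarrow> j \<in> W \<Longrightarrow> (\<Sum>y\<in>V. L x y * F y j) = (\<Sum>i\<in>W. F x i * B i j)"
  shows "detS V L = detS W B"
proof -
  obtain b where b: "bij_betw b W V"
    using finite_same_card_bij[OF W V] card by auto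
  let ?F = "\<lambda>i j. F (b i) j" and ?F' = "\<lambda>i j. F' i (b j)" and ?L = "\<lambda>i j. L (b i) (b j)"
  have bW: "b i \<in> V" if "i \<in> W" for i using b that by (auto simp: bij_betw_def)
  have "detS W ?F' * detS W ?F = detS W (\<lambda>i j. if i = j then 1 else 0)"
    unfolding detS_mult[OF W, symmetric]
    by (intro detS_cong) (simp add: inverse sum.reindex_bij_betw[OF b, of "\<lambda>x. F' _ x * F x _"])
  then have F: "detS W ?F \<noteq> 0" using detS_diagonal[OF W, of "\<lambda>_. 1::'c"] by auto
  have "detS W ?L * detS W ?F = detS W ?F * detS W B"
    unfolding detS_mult[OF W, symmetric]
    by (intro detS_cong) (simp add: intertwine bW sum.reindex_bij_betw[OF b, of "\<lambda>y. L _ y * F y _"])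
  then have "detS W ?L = detS W B" using F by (simp add: mult.commute)
  then show ?thesis using detS_reindex[OF b W, of L] by simp
qed

text \<open>When all row and column sums of \<open>L\<close> vanish, all its cofactors agree, so the
  rank one term contributes one cofactor times the sums of \<open>u\<close> and \<open>w\<close>.
  The proof carries this out by row and column operations.\<close>

lemma detS_add_rank_one:
  fixes L :: "'a \<Rightarrow> 'a \<Rightarrow> 'b::field"
  assumes S: "finite S" "r \<in> S"
    and rows: "\<And>i. i \<in> S \<Longrightarrow> (\<Sum>j\<in>S. L i j) = 0"
    and cols: "\<And>j. j \<in> S \<Longrightarrow> (\<Sum>i\<in>S. L i j) = 0"
    and u: "(\<Sum>i\<in>S. u i) \<noteq> 0"
  shows "detS S (\<lambda>i j. L i j + u i * w j) = (\<Sum>i\<in>S. u i) * (\<Sum>j\<in>S. w j) * detS (S - {r}) L"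
proof -
  define U where "U = (\<Sum>i\<in>S. u i)"
  define W where "W = (\<Sum>j\<in>S. w j)"
  define M where "M i j = L i j + u i * w j" for i j
  \<comment> \<open>Multiplying by \<open>C\<close> on the right puts the sum of all columns into
    column \<open>r\<close>, and its transpose on the left does the same for rows. \<open>E\<close>
    then subtracts \<open>u i / U\<close> times row \<open>r\<close> from row \<open>i\<close>,
    which clears the rank one term there together with the entry in column \<open>r\<close>.\<close>
  define C :: "'a \<Rightarrow> 'a \<Rightarrow> 'b" where "C i j = (if j = r \<or> i = j then 1 else 0)" for i j
  define E where "E i j = (if i = j then 1 else if j = r then - (u i / U) else 0)" for i j
  have S': "finite (S - {r})" "insert r (S - {r}) = S" using S by auto
  have one: "detS T (\<lambda>i j. if i = j then 1 else 0) = (1::'b)" if "finite T" for T :: "'a set"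
    using detS_diagonal[OF that, of "\<lambda>_. 1"] by simp
  have C: "detS S C = 1"
  proof -
    have "detS S C = C r r * detS (S - {r}) C"
      using detS_insert_row[OF S'(1), of r C] S' by (force simp: C_def)
    moreover have "detS (S - {r}) C = detS (S - {r}) (\<lambda>i j. if i = j then 1 else 0)"
      by (rule detS_cong) (auto simp: C_def)
    ultimately show ?thesis using one[OF S'(1)] by (simp add: C_def)
  qed
  have E: "detS S E = 1"
  proof -
    have "detS S E = E r r * detS (S - {r}) E"
      using detS_insert_row[OF S'(1), of r E] S' by (force simp: E_def)
    moreover have "detS (S - {r}) E = detS (S - {r}) (\<lambda>i j. if i = j then 1 else 0)"
      by (rule detS_cong) (auto simp: E_def)
    ultimately show ?thesis using one[OF S'(1)] by (simp add: E_def)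
  qed
  have Mrow: "(\<Sum>j\<in>S. M i j) = u i * W" if "i \<in> S" for i
    using rows[OF that] by (simp add: M_def W_def sum.distrib sum_distrib_left)
  have Mcol: "(\<Sum>i\<in>S. M i j) = U * w j" if "j \<in> S" for j
    using cols[OF that] by (simp add: M_def U_def sum.distrib sum_distrib_right)
  define M1 where "M1 i j = (if j = r then u i * W else M i j)" for i j
  define M2 where "M2 i j = (if i = r then if j = r then U * W else U * w j else M1 i j)" for i j
  define M3 where "M3 i j = (if i = r then M2 i j else if j = r then 0 else L i j)" for i j
  have M1: "(\<Sum>k\<in>S. M i k * C k j) = M1 i j" if "i \<in> S" "j \<in> S" for i j
  proof (cases "j = r")
    case True then show ?thesis using Mrow[OF that(1)] by (simp add: C_def M1_def)
  next
    case False
    then have "(\<Sum>k\<in>S. M i k * C k j) = (\<Sum>k\<in>S. if k = j then M i k else 0)"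
      by (intro sum.cong) (auto simp: C_def)
    then show ?thesis using S that False by (simp add: M1_def)
  qed
  have M2: "(\<Sum>k\<in>S. C k i * M1 k j) = M2 i j" if "i \<in> S" "j \<in> S" for i j
  proof (cases "i = r")
    case True
    have "(\<Sum>k\<in>S. u k * W) = U * W" by (simp add: U_def sum_distrib_right)
    then show ?thesis using Mcol[OF that(2)] True by (simp add: C_def M1_def M2_def)
  next
    case False
    then have "(\<Sum>k\<in>S. C k i * M1 k j) = (\<Sum>k\<in>S. if k = i then M1 k j else 0)"
      by (intro sum.cong) (auto simp: C_def)
    then show ?thesis using S that False by (simp add: M2_def)
  qed
  have M3: "(\<Sum>k\<in>S. E i k * M2 k j) = M3 i j" if "i \<in> S" "j \<in> S" for i j
  proof (cases "i = r")
    case True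
    then have "(\<Sum>k\<in>S. E i k * M2 k j) = (\<Sum>k\<in>S. if k = i then M2 k j else 0)"
      by (intro sum.cong) (auto simp: E_def)
    then show ?thesis using S that True by (simp add: M3_def)
  next
    case False
    then have "(\<Sum>k\<in>S. E i k * M2 k j)
        = (\<Sum>k\<in>S. (if k = i then M2 k j else 0) + (if k = r then - (u i / U) * M2 k j else 0))"
      by (intro sum.cong) (auto simp: E_def)
    also have "\<dots> = M2 i j - u i / U * M2 r j" using S that by (simp add: sum.distrib)
    also have "\<dots> = M3 i j" using False u by (auto simp: M2_def M1_def M3_def M_def U_def)
    finally show ?thesis .
  qed
  have "detS S M = detS S M1"
    using C detS_mult[OF S(1), of M C] detS_cong[OF M1, where S = S] by simp
  also have "\<dots> = detS S M2"
    using C detS_mult[OF S(1), of "\<lambda>i k. C k i" M1] detS_cong[OF M2, where S = S]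
      detS_transpose[OF S(1), of C] by simp
  also have "\<dots> = detS S M3"
    using E detS_mult[OF S(1), of E M2] detS_cong[OF M3, where S = S] by simp
  also have "\<dots> = M3 r r * detS (S - {r}) M3"
    using detS_insert_column[OF S'(1), of r M3] S' by (auto simp: M3_def)
  also have "\<dots> = U * W * detS (S - {r}) L"
  proof -
    have "detS (S - {r}) M3 = detS (S - {r}) L" by (rule detS_cong) (simp add: M3_def)
    then show ?thesis by (simp add: M3_def M2_def)
  qed
  finally show ?thesis by (simp add: M_def[abs_def] U_def W_def)
qed

section \<open>The matrix tree theorem\<close>

locale finite_serre_graph = bidirected_digraph G bar + fin_digraph G
  for G :: "('a, 'b) pre_digraph" and bar
begin

text \<open>Degree minus adjacency, kept as a sum over outgoing edges so that each row is a sum of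
  rows of single edges. Loops cancel.\<close>

definition laplacian :: "'a \<Rightarrow> 'a \<Rightarrow> 'c::field" where
  "laplacian x y = (\<Sum>e\<in>out_arcs G x. of_bool (x = y) - of_bool (head G e = y))"

lemma finite_out_arcs [simp]: "finite (out_arcs G x)"
  by (simp add: out_arcs_def)

lemma laplacian_row_sum: "x \<in> verts G \<Longrightarrow> (\<Sum>y\<in>verts G. laplacian x y) = 0"
  unfolding laplacian_def
  by (subst sum.swap) (auto simp: sum_subtractf out_arcs_def of_bool_def intro!: sum.neutral)

text \<open>The involution exchanges origins and termini, so as many edges enter \<open>y\<close> as
  leave it.\<close>

lemma laplacian_column_sum: "y \<in> verts G \<Longrightarrow> (\<Sum>x\<in>verts G. laplacian x y) = (0::'c::field)"
proof -
  assume "y \<in> verts G"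
  have "(\<Sum>x\<in>verts G. laplacian x y)
      = (\<Sum>x\<in>verts G. \<Sum>e\<in>{e \<in> arcs G. tail G e = x}. of_bool (tail G e = y) - of_bool (head G e = y) :: 'c)"
    unfolding laplacian_def out_arcs_def by (intro sum.cong) auto
  also have "\<dots> = (\<Sum>e\<in>arcs G. of_bool (tail G e = y) - of_bool (head G e = y))"
    by (rule sum.group) auto
  also have "\<dots> = (\<Sum>e\<in>arcs G. of_bool (tail G e = y)) - (\<Sum>e\<in>arcs G. of_bool (head G e = y))"
    by (rule sum_subtractf)
  also have "(\<Sum>e\<in>arcs G. of_bool (tail G e = y) :: 'c) = (\<Sum>e\<in>arcs G. of_bool (tail G (bar e) = y))"
    using sum.permute[OF arev_permutes_arcs, of "\<lambda>e. of_bool (tail G e = y) :: 'c"] by (simp add: o_def)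
  also have "\<dots> = (\<Sum>e\<in>arcs G. of_bool (head G e = y))"
    by (intro sum.cong) auto
  finally show ?thesis by simp
qed

section \<open>Spanning trees as parent functions towards a root\<close>

definition choices :: "'a \<Rightarrow> ('a \<Rightarrow> 'b) set" where
  "choices r = Pi\<^sub>E (verts G - {r}) (out_arcs G)"

text \<open>The rank \<open>d\<close> certifies that following the chosen edges runs into no cycle
  and hence ends at \<open>r\<close>.\<close>

definition ranked :: "'a \<Rightarrow> ('a \<Rightarrow> 'b) \<Rightarrow> bool" where
  "ranked r s \<longleftrightarrow> (\<exists>d :: 'a \<Rightarrow> nat. \<forall>v\<in>verts G - {r}. d (head G (s v)) < d v)"

definition tree_of :: "'a \<Rightarrow> ('a \<Rightarrow> 'b) \<Rightarrow> ('a, 'b) pre_digraph" where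
  "tree_of r s = G\<lparr>arcs := s ` (verts G - {r}) \<union> bar ` s ` (verts G - {r})\<rparr>"

lemma choicesD:
  assumes "s \<in> choices r" "v \<in> verts G - {r}"
  shows "s v \<in> arcs G" "tail G (s v) = v" "head G (s v) \<in> verts G"
  using assms by (auto simp: choices_def out_arcs_def PiE_iff)

text \<open>A vertex of least rank in \<open>S\<close> has the head of its edge outside
  \<open>S\<close>, so its row is a unit vector and can be split off.\<close>

lemma detS_choice_ranked:
  fixes d :: "'a \<Rightarrow> nat"
  assumes "finite S" "\<And>v. v \<in> S \<Longrightarrow> d (head G (s v)) < d v"
  shows "detS S (\<lambda>v w. of_bool (v = w) - of_bool (head G (s v) = w)) = (1::'c::field)"
  using assms
proof (induction S rule: finite_psubset_induct)
  case (psubset S)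
  show ?case
  proof (cases "S = {}")
    case False
    then obtain v where v: "v \<in> S" "\<And>w. w \<in> S \<Longrightarrow> d v \<le> d w"
      using ex_min_if_finite[of "d ` S"] psubset.hyps by (metis arg_min_if_finite(1) arg_min_least)
    then have head: "head G (s v) \<notin> S" using psubset.prems[of v] by (auto simp: not_le[symmetric])
    have "detS (insert v (S - {v})) (\<lambda>v w. of_bool (v = w) - of_bool (head G (s v) = w) :: 'c)
        = (of_bool (v = v) - of_bool (head G (s v) = v))
          * detS (S - {v}) (\<lambda>v w. of_bool (v = w) - of_bool (head G (s v) = w))"
      using psubset.hyps head by (intro detS_insert_row) auto
    also have "detS (S - {v}) (\<lambda>v w. of_bool (v = w) - of_bool (head G (s v) = w)) = (1::'c)"
      using v psubset.prems by (intro psubset.IH) auto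
    finally show ?thesis using v(1) head by (auto simp: insert_absorb)
  qed simp
qed

text \<open>A vertex lies in the set \<open>C\<close> of vertices that never reach \<open>r\<close>
  exactly if the head of its chosen edge does, so the indicator vector of \<open>C\<close> lies in
  the kernel.\<close>

lemma detS_choice_unranked:
  assumes s: "s \<in> choices r" and r: "r \<in> verts G" and unranked: "\<not> ranked r s"
  shows "detS (verts G - {r}) (\<lambda>v w. of_bool (v = w) - of_bool (head G (s v) = w)) = (0::'c::field)"
proof -
  define N where "N v = (if v = r then r else head G (s v))" for v
  define C where "C = {v \<in> verts G. \<forall>i. (N ^^ i) v \<noteq> r}"
  have C_step: "v \<in> C \<longleftrightarrow> head G (s v) \<in> C" if v: "v \<in> verts G - {r}" for v
  proof -
    have "(\<forall>i. (N ^^ i) v \<noteq> r) \<longleftrightarrow> (\<forall>i. (N ^^ i) (N v) \<noteq> r)"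
    proof
      assume "\<forall>i. (N ^^ i) v \<noteq> r"
      then show "\<forall>i. (N ^^ i) (N v) \<noteq> r" by (metis funpow_Suc_right o_apply)
    next
      assume *: "\<forall>i. (N ^^ i) (N v) \<noteq> r"
      show "\<forall>i. (N ^^ i) v \<noteq> r"
      proof
        fix i show "(N ^^ i) v \<noteq> r"
          using v * by (cases i) (auto simp: funpow_Suc_right simp del: funpow.simps(2))
      qed
    qed
    then show ?thesis using v choicesD(3)[OF s v] by (auto simp: C_def N_def)
  qed
  have "C \<noteq> {}"
  proof
    assume "C = {}"
    then have reach: "\<exists>i. (N ^^ i) v = r" if "v \<in> verts G" for v using that by (auto simp: C_def)
    \<comment> \<open>If every vertex reached \<open>r\<close>, the number of steps needed would be
      a rank for \<open>s\<close>.\<close>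
    define d where "d v = (LEAST i. (N ^^ i) v = r)" for v
    have "d (head G (s v)) < d v" if v: "v \<in> verts G - {r}" for v
    proof -
      have 1: "(N ^^ d v) v = r" unfolding d_def by (rule LeastI_ex) (use reach v in auto)
      then obtain i where i: "d v = Suc i" using v by (cases "d v") auto
      then have "(N ^^ i) (head G (s v)) = r"
        using 1 v by (auto simp: N_def funpow_Suc_right simp del: funpow.simps(2))
      then have "d (head G (s v)) \<le> i" unfolding d_def by (rule Least_le)
      then show ?thesis using i by simp
    qed
    then show False using unranked by (auto simp: ranked_def)
  qed
  then obtain v where v: "v \<in> C" by auto
  have "(N ^^ 0) r = r" by simp
  then have rC: "r \<notin> C" unfolding C_def by blast
  show ?thesis
  proof (rule detS_eq_0I[where x = "\<lambda>w. of_bool (w \<in> C)" and v = v])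
    show "v \<in> verts G - {r}" using v rC by (auto simp: C_def)
    fix u assume u: "u \<in> verts G - {r}"
    have "(\<Sum>w\<in>verts G - {r}. (of_bool (u = w) - of_bool (head G (s u) = w)) * of_bool (w \<in> C) :: 'c)
        = (\<Sum>w\<in>verts G - {r}. (if w = u then of_bool (w \<in> C) else 0)
            - (if w = head G (s u) then of_bool (w \<in> C) else 0))"
      by (intro sum.cong) auto
    also have "\<dots> = of_bool (u \<in> C) - of_bool (head G (s u) \<in> C)"
      using u choicesD(3)[OF s u] rC by (auto simp: sum_subtractf)
    finally show "(\<Sum>w\<in>verts G - {r}. (of_bool (u = w) - of_bool (head G (s u) = w)) * of_bool (w \<in> C)) = (0::'c)"
      using C_step[OF u] by simp
  qed (use v in auto)
qed

lemma finite_choices: "finite (choices r)"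
  unfolding choices_def by (intro finite_PiE) auto

lemma detS_laplacian:
  assumes "r \<in> verts G"
  shows "detS (verts G - {r}) laplacian = (of_nat (card {s \<in> choices r. ranked r s}) :: 'c::field)"
proof -
  have "detS (verts G - {r}) laplacian = (\<Sum>s\<in>choices r.
      detS (verts G - {r}) (\<lambda>v w. of_bool (v = w) - of_bool (head G (s v) = w)) :: 'c)"
    unfolding choices_def laplacian_def[abs_def] by (rule detS_sum_rows) auto
  also have "\<dots> = (\<Sum>s\<in>choices r. of_bool (ranked r s))"
  proof (rule sum.cong[OF refl])
    fix s assume s: "s \<in> choices r"
    show "detS (verts G - {r}) (\<lambda>v w. of_bool (v = w) - of_bool (head G (s v) = w))
        = (of_bool (ranked r s) :: 'c)"
    proof (cases "ranked r s")
      case True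
      then show ?thesis by (auto simp: ranked_def intro!: detS_choice_ranked)
    next
      case False
      then show ?thesis using detS_choice_unranked[OF s assms False] by simp
    qed
  qed
  also have "\<dots> = of_nat (card {s \<in> choices r. ranked r s})"
    using finite_choices by (simp add: of_bool_def sum.If_cases Int_def)
  finally show ?thesis .
qed

lemma tree_of_simps [simp]:
  "verts (tree_of r s) = verts G" "tail (tree_of r s) = tail G" "head (tree_of r s) = head G"
  "arcs (tree_of r s) = s ` (verts G - {r}) \<union> bar ` s ` (verts G - {r})"
  by (simp_all add: tree_of_def)

lemma spanning_bar_stable:
  assumes "spanning H G" "bar ` arcs H \<subseteq> arcs H"
  shows "wf_digraph H" "symmetric H" "verts H = verts G" "arcs H \<subseteq> arcs G" "tail H = tail G" "head H = head G"
proof -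
  show *: "wf_digraph H" "verts H = verts G" "arcs H \<subseteq> arcs G" "tail H = tail G" "head H = head G"
    using assms(1) by (auto simp: spanning_def subgraph_def compatible_def)
  show "symmetric H"
    unfolding symmetric_conv
  proof
    fix e assume "e \<in> arcs H"
    then show "\<exists>e'\<in>arcs H. tail H e = head H e' \<and> head H e = tail H e'"
      using assms(2) * by (intro bexI[of _ "bar e"]) auto
  qed
qed

lemma connected_spanning_iff:
  assumes "spanning H G" "bar ` arcs H \<subseteq> arcs H"
  shows "Digraph_Component.connected H
    \<longleftrightarrow> verts G \<noteq> {} \<and> (\<forall>u\<in>verts G. \<forall>v\<in>verts G. u \<rightarrow>\<^sup>*\<^bsub>H\<^esub> v)"
proof -
  interpret H: wf_digraph H using spanning_bar_stable(1)[OF assms] .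
  show ?thesis
    using spanning_bar_stable[OF assms]
    by (simp add: Digraph_Component.connected_def strongly_connected_def H.reachable_mk_symmetric_eq)
qed

text \<open>Breadth-first search: each vertex chooses the first edge of a shortest walk to
  \<open>r\<close> inside \<open>H\<close>, and the distance to \<open>r\<close> serves as
  rank.\<close>

lemma exists_ranked_choice:
  assumes H: "spanning H G" "bar ` arcs H \<subseteq> arcs H" "Digraph_Component.connected H" and r: "r \<in> verts G"
  obtains s where "s \<in> choices r" "ranked r s" "s ` (verts G - {r}) \<subseteq> arcs H"
proof -
  note H' = spanning_bar_stable[OF H(1,2)]
  interpret H: wf_digraph H by (rule H')
  define d where "d v = (LEAST n. \<exists>p. H.awalk v p r \<and> length p = n)" for v
  have "\<exists>e. e \<in> arcs H \<and> tail G e = v \<and> d (head G e) < d v" if v: "v \<in> verts G - {r}" for v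
  proof -
    have "v \<rightarrow>\<^sup>*\<^bsub>H\<^esub> r" using H(3) v r by (auto simp: connected_spanning_iff[OF H(1,2)])
    then have "\<exists>n p. H.awalk v p r \<and> length p = n" by (auto simp: H.reachable_awalk)
    then have "\<exists>p. H.awalk v p r \<and> length p = d v" unfolding d_def by (rule LeastI_ex)
    then obtain p where p: "H.awalk v p r" "length p = d v" by auto
    then obtain e es where es: "p = e # es" using v by (cases p) (auto simp: H.awalk_Nil_iff)
    then have "e \<in> arcs H" "tail H e = v" "H.awalk (head H e) es r"
      using p by (auto simp: H.awalk_Cons_iff)
    moreover have "d (head H e) \<le> length es"
      unfolding d_def by (rule Least_le) (use calculation in auto)
    ultimately show ?thesis using p es H' by auto
  qed
  then obtain f where f: "\<And>v. v \<in> verts G - {r} \<Longrightarrow> f v \<in> arcs H \<and> tail G (f v) = v \<and> d (head G (f v)) < d v"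
    by metis
  let ?s = "restrict f (verts G - {r})"
  have "?s \<in> choices r"
    unfolding choices_def
  proof (rule PiE_I)
    fix v assume v: "v \<in> verts G - {r}"
    then show "?s v \<in> out_arcs G v" using f[OF v] H'(4) by (auto simp: out_arcs_def)
  qed auto
  moreover have "ranked r ?s" unfolding ranked_def using f by (intro exI[of _ d]) simp
  moreover have "?s ` (verts G - {r}) \<subseteq> arcs H"
  proof
    fix e assume "e \<in> ?s ` (verts G - {r})"
    then obtain v where v: "v \<in> verts G - {r}" "e = ?s v" by blast
    then show "e \<in> arcs H" using f[OF v(1)] by simp
  qed
  ultimately show ?thesis by (rule that)
qed

lemma spanning_tree_of:
  assumes s: "s \<in> choices r"
  shows "spanning (tree_of r s) G" "bar ` arcs (tree_of r s) \<subseteq> arcs (tree_of r s)"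
proof -
  have "wf_digraph (tree_of r s)"
    using choicesD[OF s] by unfold_locales fastforce+
  then show "spanning (tree_of r s) G"
    using choicesD(1)[OF s] by (fastforce simp: spanning_def subgraph_def compatible_def wf_digraph)
  show "bar ` arcs (tree_of r s) \<subseteq> arcs (tree_of r s)" by (auto simp: image_image)
qed

lemma connected_tree_of:
  assumes s: "s \<in> choices r" and ranked: "ranked r s" and r: "r \<in> verts G"
  shows "Digraph_Component.connected (tree_of r s)"
proof -
  note T = spanning_tree_of[OF s]
  interpret T: wf_digraph "tree_of r s" by (rule spanning_bar_stable(1)[OF T])
  obtain d :: "'a \<Rightarrow> nat" where d: "\<And>v. v \<in> verts G - {r} \<Longrightarrow> d (head G (s v)) < d v"
    using ranked by (auto simp: ranked_def)
  have to_root: "v \<rightarrow>\<^sup>*\<^bsub>tree_of r s\<^esub> r" if "v \<in> verts G" for v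
    using that
  proof (induction "d v" arbitrary: v rule: less_induct)
    case less
    show ?case
    proof (cases "v = r")
      case False
      then have v: "v \<in> verts G - {r}" using less.prems by simp
      then have "head G (s v) \<rightarrow>\<^sup>*\<^bsub>tree_of r s\<^esub> r" using d choicesD(3)[OF s v] by (intro less.hyps)
      moreover have "v \<rightarrow>\<^bsub>tree_of r s\<^esub> head G (s v)"
        using v choicesD(2)[OF s v] T.in_arcs_imp_in_arcs_ends[of "s v"] by auto
      ultimately show ?thesis by (rule T.adj_reachable_trans[rotated])
    qed (use r in auto)
  qed
  show ?thesis
    using to_root r symmetric_reachable[OF spanning_bar_stable(2)[OF T]] T.reachable_trans
    by (subst connected_spanning_iff[OF T]) blast
qed

lemma (in wf_digraph) closed_awalk_ends:
  assumes "awalk u c u" "c \<noteq> []"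
  shows "tail G ` set c = head G ` set c"
proof -
  have "insert v (tail G ` set p) = insert u (head G ` set p)" if "awalk u p v" for u p v
    using that by (induction p arbitrary: u) (auto simp: awalk_Cons_iff awalk_Nil_iff)
  from this[OF assms(1)] have "insert u (tail G ` set c) = insert u (head G ` set c)" .
  moreover have "u \<in> tail G ` set c" using assms by (cases c) (auto simp: awalk_Cons_iff)
  moreover have "u \<in> head G ` set c"
    using assms by (cases c rule: rev_cases) (auto simp: awalk_Cons_iff awalk_Nil_iff)
  ultimately show ?thesis by (simp add: insert_absorb)
qed

text \<open>At the highest-ranked vertex of a circuit both circuit edges would be the edge to its parent.\<close>

lemma no_circuit_tree_of:
  assumes s: "s \<in> choices r" and ranked: "ranked r s"
  shows "\<not> serre_circuit (tree_of r s) bar c"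
proof
  assume c: "serre_circuit (tree_of r s) bar c"
  note T = spanning_tree_of[OF s]
  interpret T: wf_digraph "tree_of r s" by (rule spanning_bar_stable(1)[OF T])
  obtain d :: "'a \<Rightarrow> nat" where d: "\<And>v. v \<in> verts G - {r} \<Longrightarrow> d (head G (s v)) < d v"
    using ranked by (auto simp: ranked_def)
  obtain u where u: "T.awalk u c u" "c \<noteq> []" using c by (auto simp: serre_circuit_def T.cycle_def)
  have arcs: "set c \<subseteq> arcs (tree_of r s)" using u(1) by (auto simp: T.awalk_def)
  have ends: "tail G ` set c = head G ` set c" using T.closed_awalk_ends[OF u] by simp
  have "finite (d ` head G ` set c)" "d ` head G ` set c \<noteq> {}" using u(2) by auto
  then have "Max (d ` head G ` set c) \<in> d ` head G ` set c" by (rule Max_in)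
  then obtain e where e: "e \<in> set c" "d (head G e) = Max (d ` head G ` set c)" by auto
  have max: "d (head G e') \<le> d (head G e)" if "e' \<in> set c" for e'
    unfolding e(2) using that by (intro Max_ge) auto
  have "head G e \<in> tail G ` set c" using e ends by auto
  then obtain e' where e': "e' \<in> set c" "tail G e' = head G e" by auto
  have "tail G e \<in> head G ` set c" using e ends by auto
  then have max_tail: "d (tail G e) \<le> d (head G e)" using max by auto
  have up: "e' = s (head G e)"
  proof -
    have "e' \<in> arcs (tree_of r s)" using e' arcs by auto
    moreover have False if "e' = bar (s w)" "w \<in> verts G - {r}" for w
      using that choicesD[OF s that(2)] d[OF that(2)] max[OF e'(1)] e'(2) by auto
    ultimately obtain w where "e' = s w" "w \<in> verts G - {r}" by auto
    then show ?thesis using choicesD(2)[OF s, of w] e'(2) by simp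
  qed
  have "bar e = s (head G e)"
  proof -
    have "e \<in> arcs (tree_of r s)" using e arcs by auto
    moreover have False if "e = s w" "w \<in> verts G - {r}" for w
      using that choicesD[OF s that(2)] d[OF that(2)] max_tail by auto
    ultimately obtain w where "e = bar (s w)" "w \<in> verts G - {r}" by auto
    then show ?thesis using choicesD[OF s, of w] by simp
  qed
  then have "bar e \<in> set c" using up e'(1) by simp
  then show False using c e(1) by (auto simp: serre_circuit_def)
qed

lemma tree_of_in_spanning_trees:
  assumes "s \<in> choices r" "ranked r s" "r \<in> verts G"
  shows "tree_of r s \<in> spanning_trees G bar"
  using spanning_tree_of[OF assms(1)] connected_tree_of[OF assms] no_circuit_tree_of[OF assms(1,2)]
  by (auto simp: spanning_trees_def serre_tree_def)

text \<open>The reverse of the first edge would lead back to the starting vertex, and the starting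
  vertex is not visited again. This makes the closed walk in \<open>tree_of_surj\<close> a circuit
  in Serre's sense.\<close>

lemma apath_no_backtrack:
  assumes "set p \<subseteq> arcs G" "cas u p v" "distinct (awalk_verts u p)" "e \<in> set p"
  shows "bar e \<notin> set p"
  using assms
proof (induction p arbitrary: u)
  case (Cons a p)
  have heads: "head G ` set p \<subseteq> set (awalk_verts (head G a) p)"
    using Cons.prems by (auto simp: set_awalk_verts_cas)
  then have nin: "tail G a \<notin> head G ` set p" using Cons.prems by auto
  have "bar a \<notin> set p" using nin Cons.prems(1) by (auto simp: image_iff)
  moreover have "bar a \<noteq> a" using Cons.prems(1) arev_neq by auto
  moreover have "bar e \<noteq> a" if "e \<in> set p"
  proof
    assume "bar e = a"
    then have "head G e = tail G a" using Cons.prems(1) that by auto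
    then show False using nin that by (metis imageI)
  qed
  ultimately show ?case using Cons by auto
qed simp

text \<open>A shortest-path parent function inside \<open>T\<close> already gives a connected
  subgraph; any further edge of \<open>T\<close>, closed up by a path in that subgraph, would be a
  circuit of \<open>T\<close>.\<close>

lemma tree_of_surj:
  assumes T: "T \<in> spanning_trees G bar" and r: "r \<in> verts G"
  obtains s where "s \<in> choices r" "ranked r s" "T = tree_of r s"
proof -
  have T': "spanning T G" "bar ` arcs T \<subseteq> arcs T" "Digraph_Component.connected T"
    and acyclic: "\<And>c. \<not> serre_circuit T bar c"
    using T by (auto simp: spanning_trees_def serre_tree_def)
  note Tp = spanning_bar_stable[OF T'(1,2)]
  obtain s where s: "s \<in> choices r" "ranked r s" "s ` (verts G - {r}) \<subseteq> arcs T"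
    by (rule exists_ranked_choice[OF T' r])
  let ?S = "tree_of r s"
  note S = spanning_tree_of[OF s(1)]
  interpret T: wf_digraph T by (rule Tp)
  interpret S: wf_digraph ?S by (rule spanning_bar_stable(1)[OF S])
  have sub: "arcs ?S \<subseteq> arcs T" using s(3) T'(2) by auto
  have "arcs T \<subseteq> arcs ?S"
  proof
    fix e assume e: "e \<in> arcs T"
    show "e \<in> arcs ?S"
    proof (rule ccontr)
      assume e_S: "e \<notin> arcs ?S"
      then have bar_e: "bar e \<notin> arcs ?S" using S(2) arev_arev by (metis image_subset_iff)
      have eG: "e \<in> arcs G" using e Tp by auto
      have "head G e \<rightarrow>\<^sup>*\<^bsub>?S\<^esub> tail G e"
        using connected_tree_of[OF s(1,2) r] eG by (auto simp: connected_spanning_iff[OF S])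
      then obtain q where "S.apath (head G e) q (tail G e)" by (auto simp: S.reachable_apath)
      then have q: "set q \<subseteq> arcs ?S" "S.cas (head G e) q (tail G e)" "distinct (S.awalk_verts (head G e) q)"
        by (auto simp: S.apath_def S.awalk_def)
      \<comment> \<open>Both notions are indexed by a graph but depend only on the incidence maps,
        which \<open>T\<close>, \<open>?S\<close> and \<open>G\<close> share.\<close>
      have verts_eq: "S.awalk_verts u w = awalk_verts u w" "T.awalk_verts u w = awalk_verts u w" for u w
        by (simp_all add: awalk_verts_conv S.awalk_verts_conv T.awalk_verts_conv Tp)
      have cas_eq: "S.cas u w v = cas u w v" "T.cas u w v = cas u w v" for u w v
        by (induction w arbitrary: u) (simp_all add: Tp)
      have "serre_circuit T bar (e # q)"
        unfolding serre_circuit_def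
      proof
        have "set q \<subseteq> arcs T" using q(1) sub by blast
        then have "T.awalk (tail G e) (e # q) (tail G e)"
          using q(2) e eG Tp by (simp add: T.awalk_def cas_eq)
        moreover have "distinct (tl (T.awalk_verts (tail G e) (e # q)))"
          using q(3) by (simp add: verts_eq Tp)
        ultimately show "T.cycle (e # q)" unfolding T.cycle_def by blast
        have "set q \<subseteq> arcs G" using q(1) sub Tp(4) by blast
        then have "bar x \<notin> set q" if "x \<in> set q" for x
          using apath_no_backtrack[of q "head G e" "tail G e" x] q(2,3) that by (simp add: cas_eq verts_eq)
        moreover have "bar e \<notin> set q" using bar_e q(1) by auto
        moreover have "bar x \<noteq> e" if "x \<in> set q" for x
          using that q(1) S(2) e_S by blast
        ultimately show "\<forall>x\<in>set (e # q). bar x \<notin> set (e # q)" using arev_neq[OF eG] by auto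
      qed
      then show False using acyclic by blast
    qed
  qed
  with sub have "arcs T = arcs ?S" by blast
  then have "T = ?S" using Tp by (intro pre_digraph.equality) auto
  then show ?thesis using s by (intro that)
qed

text \<open>Let \<open>v\<close> have the largest rank among the vertices where \<open>s\<close> and
  \<open>s'\<close> differ. The edge \<open>s' v\<close> lies in the common tree, hence is the
  reverse of \<open>s w\<close> for a child \<open>w\<close> of \<open>v\<close>; if
  \<open>s\<close> and \<open>s'\<close> agreed at \<open>w\<close>, then \<open>s'\<close> would
  run back and forth between \<open>v\<close> and \<open>w\<close>. So they differ at
  \<open>w\<close>, whose rank is larger.\<close>

lemma tree_of_inj:
  assumes s: "s \<in> choices r" "ranked r s" and s': "s' \<in> choices r" "ranked r s'"
    and eq: "tree_of r s = tree_of r s'"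
  shows "s = s'"
proof (rule ccontr)
  assume "s \<noteq> s'"
  then have "\<exists>v\<in>verts G - {r}. s v \<noteq> s' v"
    using s(1) s'(1) unfolding choices_def by (metis PiE_ext)
  then have ne: "{v \<in> verts G - {r}. s v \<noteq> s' v} \<noteq> {}" (is "?D \<noteq> {}") by auto
  obtain d :: "'a \<Rightarrow> nat" where d: "\<And>v. v \<in> verts G - {r} \<Longrightarrow> d (head G (s v)) < d v"
    using s(2) by (auto simp: ranked_def)
  obtain d' :: "'a \<Rightarrow> nat" where d': "\<And>v. v \<in> verts G - {r} \<Longrightarrow> d' (head G (s' v)) < d' v"
    using s'(2) by (auto simp: ranked_def)
  have "finite ?D" by simp
  then have "Max (d ` ?D) \<in> d ` ?D" using ne by (intro Max_in) auto
  then obtain v where v: "v \<in> verts G - {r}" "s v \<noteq> s' v" "d v = Max (d ` ?D)" by auto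
  have max: "d w \<le> d v" if "w \<in> ?D" for w
    unfolding v(3) using that \<open>finite ?D\<close> by (intro Max_ge) auto
  have "s' v \<in> arcs (tree_of r s)" unfolding eq using v(1) by auto
  then consider w where "w \<in> verts G - {r}" "s' v = s w" | w where "w \<in> verts G - {r}" "s' v = bar (s w)"
    by auto
  then show False
  proof cases
    case 1
    then show False using choicesD(2)[OF s(1), of w] choicesD(2)[OF s'(1) v(1)] v by simp
  next
    case 2
    note w = choicesD[OF s(1) 2(1)] and v' = choicesD[OF s'(1) v(1)]
    have head: "head G (s w) = v" "head G (s' v) = w" using w v' 2(2) by auto
    have "s w \<noteq> s' w"
    proof
      assume "s w = s' w"
      then show False using d'[OF 2(1)] d'[OF v(1)] head by simp
    qed
    then have "d w \<le> d v" using max 2(1) by auto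
    then show False using d[OF 2(1)] head(1) by simp
  qed
qed

theorem matrix_tree:
  assumes "r \<in> verts G"
  shows "detS (verts G - {r}) laplacian = (of_nat (num_spanning_trees G bar) :: 'c::field)"
proof -
  have "bij_betw (tree_of r) {s \<in> choices r. ranked r s} (spanning_trees G bar)"
    unfolding bij_betw_def
    using tree_of_inj tree_of_in_spanning_trees[OF _ _ assms] tree_of_surj[OF _ assms]
    by (auto simp: inj_on_def) (metis (mono_tags, lifting) imageI mem_Collect_eq)
  then have "card {s \<in> choices r. ranked r s} = num_spanning_trees G bar"
    unfolding num_spanning_trees_def by (rule bij_betw_same_card)
  then show ?thesis using detS_laplacian[OF assms] by simp
qed

text \<open>Keeps the valuations of the tree numbers meaningful, and later excludes that the norms
  at primitive roots vanish.\<close>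

lemma num_spanning_trees_pos:
  assumes "Digraph_Component.connected G"
  shows "num_spanning_trees G bar > 0"
proof -
  have span: "spanning G G" "bar ` arcs G \<subseteq> arcs G"
    by (auto simp: spanning_def subgraph_refl)
  obtain r where r: "r \<in> verts G" using assms by (auto simp: connected_spanning_iff[OF span])
  obtain s where s: "s \<in> choices r" "ranked r s"
    using exists_ranked_choice[OF span assms r] by blast
  have "spanning_trees G bar \<subseteq> tree_of r ` choices r"
    using tree_of_surj[OF _ r] by blast
  then have "finite (spanning_trees G bar)" using finite_choices finite_surj by blast
  then show ?thesis
    using tree_of_in_spanning_trees[OF s r] by (auto simp: num_spanning_trees_def card_gt_0_iff)
qed

end

section \<open>Norms of integer polynomials at roots of unity of prime power order\<close>

definition ev :: "int poly \<Rightarrow> complex \<Rightarrow> complex" where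
  "ev w z = poly (map_poly of_int w) z"

lemma ev_pCons [simp]: "ev (pCons a w) z = of_int a + z * ev w z"
  by (simp add: ev_def map_poly_pCons)

lemma ev_0 [simp]: "ev 0 z = 0"
  by (simp add: ev_def)

lemma ev_1 [simp]: "ev 1 z = 1"
  by (simp add: one_pCons)

lemma ev_add [simp]: "ev (v + w) z = ev v z + ev w z"
  by (induction v w rule: poly_induct2) (simp_all add: algebra_simps)

lemma ev_smult [simp]: "ev (smult a w) z = of_int a * ev w z"
  by (induction w) (simp_all add: algebra_simps)

lemma ev_mult [simp]: "ev (v * w) z = ev v z * ev w z"
  by (induction v) (simp_all add: algebra_simps)

lemma ev_minus [simp]: "ev (- w) z = - ev w z"
  using ev_smult[of "-1" w z] by simp

lemma ev_diff [simp]: "ev (v - w) z = ev v z - ev w z"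
  using ev_add[of v "- w" z] by simp

lemma ev_power [simp]: "ev (w ^ n) z = ev w z ^ n"
  by (induction n) simp_all

lemma ev_sum: "ev (sum f A) z = (\<Sum>i\<in>A. ev (f i) z)"
  by (induction A rule: infinite_finite_induct) simp_all

lemma ev_monom [simp]: "ev (monom c n) z = of_int c * z ^ n"
  by (simp add: ev_def map_poly_monom poly_monom)

lemma ev_altdef: "ev w z = (\<Sum>l\<le>degree w. of_int (coeff w l) * z ^ l)"
  by (simp add: ev_def poly_altdef coeff_map_poly degree_map_poly)

lemma ev_one: "ev w 1 = of_int (poly w 1)"
  by (induction w) simp_all

section \<open>Characters of cyclic groups and circulant matrices\<close>

lemma sum_powers_root_of_unity:
  fixes z :: complex
  assumes "z ^ N = 1"
  shows "(\<Sum>k<N. z ^ k) = (if z = 1 then of_nat N else 0)"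
  using geometric_sum[of z N] assms by auto

lemma finite_unity_roots [simp]: "N > 0 \<Longrightarrow> finite {z::complex. z ^ N = 1}"
  by (rule finite_roots_unity) simp

lemma card_unity_roots: "N > 0 \<Longrightarrow> card {z::complex. z ^ N = 1} = N"
  by (rule card_roots_unity_eq) simp

lemma unity_roots_orthogonal:
  fixes x y :: complex
  assumes "N > 0" "x ^ N = 1" "y ^ N = 1"
  shows "(\<Sum>k<N. inverse (of_nat N) * inverse x ^ k * y ^ k) = (if x = y then 1 else 0)"
proof -
  have x: "x \<noteq> 0" using assms by (auto simp: power_0_left)
  have "(\<Sum>k<N. inverse (of_nat N) * inverse x ^ k * y ^ k) = inverse (of_nat N) * (\<Sum>k<N. (y / x) ^ k)"
    by (simp add: sum_distrib_left divide_inverse power_mult_distrib mult_ac)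
  also have "\<dots> = inverse (of_nat N) * (if y / x = 1 then of_nat N else 0)"
    using assms by (subst sum_powers_root_of_unity) (simp_all add: power_divide)
  also have "\<dots> = (if x = y then 1 else 0)" using x assms(1) by auto
  finally show ?thesis .
qed

text \<open>The matrix of multiplication by \<open>w\<close> on \<open>Z[x]/(x^N - 1)\<close> in the
  basis of powers of \<open>x\<close>. Its complex eigenvalues are the values of \<open>w\<close> at
  the \<open>N\<close>-th roots of unity.\<close>

definition circulant :: "nat \<Rightarrow> int poly \<Rightarrow> nat \<Rightarrow> nat \<Rightarrow> int" where
  "circulant N w i j = (\<Sum>l\<le>degree w. if (i + l) mod N = j then coeff w l else 0)"

text \<open>Characters diagonalise circulants. The gain is an integer matrix for the product;
  \<open>c\<close> and \<open>d\<close> are kept apart so that it is visibly scalar modulo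
  \<open>d\<close>, which will be \<open>p\<close>.\<close>

lemma prod_unity_roots_eq_detS:
  assumes N: "N > 0"
  shows "(\<Prod>z | z ^ N = 1. of_int c + of_int d * ev w z)
    = of_int (detS {..<N} (\<lambda>i j. (if i = j then c else 0) + d * circulant N w i j))"
proof -
  let ?R = "{z::complex. z ^ N = 1}"
  let ?M = "\<lambda>i j. of_int ((if i = j then c else 0) + d * circulant N w i j) :: complex"
  let ?B = "\<lambda>y z. if y = z then of_int c + of_int d * ev w y else 0"
  have circ: "(\<Sum>j<N. of_int (circulant N w i j) * z ^ j) = z ^ i * ev w z"
    if z: "z ^ N = 1" for i and z :: complex
  proof -
    have "z ^ (n mod N) = z ^ n" for n
    proof -
      have "z ^ n = (z ^ N) ^ (n div N) * z ^ (n mod N)"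
        by (metis power_add power_mult mult_div_mod_eq)
      then show ?thesis using z by simp
    qed
    note red = this
    have "(\<Sum>j<N. of_int (circulant N w i j) * z ^ j)
        = (\<Sum>l\<le>degree w. \<Sum>j<N. if j = (i + l) mod N then of_int (coeff w l) * z ^ j else 0)"
      unfolding circulant_def of_int_sum sum_distrib_right
      by (subst sum.swap) (auto intro!: sum.cong)
    also have "\<dots> = (\<Sum>l\<le>degree w. of_int (coeff w l) * z ^ (i + l))"
      using N by (simp add: red)
    also have "\<dots> = z ^ i * ev w z" by (simp add: ev_altdef sum_distrib_left power_add mult_ac)
    finally show ?thesis .
  qed
  have "of_int (detS {..<N} (\<lambda>i j. (if i = j then c else 0) + d * circulant N w i j)) = detS {..<N} ?M"
    by (rule detS_hom) simp_all
  also have "\<dots> = detS ?R ?B"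
  proof (rule detS_similar[where F = "\<lambda>i z. z ^ i" and F' = "\<lambda>z i. inverse (of_nat N) * inverse z ^ i"])
    show "finite ?R" "card {..<N} = card ?R" using N by (simp_all add: card_unity_roots)
    fix i assume i: "i \<in> {..<N}"
    fix z assume z: "z \<in> ?R"
    have "(\<Sum>j<N. ?M i j * z ^ j) = (\<Sum>j<N. (if j = i then of_int c * z ^ j else 0))
        + of_int d * (\<Sum>j<N. of_int (circulant N w i j) * z ^ j)"
      unfolding sum_distrib_left sum.distrib[symmetric]
      by (intro sum.cong) (auto simp: algebra_simps)
    also have "\<dots> = z ^ i * (of_int c + of_int d * ev w z)"
      using i circ[of z i] z by (simp add: algebra_simps)
    also have "\<dots> = (\<Sum>y\<in>?R. if y = z then y ^ i * (of_int c + of_int d * ev w y) else 0)"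
      using z N by (subst sum.delta) auto
    also have "\<dots> = (\<Sum>y\<in>?R. y ^ i * ?B y z)" by (intro sum.cong) auto
    finally show "(\<Sum>j<N. ?M i j * z ^ j) = (\<Sum>y\<in>?R. y ^ i * ?B y z)" .
  qed (use N in \<open>auto simp: unity_roots_orthogonal\<close>)
  also have "\<dots> = (\<Prod>z\<in>?R. of_int c + of_int d * ev w z)"
    using N by (intro detS_diagonal) simp
  finally show ?thesis by simp
qed

text \<open>The units of the localisation of the integers at \<open>p\<close>, as complex numbers.
  Rational numbers suffice because only full norms get compared.\<close>

definition p_unit :: "nat \<Rightarrow> complex \<Rightarrow> bool" where
  "p_unit p x \<longleftrightarrow> (\<exists>a b :: int. \<not> int p dvd a \<and> \<not> int p dvd b \<and> of_int b * x = of_int a)"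

lemma p_unit_of_int: "\<not> int p dvd a \<Longrightarrow> prime p \<Longrightarrow> p_unit p (of_int a)"
  unfolding p_unit_def by (rule exI[of _ a], rule exI[of _ 1]) (auto simp: prime_gt_1_nat)

lemma p_unit_mult:
  assumes "prime p" "p_unit p x" "p_unit p y"
  shows "p_unit p (x * y)"
proof -
  obtain a b c d where "\<not> int p dvd a" "\<not> int p dvd b" "of_int b * x = of_int a"
    and "\<not> int p dvd c" "\<not> int p dvd d" "of_int d * y = of_int c"
    using assms by (auto simp: p_unit_def)
  moreover from this have "of_int (b * d) * (x * y) = of_int (a * c)"
    by (metis mult.assoc mult.left_commute of_int_mult)
  moreover have "prime (int p)" using assms(1) by simp
  ultimately show ?thesis unfolding p_unit_def
    by (intro exI[of _ "a * c"] exI[of _ "b * d"]) (auto simp: prime_dvd_mult_iff)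
qed

lemma p_unit_power: "prime p \<Longrightarrow> p_unit p x \<Longrightarrow> p_unit p (x ^ n)"
proof (induction n)
  case 0
  then show ?case using p_unit_of_int[of p 1] prime_gt_1_nat[of p] by auto
qed (simp add: p_unit_mult)

lemma p_unit_nonzero: "p_unit p x \<Longrightarrow> x \<noteq> 0"
  by (auto simp: p_unit_def)

lemma p_unit_inverse:
  assumes "p_unit p x"
  shows "p_unit p (inverse x)"
proof -
  obtain a b where ab: "\<not> int p dvd a" "\<not> int p dvd b" "of_int b * x = of_int a"
    using assms by (auto simp: p_unit_def)
  then have "of_int a * inverse x = of_int b"
    using p_unit_nonzero[OF assms] by (simp add: ab(3)[symmetric])
  with ab show ?thesis unfolding p_unit_def by blast
qed

text \<open>Clearing the denominator of \<open>U\<close> turns a complex identity into one of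
  integers, where multiplicities can be counted.\<close>

lemma multiplicity_eq_p_unit:
  assumes p: "prime p" and U: "p_unit p U" and pos: "A > 0" "B > 0"
    and eq: "of_nat A = of_nat B * of_nat p ^ k * U"
  shows "multiplicity p A = multiplicity p B + k"
proof -
  obtain a b where ab: "\<not> int p dvd a" "\<not> int p dvd b" "of_int b * U = of_int a"
    using U by (auto simp: p_unit_def)
  have "of_int (b * int A) = (of_int (int B * int p ^ k * a) :: complex)"
    using ab(3) by (simp add: eq mult_ac flip: ab(3))
  then have eq': "b * int A = int B * int p ^ k * a" by (simp only: of_int_eq_iff)
  then have "\<bar>b * int A\<bar> = \<bar>int B * int p ^ k * a\<bar>" by (rule arg_cong)
  then have "int (nat \<bar>b\<bar> * A) = int (B * p ^ k * nat \<bar>a\<bar>)"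
    by (simp add: abs_mult)
  then have eq'': "nat \<bar>b\<bar> * A = B * p ^ k * nat \<bar>a\<bar>" by (simp only: of_nat_eq_iff)
  have ndvd: "\<not> p dvd nat \<bar>a\<bar>" "\<not> p dvd nat \<bar>b\<bar>"
    using ab by (simp_all flip: int_dvd_int_iff)
  have nz: "nat \<bar>a\<bar> \<noteq> 0" "nat \<bar>b\<bar> \<noteq> 0" "p \<noteq> 0" using ab p by auto
  have pp: "prime_elem p" using p by simp
  have "multiplicity p (nat \<bar>b\<bar> * A) = multiplicity p A"
    using ndvd nz pos pp by (simp add: prime_elem_multiplicity_mult_distrib not_dvd_imp_multiplicity_0)
  moreover have "multiplicity p (B * p ^ k * nat \<bar>a\<bar>) = multiplicity p B + k"
    using ndvd nz pos pp
    by (simp add: prime_elem_multiplicity_mult_distrib not_dvd_imp_multiplicity_0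
        prime_elem_multiplicity_power_distrib)
  ultimately show ?thesis unfolding eq'' by simp
qed

lemma const_dvd_imp_dvd_poly: "[:c:] dvd (w :: int poly) \<Longrightarrow> c dvd poly w x"
  by (auto elim!: dvdE)

lemma freshmans_dream_dvd:
  fixes a b :: "'a::comm_ring_1"
  assumes "prime p"
  shows "of_nat p dvd (a + b) ^ (p ^ m) - a ^ (p ^ m) - b ^ (p ^ m)"
proof -
  have step: "of_nat p dvd (x + y) ^ p - x ^ p - y ^ p" for x y :: 'a
  proof -
    obtain q where q: "p = Suc (Suc q)" using prime_ge_2_nat[OF assms] by (metis add_2_eq_Suc le_iff_add)
    have "(x + y) ^ p = (\<Sum>k\<le>p. of_nat (p choose k) * x ^ k * y ^ (p - k))" by (rule binomial_ring)
    also have "\<dots> = (\<Sum>k\<in>{1..<p}. of_nat (p choose k) * x ^ k * y ^ (p - k)) + x ^ p + y ^ p"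
    proof -
      have "{..p} = insert 0 (insert p {1..<p})" using q by auto
      then show ?thesis using q by simp
    qed
    also have "of_nat p dvd (\<Sum>k\<in>{1..<p}. of_nat (p choose k) * x ^ k * y ^ (p - k))"
    proof (intro dvd_sum dvd_mult2)
      fix k assume "k \<in> {1..<p}"
      then have "p dvd (p choose k)" using assms by (intro dvd_choose_prime) auto
      then show "of_nat p dvd (of_nat (p choose k) :: 'a)" by (metis dvd_def of_nat_mult)
    qed
    ultimately show ?thesis by simp
  qed
  show ?thesis
  proof (induction m)
    case (Suc m)
    let ?A = "a ^ (p ^ m)" and ?B = "b ^ (p ^ m)" and ?C = "(a + b) ^ (p ^ m)"
    have pow: "x ^ (p ^ Suc m) = (x ^ (p ^ m)) ^ p" for x :: 'a
      by (metis power_Suc power_mult mult.commute)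
    have "of_nat p dvd ?C - (?A + ?B)" using Suc.IH by (simp add: diff_diff_add)
    also have "?C - (?A + ?B) dvd ?C ^ p - (?A + ?B) ^ p"
      by (metis power_diff_sumr2 dvd_triv_left)
    finally have "of_nat p dvd (?C ^ p - (?A + ?B) ^ p) + ((?A + ?B) ^ p - ?A ^ p - ?B ^ p)"
      using step by (rule dvd_add)
    then show ?case unfolding pow by (simp add: algebra_simps)
  qed simp
qed

text \<open>In characteristic \<open>p\<close> all \<open>p\<close>-power roots of unity collapse to
  1; this is why the behaviour at 1 governs all the norms below.\<close>

lemma monom_prime_power_cong:
  assumes "prime p"
  shows "[:int p:] dvd monom 1 (p ^ m) - 1 - [:-1, 1:] ^ (p ^ m)"
proof -
  have "[:-1, 1:] + 1 = monom (1::int) 1" by (simp add: one_pCons monom_altdef)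
  then show ?thesis
    using freshmans_dream_dvd[OF assms, of "[:-1, 1:] :: int poly" 1 m]
    by (simp add: monom_power of_nat_poly algebra_simps)
qed

text \<open>Each factor is congruent to \<open>w(1)\<close> modulo a prime above \<open>p\<close>.
  To stay with integer matrices one takes \<open>q\<close>-th powers, \<open>q = p^m\<close>: by the
  Frobenius, \<open>w(z)^q\<close> is \<open>w(1)^q\<close> plus \<open>p\<close> times an integer
  polynomial in \<open>z\<close>.\<close>

lemma p_unit_prod_unity_roots:
  assumes p: "prime p" and w: "\<not> int p dvd poly w 1"
  shows "p_unit p (\<Prod>z | z ^ (p ^ m) = 1. ev w z)"
proof -
  let ?q = "p ^ m" and ?c = "poly w 1 ^ (p ^ m)"
  let ?R = "{z::complex. z ^ ?q = 1}"
  have q: "?q > 0" using p by (simp add: prime_gt_0_nat)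
  define v where "v = synthetic_div w 1"
  have wv: "w = [:poly w 1:] + [:-1, 1:] * v"
    using synthetic_div_correct'[of 1 w] by (simp add: v_def add.commute)
  have "of_nat p dvd w ^ ?q - [:poly w 1:] ^ ?q - ([:-1, 1:] * v) ^ ?q"
    using freshmans_dream_dvd[OF p, of "[:poly w 1:]" "[:-1, 1:] * v" m] wv by simp
  then obtain e where e: "w ^ ?q - [:poly w 1:] ^ ?q - ([:-1, 1:] * v) ^ ?q = [:int p:] * e"
    by (auto simp: of_nat_poly elim!: dvdE)
  obtain e' where e': "monom 1 ?q - 1 - [:-1, 1:] ^ ?q = [:int p:] * e'"
    using monom_prime_power_cong[OF p, of m] by (auto elim!: dvdE)
  \<comment> \<open>Collects two multiples of \<open>p\<close>: the error \<open>e\<close> of the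
    Frobenius on \<open>w\<close>, and \<open>(z - 1)^q = - p e'(z)\<close>, which holds because
    \<open>z^q = 1\<close>.\<close>
  define g where "g = e - e' * v ^ ?q"
  have ev_w: "ev w z ^ ?q = of_int ?c + of_int (int p) * ev g z" if "z \<in> ?R" for z
  proof -
    have "ev (w ^ ?q - [:poly w 1:] ^ ?q - ([:-1, 1:] * v) ^ ?q) z = ev ([:int p:] * e) z"
      by (simp only: e)
    then have 1: "ev w z ^ ?q - of_int ?c - (z - 1) ^ ?q * ev v z ^ ?q = of_nat p * ev e z"
      by (simp add: power_mult_distrib del: mult_pCons_left)
    have "ev (monom 1 ?q - 1 - [:-1, 1:] ^ ?q) z = ev ([:int p:] * e') z"
      by (simp only: e')
    then have "(z - 1) ^ ?q = - (of_nat p * ev e' z)"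
      using that by (simp add: minus_equation_iff)
    then show ?thesis using 1 by (simp add: g_def algebra_simps)
  qed
  let ?D = "detS {..<?q} (\<lambda>i j. (if i = j then 0 else 0) + 1 * circulant ?q w i j)"
  let ?E = "detS {..<?q} (\<lambda>i j. (if i = j then ?c else 0) + int p * circulant ?q g i j)"
  have D: "(\<Prod>z\<in>?R. ev w z) = of_int ?D"
    using prod_unity_roots_eq_detS[OF q, of 0 1 w] by simp
  have "of_int (?D ^ ?q) = (\<Prod>z\<in>?R. ev w z ^ ?q)" by (simp only: of_int_power D prod_power_distrib[symmetric])
  also have "\<dots> = (\<Prod>z\<in>?R. of_int ?c + of_int (int p) * ev g z)" by (intro prod.cong refl ev_w)
  also have "\<dots> = of_int ?E" by (rule prod_unity_roots_eq_detS[OF q])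
  finally have DE: "?D ^ ?q = ?E" by (simp only: of_int_eq_iff)
  \<comment> \<open>Modulo \<open>p\<close> the matrix is scalar with entry
    \<open>?c\<close>.\<close>
  have "int p dvd ?E - detS {..<?q} (\<lambda>i j. if i = j then ?c else 0)"
    by (rule detS_dvd_diff) auto
  then have "int p dvd ?E - ?c ^ ?q" by (simp add: detS_diagonal)
  moreover have "prime (int p)" using p by simp
  then have "\<not> int p dvd ?c ^ ?q" using w by (metis prime_dvd_power)
  moreover have "\<not> d dvd x" if "d dvd x - y" "\<not> d dvd y" for d x y :: int
    using that dvd_diff[of d x "x - y"] by auto
  ultimately have "\<not> int p dvd ?E" by blast
  then have "\<not> int p dvd ?D" using DE q by (metis dvd_power dvd_trans)
  then show ?thesis unfolding D by (intro p_unit_of_int p)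
qed

section \<open>Norms over primitive roots of unity\<close>

definition primitive_roots :: "nat \<Rightarrow> nat \<Rightarrow> complex set" where
  "primitive_roots p k = {z. z ^ (p ^ k) = 1 \<and> z ^ (p ^ (k - 1)) \<noteq> 1}"

lemma unity_roots_Suc:
  "{z::complex. z ^ (p ^ Suc k) = 1} = {z. z ^ (p ^ k) = 1} \<union> primitive_roots p (Suc k)"
  "{z::complex. z ^ (p ^ k) = 1} \<inter> primitive_roots p (Suc k) = {}"
  by (auto simp: primitive_roots_def power_mult mult.commute[of p])

lemma finite_primitive_roots [simp]: "p > 0 \<Longrightarrow> finite (primitive_roots p k)"
  by (rule finite_subset[OF _ finite_unity_roots[of "p ^ k"]]) (auto simp: primitive_roots_def)

lemma card_primitive_roots:
  assumes "p > 0"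
  shows "card (primitive_roots p (Suc k)) = p ^ Suc k - p ^ k"
proof -
  have "card {z::complex. z ^ (p ^ Suc k) = 1} = card {z::complex. z ^ (p ^ k) = 1} + card (primitive_roots p (Suc k))"
    unfolding unity_roots_Suc(1) using assms unity_roots_Suc(2) by (intro card_Un_disjoint) auto
  then show ?thesis using assms by (simp add: card_unity_roots)
qed

definition prim_norm :: "nat \<Rightarrow> nat \<Rightarrow> int poly \<Rightarrow> complex" where
  "prim_norm p k w = (\<Prod>z\<in>primitive_roots p k. ev w z)"

lemma prim_norm_mult: "prim_norm p k (v * w) = prim_norm p k v * prim_norm p k w"
  by (simp add: prim_norm_def prod.distrib)

text \<open>A quotient of full norms at two consecutive levels, both of them
  \<open>p\<close>-units.\<close>

lemma p_unit_prim_norm: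
  assumes p: "prime p" and w: "\<not> int p dvd poly w 1"
  shows "p_unit p (prim_norm p (Suc k) w)"
proof -
  let ?Q = "\<lambda>m. \<Prod>z | z ^ (p ^ m) = 1. ev w z"
  have "p > 0" using p by (rule prime_gt_0_nat)
  then have "?Q (Suc k) = ?Q k * prim_norm p (Suc k) w"
    unfolding unity_roots_Suc(1) prim_norm_def using unity_roots_Suc(2) by (intro prod.union_disjoint) auto
  then have "prim_norm p (Suc k) w = ?Q (Suc k) * inverse (?Q k)"
    using p_unit_nonzero[OF p_unit_prod_unity_roots[OF p w, of k]] by simp
  then show ?thesis
    using p_unit_prod_unity_roots[OF p w] by (simp only: p_unit_mult p_unit_inverse p)
qed

text \<open>The cyclotomic polynomial of order \<open>p ^ Suc k\<close> is \<open>(x - 1) ^ \<phi> + p q\<close> with \<open>q(1) = 1\<close>.\<close>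

lemma prime_at_primitive_roots:
  fixes p k :: nat
  assumes p: "prime p"
  defines "\<phi> \<equiv> p ^ Suc k - p ^ k"
  obtains q :: "int poly" where "poly q 1 = 1"
    "\<And>z. z \<in> primitive_roots p (Suc k) \<Longrightarrow> of_nat p * ev q z = - ((z - 1) ^ \<phi>)"
proof -
  let ?y = "monom 1 (p ^ k) :: int poly" and ?x = "[:-1, 1:] :: int poly"
  define C where "C = (\<Sum>i<p. ?y ^ i)"
  have p0: "p > 1" using p by (rule prime_gt_1_nat)
  have less: "p ^ k < p ^ Suc k" using p0 by simp
  have yC: "?y ^ p - 1 = (?y - 1) * C" unfolding C_def by (rule power_diff_1_eq)
  have yp: "?y ^ p = monom 1 (p ^ Suc k)" by (simp add: monom_power mult.commute)
  \<comment> \<open>Modulo \<open>p\<close> both \<open>x^(p^(k+1)) - 1\<close> and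
    \<open>x^(p^k) - 1\<close> are powers of \<open>x - 1\<close>, so their quotient
    \<open>C\<close> becomes a power too, once \<open>(x - 1)^(p^k)\<close> is cancelled; the
    constant \<open>p\<close> is a prime element not dividing that factor.\<close>
  have "[:int p:] dvd (?y ^ p - 1 - ?x ^ (p ^ Suc k)) - (?y - 1 - ?x ^ (p ^ k)) * C"
    unfolding yp by (rule dvd_diff[OF _ dvd_mult2]) (rule monom_prime_power_cong[OF p])+
  also have "(?y ^ p - 1 - ?x ^ (p ^ Suc k)) - (?y - 1 - ?x ^ (p ^ k)) * C = ?x ^ (p ^ k) * (C - ?x ^ \<phi>)"
  proof -
    have "?x ^ (p ^ Suc k) = ?x ^ (p ^ k) * ?x ^ \<phi>"
      unfolding power_add[symmetric] \<phi>_def using less by simp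
    then show ?thesis unfolding yC by (simp only: algebra_simps)
  qed
  finally have "[:int p:] dvd ?x ^ (p ^ k) * (C - ?x ^ \<phi>)" .
  moreover have "prime_elem [:int p:]" using p by (simp add: prime_elem_const_poly_iff)
  moreover have "\<not> [:int p:] dvd ?x ^ (p ^ k)"
  proof
    assume "[:int p:] dvd ?x ^ (p ^ k)"
    then have "int p dvd poly (?x ^ (p ^ k)) 2" by (rule const_dvd_imp_dvd_poly)
    then show False using p0 by simp
  qed
  ultimately have "[:int p:] dvd C - ?x ^ \<phi>" by (simp only: prime_elem_dvd_mult_iff) simp
  then obtain q where "C - ?x ^ \<phi> = [:int p:] * q" by (auto elim!: dvdE)
  then have q: "C = ?x ^ \<phi> + [:int p:] * q" by (simp add: algebra_simps)
  have "\<phi> > 0" using less by (simp add: \<phi>_def)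
  \<comment> \<open>Since \<open>(x - 1)^\<phi>\<close> vanishes at 1, this reads
    \<open>p q(1) = p\<close>.\<close>
  have "poly C 1 = int p" by (simp add: C_def poly_sum poly_monom)
  then have "poly q 1 = 1" unfolding q using \<open>\<phi> > 0\<close> p0 by (simp add: power_0_left)
  moreover have "of_nat p * ev q z = - ((z - 1) ^ \<phi>)" if z: "z \<in> primitive_roots p (Suc k)" for z
  proof -
    have "ev (?y ^ p - 1) z = ev ((?y - 1) * C) z" by (simp only: yC)
    then have "ev C z = 0" using z by (auto simp: yp primitive_roots_def)
    then show ?thesis unfolding q by (simp add: eq_neg_iff_add_eq_0 add.commute)
  qed
  ultimately show ?thesis by (rule that)
qed

text \<open>At primitive roots \<open>p\<close> is a unit multiple of \<open>(z - 1)^\<phi>\<close>,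
  so for \<open>l < \<phi>\<close> the term \<open>(x - 1)^l u\<close> dominates \<open>p a\<close>.
  Multiplication by \<open>q\<close> makes this exact: \<open>q h\<close> takes the values of
  \<open>(x - 1)^l w\<close>, where \<open>w(1) = u(1)\<close>. The norm \<open>?t\<close> of
  \<open>z - 1\<close> is evaluated only through \<open>?t ^ \<phi>\<close>, whence the outer
  exponent.\<close>

lemma prim_norm_valuation:
  fixes p k l :: nat and h :: "int poly"
  assumes p: "prime p" and h: "h = [:int p:] * a + [:-1, 1:] ^ l * u" and u: "\<not> int p dvd poly u 1"
  defines "\<phi> \<equiv> p ^ Suc k - p ^ k"
  assumes l: "l < \<phi>"
  obtains U where "p_unit p U" "prim_norm p (Suc k) h ^ \<phi> = of_nat p ^ (l * \<phi>) * U"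
proof -
  obtain q where q: "poly q 1 = 1"
    "\<And>z. z \<in> primitive_roots p (Suc k) \<Longrightarrow> of_nat p * ev q z = - ((z - 1) ^ \<phi>)"
    using prime_at_primitive_roots[OF p, of k, folded \<phi>_def] by blast
  define w where "w = u * q - [:-1, 1:] ^ (\<phi> - l) * a"
  let ?P = "prim_norm p (Suc k)" and ?t = "\<Prod>z\<in>primitive_roots p (Suc k). z - 1"
  have p0: "p > 1" using p by (rule prime_gt_1_nat)
  have "ev q z * ev h z = (z - 1) ^ l * ev w z" if "z \<in> primitive_roots p (Suc k)" for z
  proof -
    have "ev q z * ev h z = (of_nat p * ev q z) * ev a z + (z - 1) ^ l * ev u z * ev q z"
      by (simp add: h algebra_simps)
    also have "of_nat p * ev q z = - ((z - 1) ^ l * (z - 1) ^ (\<phi> - l))"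
      using q(2)[OF that] l by (simp add: power_add[symmetric])
    also have "- ((z - 1) ^ l * (z - 1) ^ (\<phi> - l)) * ev a z + (z - 1) ^ l * ev u z * ev q z
        = (z - 1) ^ l * ev w z"
      by (simp add: w_def algebra_simps)
    finally show ?thesis .
  qed
  then have "?P q * ?P h = (\<Prod>z\<in>primitive_roots p (Suc k). (z - 1) ^ l * ev w z)"
    unfolding prim_norm_def prod.distrib[symmetric] by (intro prod.cong) auto
  then have 1: "?P q * ?P h = ?t ^ l * ?P w"
    by (simp add: prod.distrib prod_power_distrib[symmetric] prim_norm_def)
  have card: "card (primitive_roots p (Suc k)) = \<phi>" using p0 by (simp add: card_primitive_roots \<phi>_def)
  have "(\<Prod>z\<in>primitive_roots p (Suc k). of_nat p * ev q z)
      = (\<Prod>z\<in>primitive_roots p (Suc k). (-1) * (z - 1) ^ \<phi>)"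
    by (intro prod.cong) (auto simp: q(2))
  then have Pq: "of_nat p ^ \<phi> * ?P q = (-1) ^ \<phi> * ?t ^ \<phi>"
    unfolding prod.distrib prod_power_distrib[symmetric] prod_constant card prim_norm_def .
  then have 2: "?t ^ \<phi> = (-1) ^ \<phi> * of_nat p ^ \<phi> * ?P q"
  proof -
    have "(-1) ^ \<phi> * (-1) ^ \<phi> = (1::complex)" by (simp flip: power_mult_distrib)
    then have "?t ^ \<phi> = (-1) ^ \<phi> * ((-1) ^ \<phi> * ?t ^ \<phi>)" by (simp only: mult.assoc[symmetric]) simp
    also have "(-1) ^ \<phi> * ?t ^ \<phi> = of_nat p ^ \<phi> * ?P q" by (rule Pq[symmetric])
    finally show ?thesis by (simp only: mult.assoc)
  qed
  have "poly w 1 = poly u 1" using q(1) l by (simp add: w_def power_0_left)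
  then have units: "p_unit p (?P q)" "p_unit p (?P w)" "p_unit p (-1)"
    using q(1) u p0 p_unit_of_int[of p "-1"] by (auto intro!: p_unit_prim_norm p)
  define U where "U = ((-1) ^ \<phi> * ?P q) ^ l * ?P w ^ \<phi> * inverse (?P q ^ \<phi>)"
  have "p_unit p U"
    unfolding U_def by (intro p_unit_mult p_unit_power p_unit_inverse units p)
  moreover have "?P h ^ \<phi> = of_nat p ^ (l * \<phi>) * U"
  proof -
    have "?P q ^ \<phi> * ?P h ^ \<phi> = (?t ^ \<phi>) ^ l * ?P w ^ \<phi>"
      unfolding power_mult_distrib[symmetric] 1 by (simp add: power_mult_distrib power_mult[symmetric] mult.commute)
    also have "\<dots> = of_nat p ^ (l * \<phi>) * (((-1) ^ \<phi> * ?P q) ^ l * ?P w ^ \<phi>)"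
      unfolding 2 by (simp add: power_mult_distrib power_mult[symmetric] mult_ac)
    finally show ?thesis
      using p_unit_nonzero[OF units(1)] by (simp add: U_def field_simps)
  qed
  ultimately show ?thesis by (rule that)
qed


section \<open>Weierstrass preparation at finite levels\<close>

lemma monic_division:
  fixes f m :: "int poly"
  assumes m: "lead_coeff m = 1" "degree m > 0"
  obtains q r where "f = q * m + r" "degree r < degree m"
proof -
  have m0: "m \<noteq> 0" using m by auto
  obtain q r where qr: "pseudo_divmod f m = (q, r)" by (cases "pseudo_divmod f m")
  from pseudo_divmod[OF m0 qr] m have "f = q * m + r" "r = 0 \<or> degree r < degree m"
    by (simp_all add: mult.commute)
  then show ?thesis using m by (intro that[of q r]) auto
qed

lemma dvd_small_degree_imp_0:
  fixes m r :: "int poly"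
  assumes "m dvd r" "degree r < degree m"
  shows "r = 0"
  using assms dvd_imp_degree_le[of m r] by auto

text \<open>As long as \<open>p\<close> divides \<open>h(1)\<close>, synthetic division splits off
  \<open>x - 1\<close> up to a constant multiple of \<open>p\<close>, and the degree drops. The
  bound on \<open>l\<close> later places it below \<open>p^K\<close>.\<close>

lemma order_mod_prime_at_1:
  fixes h :: "int poly"
  assumes p: "prime p" and "\<not> [:int p:] dvd h"
  obtains l a u where "h = [:int p:] * a + [:-1, 1:] ^ l * u" "\<not> int p dvd poly u 1" "l \<le> degree h"
proof -
  have "\<exists>l a u. h = [:int p:] * a + [:-1, 1:] ^ l * u \<and> \<not> int p dvd poly u 1 \<and> l \<le> degree h"
    using assms(2)
  proof (induction "degree h" arbitrary: h rule: less_induct)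
    case less
    show ?case
    proof (cases "int p dvd poly h 1")
      case False
      then show ?thesis by (intro exI[of _ 0] exI[of _ "0 :: int poly"] exI[of _ h]) simp
    next
      case True
      then obtain c where c: "poly h 1 = int p * c" by (auto elim!: dvdE)
      define g where "g = synthetic_div h 1"
      have hg: "h = [:int p:] * [:c:] + [:-1, 1:] * g"
      proof -
        have "[:int p:] * [:c:] = [:poly h 1:]" by (simp add: c mult.commute)
        then show ?thesis using synthetic_div_correct'[of 1 h] by (metis g_def add.commute)
      qed
      have deg: "degree h > 0"
      proof (rule ccontr)
        assume "\<not> degree h > 0"
        then obtain b where b: "h = [:b:]" by (auto elim!: degree_eq_zeroE)
        then have "[:int p:] dvd h" using True by simp
        then show False using less.prems by simp
      qed
      have "\<not> [:int p:] dvd g"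
      proof
        assume "[:int p:] dvd g"
        then have "[:int p:] dvd [:int p:] * [:c:] + [:-1, 1:] * g" by (intro dvd_add dvd_mult dvd_triv_left)
        then show False using less.prems hg by simp
      qed
      moreover have "degree g = degree h - 1" by (simp add: g_def degree_synthetic_div)
      ultimately obtain l a u where "g = [:int p:] * a + [:-1, 1:] ^ l * u" "\<not> int p dvd poly u 1" "l \<le> degree g"
        using less.hyps[of g] deg by auto
      then show ?thesis
        using hg deg \<open>degree g = degree h - 1\<close>
        by (intro exI[of _ "Suc l"] exI[of _ "[:c:] + [:-1, 1:] * a"] exI[of _ u]) (auto simp: algebra_simps)
    qed
  qed
  then show ?thesis using that by blast
qed

lemma eventually_constant_antimono:
  fixes c :: "nat \<Rightarrow> nat"
  assumes "\<And>k. k \<ge> k0 \<Longrightarrow> c (Suc k) \<le> c k"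
  obtains K where "K \<ge> k0" "\<And>k. k \<ge> K \<Longrightarrow> c k = c K"
proof -
  have anti: "c k \<le> c j" if "k \<ge> j" "j \<ge> k0" for j k
    using that by (induction k rule: dec_induct) (auto intro: order_trans assms)
  define m where "m = (LEAST m. \<exists>k\<ge>k0. c k = m)"
  have "\<exists>k\<ge>k0. c k = m" unfolding m_def by (rule LeastI_ex) auto
  then obtain K where K: "K \<ge> k0" "c K = m" by auto
  have "c k = c K" if "k \<ge> K" for k
  proof (rule antisym)
    show "c k \<le> c K" using anti[of K k] that K by simp
    have "\<exists>j\<ge>k0. c j = c k" using that K by (intro exI[of _ k]) auto
    then have "m \<le> c k" unfolding m_def by (rule Least_le)
    then show "c K \<le> c k" using K by simp
  qed
  with K show ?thesis using that by blast
qed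

lemma degree_unity_poly: "N > 0 \<Longrightarrow> degree (monom 1 N - 1 :: int poly) = N"
  "N > 0 \<Longrightarrow> lead_coeff (monom 1 N - 1 :: int poly) = 1"
proof -
  assume "N > 0"
  then have "monom 1 N - 1 = (- 1 :: int poly) + monom 1 N" "degree (- 1 :: int poly) < degree (monom (1::int) N)"
    by (simp_all add: degree_monom_eq)
  then show deg: "degree (monom 1 N - 1 :: int poly) = N"
    by (metis degree_add_eq_right degree_monom_eq one_neq_zero)
  show "lead_coeff (monom 1 N - 1 :: int poly) = 1"
    unfolding deg using \<open>N > 0\<close> by simp
qed

text \<open>Makes the rings \<open>Z[x]/(x^(p^k) - 1)\<close> a projective system, so that
  congruences descend to lower levels.\<close>

lemma unity_poly_dvd: "(monom 1 (p ^ j) - 1 :: int poly) dvd monom 1 (p ^ k) - 1" if "j \<le> k"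
proof -
  have "(monom 1 (p ^ k) :: int poly) = monom 1 (p ^ j) ^ (p ^ (k - j))"
    using that by (simp only: monom_power power_add[symmetric] power_one) simp
  moreover have "(monom 1 (p ^ j) - 1 :: int poly) dvd monom 1 (p ^ j) ^ (p ^ (k - j)) - 1"
    unfolding power_diff_1_eq by (rule dvd_triv_left)
  ultimately show ?thesis by simp
qed

text \<open>Weierstrass preparation for the sequence \<open>f k\<close>, an element of the Iwasawa algebra: \<open>\<mu>\<close> is
  the eventual content of \<open>f k\<close> reduced modulo \<open>x ^ (p ^ k) - 1\<close> and \<open>l\<close> the order of vanishing at
  \<open>x = 1\<close> of \<open>f k / p ^ \<mu>\<close> modulo \<open>p\<close>.\<close>

lemma prim_norm_valuation_sequence:
  fixes f :: "nat \<Rightarrow> int poly"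
  assumes p: "prime p"
    and cong: "\<And>k. (monom 1 (p ^ k) - 1) dvd f (Suc k) - f k"
    and nonzero: "\<And>k. k \<ge> k0 \<Longrightarrow> prim_norm p (Suc k) (f (Suc k)) \<noteq> 0"
  shows "\<exists>\<mu> l K. (\<forall>k\<ge>K. \<exists>U. p_unit p U \<and> prim_norm p (Suc k) (f (Suc k)) ^ (p ^ Suc k - p ^ k)
        = of_nat p ^ ((\<mu> * (p ^ Suc k - p ^ k) + l) * (p ^ Suc k - p ^ k)) * U)
      \<and> ((\<forall>k. poly (f k) 1 = 0) \<longrightarrow> l \<ge> 1)"
proof -
  define M :: "nat \<Rightarrow> int poly" where "M k = monom 1 (p ^ k) - 1" for k
  have p1: "p > 1" using p by (rule prime_gt_1_nat)
  have degM: "degree (M k) = p ^ k" and monicM: "lead_coeff (M k) = 1" for k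
    using degree_unity_poly[of "p ^ k"] p1 by (simp_all add: M_def)
  have "\<exists>r. M k dvd f k - r \<and> degree r < p ^ k" for k
  proof -
    obtain q r where "f k = q * M k + r" "degree r < degree (M k)"
      using monic_division[of "M k" "f k"] monicM degM p1 by auto
    then show ?thesis using degM by (intro exI[of _ r]) auto
  qed
  \<comment> \<open>The reduced representatives have degree below \<open>p^k\<close>, so a
    congruence between two such polynomials modulo \<open>M k\<close> is an equality, and their
    content at \<open>p\<close> is well defined.\<close>
  then obtain r where r: "\<And>k. M k dvd f k - r k" "\<And>k. degree (r k) < p ^ k" by metis
  have f_cong: "M j dvd f k - f j" if "j \<le> k" for j k
    using that
  proof (induction k rule: dec_induct)
    case (step k)
    have "M j dvd M k" using step unfolding M_def by (intro unity_poly_dvd) simp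
    then have "M j dvd f (Suc k) - f k" using cong[of k] by (metis M_def dvd_trans)
    then have "M j dvd (f (Suc k) - f k) + (f k - f j)" using step.IH by (intro dvd_add)
    then show ?case by simp
  qed simp
  have r_cong: "M j dvd r k - r j" if "j \<le> k" for j k
  proof -
    have "M j dvd M k" using that unfolding M_def by (rule unity_poly_dvd)
    then have "M j dvd f k - r k" using r(1)[of k] by (rule dvd_trans)
    then have "M j dvd (f k - f j) + (f j - r j) - (f k - r k)"
      by (rule dvd_diff[OF dvd_add[OF f_cong[OF that] r(1)[of j]]])
    then show ?thesis by simp
  qed
  have norm_r: "prim_norm p k (f k) = prim_norm p k (r k)" for k
    unfolding prim_norm_def
  proof (rule prod.cong[OF refl])
    fix z assume z: "z \<in> primitive_roots p k"
    obtain g where "f k - r k = M k * g" using r(1)[of k] by (auto elim!: dvdE)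
    then have "ev (f k - r k) z = ev (M k * g) z" by simp
    then show "ev (f k) z = ev (r k) z" using z by (simp add: M_def primitive_roots_def)
  qed
  have r_nz: "r (Suc k) \<noteq> 0" if "k \<ge> k0" for k
  proof
    assume "r (Suc k) = 0"
    then have "ev (r (Suc k)) z = 0" for z by simp
    moreover have "card (primitive_roots p (Suc k)) > 0"
      using p1 by (simp add: card_primitive_roots)
    ultimately have "prim_norm p (Suc k) (r (Suc k)) = 0"
      by (simp add: prim_norm_def power_0_left)
    then show False using nonzero[OF that] norm_r by simp
  qed
  \<comment> \<open>Division by the monic \<open>M j\<close> respects constant factors, so a power
    of \<open>p\<close> dividing \<open>r k\<close> also divides \<open>r j\<close>: the content at
    \<open>p\<close> can only drop as the level rises.\<close>
  have reduce: "\<exists>h. r j = [:int p:] ^ m * h \<and> M j dvd g - h" if rk: "r k = [:int p:] ^ m * g" and jk: "j \<le> k" for j k m g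
  proof -
    obtain q h where h: "g = q * M j + h" "degree h < degree (M j)"
      using monic_division[of "M j" g] monicM degM p1 by auto
    have "M j dvd r k - r j" by (rule r_cong[OF jk])
    then have "M j dvd (r k - r j) - [:int p:] ^ m * q * M j" by (rule dvd_diff) simp
    also have "(r k - r j) - [:int p:] ^ m * q * M j = [:int p:] ^ m * h - r j"
      by (simp add: rk h(1) algebra_simps)
    finally have "M j dvd [:int p:] ^ m * h - r j" .
    moreover have "degree ([:int p:] ^ m * h - r j) < degree (M j)"
    proof (rule degree_diff_less)
      have "degree ([:int p:] ^ m * h) \<le> degree ([:int p:] ^ m) + degree h" by (rule degree_mult_le)
      also have "degree ([:int p:] ^ m) = 0" by (metis degree_pCons_0 poly_const_pow)
      finally show "degree ([:int p:] ^ m * h) < degree (M j)" using h(2) by simp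
    qed (use r(2)[of j] degM in simp)
    ultimately have "[:int p:] ^ m * h - r j = 0" by (rule dvd_small_degree_imp_0)
    then show ?thesis using h(1) by (intro exI[of _ h]) auto
  qed
  define c where "c k = multiplicity [:int p:] (r k)" for k
  have pn: "\<not> is_unit [:int p:]" using p1 by (simp add: is_unit_const_poly_iff)
  have "c (Suc k) \<le> c k" if "k \<ge> Suc k0" for k
  proof -
    have "[:int p:] ^ c (Suc k) dvd r (Suc k)" unfolding c_def by (rule multiplicity_dvd)
    then obtain g where "r (Suc k) = [:int p:] ^ c (Suc k) * g" by (auto elim!: dvdE)
    then have "[:int p:] ^ c (Suc k) dvd r k" using reduce[of "Suc k" "c (Suc k)" g k] by auto
    moreover have "r k \<noteq> 0" using r_nz[of "k - 1"] that by simp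
    ultimately show ?thesis unfolding c_def using pn by (intro multiplicity_geI)
  qed
  then obtain K where K: "K \<ge> Suc k0" "\<And>k. k \<ge> K \<Longrightarrow> c k = c K"
    using eventually_constant_antimono[of "Suc k0" c] by blast
  define \<mu> where "\<mu> = c K"
  have "r K \<noteq> 0" using r_nz[of "K - 1"] K(1) by simp
  then obtain hK where hK: "r K = [:int p:] ^ \<mu> * hK" "\<not> [:int p:] dvd hK"
    using multiplicity_decompose'[OF _ pn] unfolding \<mu>_def c_def by metis
  obtain l a u where lau: "hK = [:int p:] * a + [:-1, 1:] ^ l * u" "\<not> int p dvd poly u 1" "l \<le> degree hK"
    by (rule order_mod_prime_at_1[OF p hK(2)])
  have p\<mu>: "[:int p:] ^ \<mu> = [:int p ^ \<mu>:]" by (rule poly_const_pow)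
  have "degree (r K) = degree hK" using p1 by (simp add: hK(1) p\<mu>)
  then have l_less: "l < p ^ K" using lau(3) r(2)[of K] by simp
  obtain e where e: "M K - [:-1, 1:] ^ (p ^ K) = [:int p:] * e"
    using monom_prime_power_cong[OF p, of K] by (auto simp: M_def elim!: dvdE)
  \<comment> \<open>Level \<open>K\<close> fixes \<open>l\<close> for all higher levels:
    \<open>h\<close> changes by a multiple of \<open>M K\<close>, which is
    \<open>(x - 1)^(p^K)\<close> modulo \<open>p\<close>, and \<open>p^K > l\<close>. Thus
    \<open>u\<close> changes by a multiple of \<open>x - 1\<close> only, and \<open>u(1)\<close>
    stays the same.\<close>
  have shape: "\<exists>h a u. r k = [:int p:] ^ \<mu> * h \<and> h = [:int p:] * a + [:-1, 1:] ^ l * u \<and> \<not> int p dvd poly u 1"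
    if k: "k \<ge> K" for k
  proof -
    have "\<mu> = multiplicity [:int p:] (r k)" using K(2)[OF k] by (simp add: \<mu>_def c_def)
    then have "[:int p:] ^ \<mu> dvd r k" by (simp only: multiplicity_dvd)
    then obtain h where h: "r k = [:int p:] ^ \<mu> * h" by (auto elim!: dvdE)
    from reduce[OF h k] obtain h' where h': "r K = [:int p:] ^ \<mu> * h'" "M K dvd h - h'" by auto
    have "[:int p:] ^ \<mu> * h' = [:int p:] ^ \<mu> * hK"
      using trans[OF h'(1)[symmetric] hK(1)] .
    then have "h' = hK" using p1 by auto
    with h'(2) obtain b where b: "h - hK = M K * b" by (auto elim!: dvdE)
    have "h = hK + M K * b" using b by (simp add: algebra_simps)
    also have "M K = [:-1, 1:] ^ (p ^ K) + [:int p:] * e" using e by (simp add: algebra_simps)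
    also have "[:-1, 1:] ^ (p ^ K) = ([:-1, 1:] :: int poly) ^ l * [:-1, 1:] ^ (p ^ K - l)"
      using l_less by (simp add: power_add[symmetric])
    finally have "h = [:int p:] * (a + e * b) + [:-1, 1:] ^ l * (u + [:-1, 1:] ^ (p ^ K - l) * b)"
      unfolding lau(1) by (simp only: algebra_simps)
    moreover have "poly (u + [:-1, 1:] ^ (p ^ K - l) * b) 1 = poly u 1"
      using l_less by (simp add: power_0_left)
    ultimately show ?thesis using h lau(2) by metis
  qed
  have collect: "(x ^ (s * t) * y) ^ t = x ^ ((s * t + c) * t) * U" if "y ^ t = x ^ (c * t) * U"
    for x y U :: complex and s t c :: nat
  proof -
    have "(x ^ (s * t) * y) ^ t = x ^ (s * t * t) * (x ^ (c * t) * U)"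
      by (simp only: power_mult_distrib that power_mult)
    then show ?thesis by (simp add: add_mult_distrib power_add)
  qed
  show ?thesis
  \<comment> \<open>From \<open>K + l\<close> on one has \<open>l < p^k <= p^(k+1) - p^k\<close>, as
    \<open>prim_norm_valuation\<close> requires.\<close>
  proof (rule exI[of _ \<mu>], rule exI[of _ l], rule exI[of _ "K + l"], intro conjI allI impI)
    fix k assume k: "k \<ge> K + l"
    let ?\<phi> = "p ^ Suc k - p ^ k"
    obtain h a u where h: "r (Suc k) = [:int p:] ^ \<mu> * h" "h = [:int p:] * a + [:-1, 1:] ^ l * u" "\<not> int p dvd poly u 1"
      using shape[of "Suc k"] k by auto
    have "l < p ^ k" using power_gt_expt[of p k] p1 k by simp
    moreover have "2 * p ^ k \<le> p * p ^ k" using p1 by (intro mult_le_mono1) simp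
    then have "p ^ k \<le> ?\<phi>" unfolding power_Suc by linarith
    ultimately have "l < ?\<phi>" by (rule less_le_trans)
    then obtain U where U: "p_unit p U" "prim_norm p (Suc k) h ^ ?\<phi> = of_nat p ^ (l * ?\<phi>) * U"
      using prim_norm_valuation[OF p h(2,3)] by metis
    have "prim_norm p (Suc k) ([:int p:] ^ \<mu>) = of_nat p ^ (\<mu> * ?\<phi>)"
      using p1 by (simp add: prim_norm_def card_primitive_roots power_mult)
    then have "prim_norm p (Suc k) (f (Suc k)) = of_nat p ^ (\<mu> * ?\<phi>) * prim_norm p (Suc k) h"
      by (simp add: norm_r h(1) prim_norm_mult)
    then have "prim_norm p (Suc k) (f (Suc k)) ^ ?\<phi> = of_nat p ^ ((\<mu> * ?\<phi> + l) * ?\<phi>) * U"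
      using collect[OF U(2)] by simp
    then show "\<exists>U. p_unit p U \<and> prim_norm p (Suc k) (f (Suc k)) ^ ?\<phi> = of_nat p ^ ((\<mu> * ?\<phi> + l) * ?\<phi>) * U"
      using U(1) by blast
  next
    assume zero: "\<forall>k. poly (f k) 1 = 0"
    \<comment> \<open>\<open>f K\<close> and \<open>r K\<close> agree at 1, a root of
      \<open>M K\<close>. So \<open>hK\<close> vanishes at 1, and \<open>l = 0\<close> would force
      \<open>p\<close> to divide \<open>u(1)\<close>.\<close>
    obtain g where "f K - r K = M K * g" using r(1)[of K] by (auto elim!: dvdE)
    then have "poly (f K - r K) 1 = poly (M K * g) 1" by simp
    then have "poly (r K) 1 = 0" using zero by (simp add: M_def poly_monom)
    then have "poly hK 1 = 0" using p1 by (simp add: hK(1) p\<mu>)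
    have "l \<noteq> 0"
    proof
      assume "l = 0"
      then have "poly u 1 = int p * (- poly a 1)" using \<open>poly hK 1 = 0\<close> lau(1) by simp
      then show False using lau(2) by (metis dvd_triv_left)
    qed
    then show "l \<ge> 1" by simp
  qed
qed

section \<open>Finite levels of the group of \<open>p\<close>-adic integers\<close>

lemma Zp_bounds:
  assumes "x \<in> carrier (Zp p)"
  shows "0 \<le> x n" "x n < int p ^ n"
  using assms by (auto simp: Zp_def)

lemma Zp_mod_le:
  assumes "x \<in> carrier (Zp p)" "k \<le> n"
  shows "x n mod int p ^ k = x k"
  using Zp_mod[OF assms(1), of k "n - k"] assms(2) by simp

lemma Zp_zero [simp]: "x \<in> carrier (Zp p) \<Longrightarrow> x 0 = 0"
  using Zp_bounds[of x p 0] by simp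

text \<open>In a finite quotient an element of least valuation \<open>k\<close> generates all
  multiples of \<open>p^k\<close>, because its cofactor is invertible modulo
  \<open>p^n\<close>.\<close>

lemma Zp_subgroup_levels:
  assumes p: "prime p" and H: "subgroup H (Zp p)"
  shows "(\<forall>n. (\<lambda>x. x n) ` H = {0})
    \<or> (\<exists>k. \<forall>n. (\<lambda>x. x n) ` H = {c. 0 \<le> c \<and> c < int p ^ n \<and> int p ^ (min n k) dvd c})"
proof (cases "\<forall>x\<in>H. \<forall>n. x n = 0")
  case True
  have "\<one>\<^bsub>Zp p\<^esub> \<in> H" using H by (rule subgroup.one_closed)
  then have "(\<lambda>x. x n) ` H = (\<lambda>x. 0) ` H" "H \<noteq> {}" for n using True by (auto intro!: image_cong)
  then have "(\<lambda>x. x n) ` H = {0}" for n by (simp add: image_constant_conv)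
  then show ?thesis by blast
next
  case False
  have carrier: "x \<in> carrier (Zp p)" if "x \<in> H" for x using subgroup.mem_carrier[OF H that] .
  have p0: "p > 0" "int p > 0" using p by (simp_all add: prime_gt_0_nat)
  \<comment> \<open>The first level where some element is nonzero. Level 0 is trivial, so
    \<open>j = k + 1\<close>, with \<open>k\<close> the least valuation.\<close>
  define j where "j = (LEAST n. \<exists>x\<in>H. x n \<noteq> 0)"
  have "\<exists>x\<in>H. x j \<noteq> 0" unfolding j_def by (rule LeastI_ex) (use False in blast)
  then obtain x where x: "x \<in> H" "x j \<noteq> 0" by blast
  then obtain k where k: "j = Suc k" using carrier[OF x(1)] by (cases j) auto
  have zero: "y n = 0" if "y \<in> H" "n \<le> k" for y n
    using that not_less_Least[of n "\<lambda>n. \<exists>x\<in>H. x n \<noteq> 0"] k by (auto simp: j_def)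
  have "(\<lambda>x. x n) ` H = {c. 0 \<le> c \<and> c < int p ^ n \<and> int p ^ (min n k) dvd c}" for n
  proof (intro equalityI subsetI)
    fix c assume "c \<in> (\<lambda>x. x n) ` H"
    then obtain y where y: "y \<in> H" "c = y n" by blast
    have "y n mod int p ^ (min n k) = y (min n k)" by (rule Zp_mod_le) (use y carrier in auto)
    then show "c \<in> {c. 0 \<le> c \<and> c < int p ^ n \<and> int p ^ (min n k) dvd c}"
      using zero[OF y(1), of "min n k"] Zp_bounds[OF carrier[OF y(1)], of n] y(2) by (auto simp: dvd_eq_mod_eq_0)
  next
    fix c assume c: "c \<in> {c. 0 \<le> c \<and> c < int p ^ n \<and> int p ^ (min n k) dvd c}"
    show "c \<in> (\<lambda>x. x n) ` H"
    proof (cases "n \<le> k")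
      case True
      then have "c = 0" using c by (auto dest: zdvd_imp_le)
      then show ?thesis using zero[OF x(1) True] x(1) by (intro image_eqI[of _ _ x]) auto
    next
      case nk: False
      then have "min n k = k" by simp
      then obtain d where d: "c = int p ^ k * d" using c by (auto elim!: dvdE)
      have "x n mod int p ^ k = 0" using Zp_mod_le[OF carrier[OF x(1)], of k n] zero[OF x(1)] nk by simp
      then obtain u where u: "x n = int p ^ k * u" by (auto simp: dvd_eq_mod_eq_0[symmetric] elim!: dvdE)
      have "\<not> int p dvd u"
      proof
        assume "int p dvd u"
        then have "int p ^ Suc k dvd x n" unfolding u by (simp add: mult.commute mult_dvd_mono)
        moreover have "x n mod int p ^ Suc k = x (Suc k)" using Zp_mod_le[OF carrier[OF x(1)], of "Suc k" n] nk by simp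
        ultimately show False using x(2) k by (simp add: dvd_eq_mod_eq_0)
      qed
      then have "coprime (int p) u" using p by (intro prime_imp_coprime) auto
      then have "coprime u (int p ^ n)" by (simp add: coprime_commute)
      then obtain t y where "t * u + y * int p ^ n = 1" using bezout_int[of u "int p ^ n"] by auto
      then have t: "u * t = 1 + int p ^ n * (- y)" by (simp add: algebra_simps)
      \<comment> \<open>\<open>t\<close> inverts the cofactor \<open>u\<close> modulo
        \<open>p^n\<close>, so the multiple \<open>t d\<close> of \<open>x\<close> has residue
        \<open>c\<close> at level \<open>n\<close>.\<close>
      define s where "s = nat ((t * d) mod int p ^ n)"
      have s: "int s = (t * d) mod int p ^ n" using p0 by (simp add: s_def)
      have "(x [^]\<^bsub>Zp p\<^esub> s) n = (int s * x n) mod int p ^ n" by (rule Zp_pow)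
      also have "\<dots> = (t * d * (int p ^ k * u)) mod int p ^ n" by (simp add: s u mod_mult_left_eq)
      also have "t * d * (int p ^ k * u) = (u * t) * (int p ^ k * d)" by (simp add: algebra_simps)
      also have "\<dots> mod int p ^ n = (1 * (int p ^ k * d)) mod int p ^ n"
        unfolding t distrib_right mult.assoc by (rule mod_mult_self2)
      also have "\<dots> = c" using c d by simp
      finally have "(x [^]\<^bsub>Zp p\<^esub> s) n = c" .
      moreover have "x [^]\<^bsub>Zp p\<^esub> s \<in> H"
      proof -
        interpret comm_group "Zp p" by (rule comm_group_Zp[OF p0(1)])
        show ?thesis using H x(1) by (induction s) (auto simp: subgroup.one_closed subgroup.m_closed)
      qed
      ultimately show ?thesis by blast
    qed
  qed
  then show ?thesis by blast
qed

text \<open>The element of \<open>\<Gamma> p n\<close> with residue \<open>c\<close>, as a concrete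
  coset; it allows the layers to be handled with natural numbers below \<open>p^n\<close>.\<close>

definition level_class :: "nat \<Rightarrow> nat \<Rightarrow> nat \<Rightarrow> (nat \<Rightarrow> int) set" where
  "level_class p n c = {x \<in> carrier (Zp p). x n = int c}"

lemma level_class_nonempty:
  assumes "p > 0" "c < p ^ n"
  obtains x where "x \<in> carrier (Zp p)" "x n = int c"
proof (rule that[of "\<lambda>k. int c mod int p ^ k"])
  show "(\<lambda>k. int c mod int p ^ k) \<in> carrier (Zp p)"
    using assms by (simp add: Zp_def mod_mod_cancel)
  show "int c mod int p ^ n = int c" using assms by (simp flip: of_nat_power)
qed

lemma inj_on_level_class: "p > 0 \<Longrightarrow> inj_on (level_class p n) {..<p ^ n}"
proof (rule inj_onI)
  fix c d assume *: "p > 0" "c \<in> {..<p ^ n}" "d \<in> {..<p ^ n}" "level_class p n c = level_class p n d"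
  obtain x where "x \<in> carrier (Zp p)" "x n = int c" using level_class_nonempty[of p c n] * by auto
  then have "x \<in> level_class p n d" unfolding *(4)[symmetric] by (simp add: level_class_def)
  then show "c = d" using \<open>x n = int c\<close> by (simp add: level_class_def)
qed

lemma \<pi>_eq_level_class:
  assumes p: "p > 0" and x: "x \<in> carrier (Zp p)"
  shows "\<pi> p n x = level_class p n (nat (x n))"
proof -
  interpret comm_group "Zp p" by (rule comm_group_Zp[OF p])
  interpret N: normal "pow_Zp p n" "Zp p" by (rule normal_pow_Zp[OF p])
  have xn: "int (nat (x n)) = x n" using Zp_bounds[OF x] by simp
  show ?thesis
  proof (intro equalityI subsetI)
    fix y assume "y \<in> \<pi> p n x"
    then obtain h where h: "h \<in> pow_Zp p n" "y = h \<otimes>\<^bsub>Zp p\<^esub> x" by (auto simp: \<pi>_def r_coset_def)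
    then have h': "h \<in> carrier (Zp p)" "h n = 0" unfolding pow_Zp_eq[OF p] by blast+
    then have "y \<in> carrier (Zp p)" using h(2) x by simp
    moreover have "y n = x n" using h(2) h'(2) Zp_bounds[OF x, of n] by (simp add: Zp_def)
    ultimately show "y \<in> level_class p n (nat (x n))" unfolding level_class_def xn by simp
  next
    fix y assume "y \<in> level_class p n (nat (x n))"
    then have y: "y \<in> carrier (Zp p)" "y n = x n" unfolding level_class_def xn by simp_all
    define h where "h = y \<otimes>\<^bsub>Zp p\<^esub> inv\<^bsub>Zp p\<^esub> x"
    have h: "h \<in> carrier (Zp p)" "y = h \<otimes>\<^bsub>Zp p\<^esub> x" using x y by (simp_all add: h_def m_assoc)
    then have "(h n + x n) mod int p ^ n = x n" using y(2) by (simp add: Zp_def)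
    then have "(h n + x n) mod int p ^ n = x n mod int p ^ n" using Zp_bounds[OF x, of n] by simp
    then have "h n mod int p ^ n = 0" by (simp add: mod_eq_dvd_iff)
    then have "h n = 0" using Zp_bounds[OF h(1), of n] by simp
    then have "h \<in> pow_Zp p n" using h(1) unfolding pow_Zp_eq[OF p] by blast
    then show "y \<in> \<pi> p n x" using h(2) by (auto simp: \<pi>_def r_coset_def)
  qed
qed

lemma carrier_\<Gamma>:
  assumes p: "p > 0"
  shows "carrier (\<Gamma> p n) = level_class p n ` {..<p ^ n}"
proof -
  have "carrier (\<Gamma> p n) = \<pi> p n ` carrier (Zp p)"
    by (auto simp: \<Gamma>_def \<pi>_def FactGroup_def RCOSETS_def)
  also have "\<dots> = level_class p n ` {..<p ^ n}"
  proof (intro equalityI subsetI)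
    fix C assume "C \<in> \<pi> p n ` carrier (Zp p)"
    then obtain x where x: "x \<in> carrier (Zp p)" "C = \<pi> p n x" by blast
    have "nat (x n) < p ^ n" using Zp_bounds[OF x(1), of n] by (simp add: nat_less_iff)
    then show "C \<in> level_class p n ` {..<p ^ n}" using x \<pi>_eq_level_class[OF p x(1)] by auto
  next
    fix C assume "C \<in> level_class p n ` {..<p ^ n}"
    then obtain c where c: "c < p ^ n" "C = level_class p n c" by blast
    obtain x where "x \<in> carrier (Zp p)" "x n = int c" using level_class_nonempty[OF p c(1)] .
    then show "C \<in> \<pi> p n ` carrier (Zp p)" using \<pi>_eq_level_class[OF p, of x n] c(2) by auto
  qed
  finally show ?thesis .
qed

lemma \<Gamma>_mult:
  assumes p: "p > 0" and "a < p ^ n" "b < p ^ n"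
  shows "level_class p n a \<otimes>\<^bsub>\<Gamma> p n\<^esub> level_class p n b = level_class p n ((a + b) mod p ^ n)"
proof -
  interpret comm_group "Zp p" by (rule comm_group_Zp[OF p])
  interpret N: normal "pow_Zp p n" "Zp p" by (rule normal_pow_Zp[OF p])
  obtain x where x: "x \<in> carrier (Zp p)" "x n = int a" using level_class_nonempty[OF p assms(2)] .
  obtain y where y: "y \<in> carrier (Zp p)" "y n = int b" using level_class_nonempty[OF p assms(3)] .
  have "\<pi> p n x \<otimes>\<^bsub>\<Gamma> p n\<^esub> \<pi> p n y = \<pi> p n (x \<otimes>\<^bsub>Zp p\<^esub> y)"
    using x y by (simp add: \<pi>_def \<Gamma>_def N.rcos_sum)
  moreover have "(x \<otimes>\<^bsub>Zp p\<^esub> y) n = int ((a + b) mod p ^ n)"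
    using x(2) y(2) by (simp add: Zp_def zmod_int)
  ultimately show ?thesis
    using x y \<pi>_eq_level_class[OF p, of _ n] by simp
qed

text \<open>Translates the vertices over a point whose group has image \<open>p^m Z / p^n Z\<close>
  into residues modulo \<open>p^m\<close>.\<close>

lemma \<Gamma>_coset:
  assumes p: "p > 0" and a: "a < p ^ n" and m: "m \<le> n"
    and levels: "(\<lambda>x. x n) ` H = {c. 0 \<le> c \<and> c < int p ^ n \<and> int p ^ m dvd c}" and H: "H \<subseteq> carrier (Zp p)"
  shows "level_class p n a <#\<^bsub>\<Gamma> p n\<^esub> (\<pi> p n ` H)
    = level_class p n ` {c. c < p ^ n \<and> c mod p ^ m = a mod p ^ m}"
proof -
  have dvd: "p ^ m dvd p ^ n" using m by (rule le_imp_power_dvd)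
  have "\<pi> p n ` H = level_class p n ` nat ` (\<lambda>x. x n) ` H"
    using H by (auto simp: image_image \<pi>_eq_level_class[OF p] subset_iff intro!: image_cong)
  also have "nat ` (\<lambda>x. x n) ` H = {b. b < p ^ n \<and> p ^ m dvd b}"
  proof -
    have "nat ` {c. 0 \<le> c \<and> c < int p ^ n \<and> int p ^ m dvd c} = {b. b < p ^ n \<and> p ^ m dvd b}"
    proof (intro equalityI subsetI)
      fix b assume "b \<in> {b. b < p ^ n \<and> p ^ m dvd b}"
      then show "b \<in> nat ` {c. 0 \<le> c \<and> c < int p ^ n \<and> int p ^ m dvd c}"
        by (intro image_eqI[of _ _ "int b"]) (auto simp flip: of_nat_power)
    next
      fix b assume "b \<in> nat ` {c. 0 \<le> c \<and> c < int p ^ n \<and> int p ^ m dvd c}"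
      then obtain c where c: "b = nat c" "0 \<le> c" "c < int p ^ n" "int p ^ m dvd c" by blast
      then have "int b = c" by simp
      with c have "int b < int (p ^ n)" "int (p ^ m) dvd int b" by simp_all
      then show "b \<in> {b. b < p ^ n \<and> p ^ m dvd b}" by (simp only: of_nat_less_iff int_dvd_int_iff mem_Collect_eq)
    qed
    then show ?thesis using levels by simp
  qed
  finally have img: "\<pi> p n ` H = level_class p n ` {b. b < p ^ n \<and> p ^ m dvd b}" .
  have "level_class p n a <#\<^bsub>\<Gamma> p n\<^esub> (\<pi> p n ` H)
      = (\<lambda>b. level_class p n a \<otimes>\<^bsub>\<Gamma> p n\<^esub> level_class p n b) ` {b. b < p ^ n \<and> p ^ m dvd b}"
    by (auto simp: l_coset_def img)
  also have "\<dots> = (\<lambda>b. level_class p n ((a + b) mod p ^ n)) ` {b. b < p ^ n \<and> p ^ m dvd b}"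
    by (intro image_cong refl) (simp add: \<Gamma>_mult[OF p a])
  also have "\<dots> = level_class p n ` (\<lambda>b. (a + b) mod p ^ n) ` {b. b < p ^ n \<and> p ^ m dvd b}"
    by (simp add: image_image)
  also have "(\<lambda>b. (a + b) mod p ^ n) ` {b. b < p ^ n \<and> p ^ m dvd b} = {c. c < p ^ n \<and> c mod p ^ m = a mod p ^ m}"
  proof (intro equalityI subsetI)
    fix c assume "c \<in> (\<lambda>b. (a + b) mod p ^ n) ` {b. b < p ^ n \<and> p ^ m dvd b}"
    then obtain b where b: "c = (a + b) mod p ^ n" "p ^ m dvd b" by blast
    have "c mod p ^ m = (a + b) mod p ^ m" unfolding b(1) by (rule mod_mod_cancel[OF dvd])
    also have "\<dots> = a mod p ^ m" using b(2) by (auto elim!: dvdE)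
    finally show "c \<in> {c. c < p ^ n \<and> c mod p ^ m = a mod p ^ m}" using p b(1) by simp
  next
    fix c assume c: "c \<in> {c. c < p ^ n \<and> c mod p ^ m = a mod p ^ m}"
    define b where "b = (c + (p ^ n - a)) mod p ^ n"
    have "(a + b) mod p ^ n = (a + (c + (p ^ n - a))) mod p ^ n" unfolding b_def by (rule mod_add_right_eq)
    also have "a + (c + (p ^ n - a)) = c + p ^ n" using a by simp
    finally have "(a + b) mod p ^ n = c" using c by simp
    moreover have "b < p ^ n" using p by (simp add: b_def)
    moreover have "p ^ m dvd b"
    proof -
      have "(a + b) mod p ^ m = a mod p ^ m"
        using \<open>(a + b) mod p ^ n = c\<close> c mod_mod_cancel[OF dvd, of "a + b"] by simp
      then show ?thesis by (metis add_diff_cancel_left' le_add1 mod_eq_dvd_iff_nat)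
    qed
    ultimately show "c \<in> (\<lambda>b. (a + b) mod p ^ n) ` {b. b < p ^ n \<and> p ^ m dvd b}" by force
  qed
  finally show ?thesis .
qed

section \<open>Fourier decomposition of the Laplacian of a layer\<close>

lemma sum_residue_class:
  fixes M h c :: nat
  assumes "c < M"
  shows "(\<Sum>a | a < M * h \<and> a mod M = c. g a) = (\<Sum>i<h. g (c + M * i))"
proof (rule sum.reindex_bij_witness[where i = "\<lambda>i. c + M * i" and j = "\<lambda>a. a div M"])
  fix a assume "a \<in> {a. a < M * h \<and> a mod M = c}"
  then have a: "a < M * h" "a mod M = c" by auto
  show eq: "c + M * (a div M) = a" using a(2) by (metis mod_mult_div_eq)
  show "a div M \<in> {..<h}" using a(1) assms by (simp add: less_mult_imp_div_less mult.commute)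
  show "g (c + M * (a div M)) = g a" by (simp only: eq)
next
  fix i assume i: "i \<in> {..<h}"
  show "(c + M * i) div M = i" using assms by simp
  have "c + M * i < M * Suc i" using assms by simp
  also have "\<dots> \<le> M * h" using i by (intro mult_le_mono2) simp
  finally show "c + M * i \<in> {a. a < M * h \<and> a mod M = c}" using assms by simp
qed

text \<open>A character sums to zero over a coset of a subgroup on which it is nontrivial. This
  decides which vertices a character sees.\<close>

lemma sum_residue_class_powers:
  fixes z :: complex
  assumes "c < M" "z ^ (M * h) = 1"
  shows "(\<Sum>a | a < M * h \<and> a mod M = c. z ^ a) = of_nat h * of_bool (z ^ M = 1) * z ^ c"
proof -
  have "(z ^ M) ^ h = 1" using assms(2) by (simp add: power_mult)
  have "(\<Sum>a | a < M * h \<and> a mod M = c. z ^ a) = (\<Sum>i<h. z ^ (c + M * i))"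
    by (rule sum_residue_class[OF assms(1)])
  also have "\<dots> = z ^ c * (\<Sum>i<h. (z ^ M) ^ i)"
    by (simp add: sum_distrib_left power_add power_mult)
  also have "\<dots> = of_nat h * of_bool (z ^ M = 1) * z ^ c"
    by (subst sum_powers_root_of_unity[OF \<open>(z ^ M) ^ h = 1\<close>]) simp
  finally show ?thesis .
qed

lemma power_mod_root:
  fixes z :: complex
  assumes "z ^ M = 1"
  shows "z ^ (a mod M) = z ^ a"
proof -
  have "z ^ a = (z ^ M) ^ (a div M) * z ^ (a mod M)"
    by (metis power_add power_mult mult_div_mod_eq)
  then show ?thesis using assms by simp
qed

text \<open>\<open>R\<close> is the set of vertices with nontrivial group; there the group has the same finite levels
  as \<open>p ^ depth v\<close> times the \<open>p\<close>-adic integers.\<close>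

locale graph_tower =
  fixes p :: nat and X :: "('v, 'e) pre_digraph" and bar :: "'e \<Rightarrow> 'e"
    and \<alpha> :: "'e \<Rightarrow> nat \<Rightarrow> int" and \<G> :: "'v \<Rightarrow> (nat \<Rightarrow> int) set"
    and R :: "'v set" and depth :: "'v \<Rightarrow> nat"
  assumes prime_p: "prime p"
    and bidirected_X: "bidirected_digraph X bar" and fin_X: "fin_digraph X"
    and \<alpha>_carrier: "\<And>s. s \<in> arcs X \<Longrightarrow> \<alpha> s \<in> carrier (Zp p)"
    and \<alpha>_bar: "\<And>s. s \<in> arcs X \<Longrightarrow> \<alpha> (bar s) = inv\<^bsub>Zp p\<^esub> (\<alpha> s)"
    and \<G>_carrier: "\<And>v. v \<in> verts X \<Longrightarrow> \<G> v \<subseteq> carrier (Zp p)"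
    and \<G>_levels: "\<And>v n. v \<in> verts X \<Longrightarrow> (\<lambda>x. x n) ` \<G> v
      = {c. 0 \<le> c \<and> c < int p ^ n \<and> int p ^ (if v \<in> R then min n (depth v) else n) dvd c}"
    and R_sub: "R \<subseteq> verts X"
begin

sublocale X: fin_digraph X by (rule fin_X)

lemma p_pos [simp]: "p > 0" using prime_p by (rule prime_gt_0_nat)

lemma p_nonzero [simp]: "p \<noteq> 0" using p_pos by simp

text \<open>The fibre over \<open>v\<close> at level \<open>n\<close> has \<open>p ^ lvl v n\<close>
  vertices, each with a stabiliser of order \<open>p ^ (n - lvl v n)\<close>.\<close>

definition lvl :: "'v \<Rightarrow> nat \<Rightarrow> nat" where
  "lvl v n = (if v \<in> R then min n (depth v) else n)"

lemma lvl_le: "lvl v n \<le> n" by (simp add: lvl_def)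

lemma p_pow_lvl: "p ^ lvl v n * p ^ (n - lvl v n) = p ^ n"
  using lvl_le by (simp add: power_add[symmetric])

abbreviation layer :: "nat \<Rightarrow> ('v \<times> (nat \<Rightarrow> int) set set, 'e \<times> (nat \<Rightarrow> int) set) pre_digraph" where
  "layer n \<equiv> layer_graph p X \<G> \<alpha> n"

definition voltage :: "'e \<Rightarrow> nat \<Rightarrow> nat" where
  "voltage s n = nat (\<alpha> s n)"

lemma voltage_less: "s \<in> arcs X \<Longrightarrow> voltage s n < p ^ n"
  using Zp_bounds[OF \<alpha>_carrier, of s n] by (simp add: voltage_def nat_less_iff)

lemma voltage_mod:
  assumes "s \<in> arcs X"
  shows "voltage s (Suc n) mod p ^ n = voltage s n"
proof -
  have "int (voltage s k) = \<alpha> s k" for k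
    using Zp_bounds[OF \<alpha>_carrier[OF assms], of k] by (simp add: voltage_def)
  moreover have "\<alpha> s (Suc n) mod int p ^ n = \<alpha> s n" using Zp_mod_le[OF \<alpha>_carrier[OF assms], of n "Suc n"] by simp
  ultimately have "int (voltage s (Suc n) mod p ^ n) = int (voltage s n)" by (simp add: zmod_int)
  then show ?thesis by simp
qed

section \<open>Residue coordinates on the layers\<close>

definition indices :: "nat \<Rightarrow> ('v \<times> nat) set" where
  "indices n = (SIGMA v:verts X. {..<p ^ lvl v n})"

definition vertex :: "nat \<Rightarrow> 'v \<times> nat \<Rightarrow> 'v \<times> (nat \<Rightarrow> int) set set" where
  "vertex n = (\<lambda>(v, c). (v, level_class p n ` {a. a < p ^ n \<and> a mod p ^ lvl v n = c}))"

lemma finite_indices [simp]: "finite (indices n)"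
  by (simp add: indices_def)

lemma coset_eq_vertex:
  assumes "v \<in> verts X" "a < p ^ n"
  shows "(v, level_class p n a <#\<^bsub>\<Gamma> p n\<^esub> (\<pi> p n ` \<G> v)) = vertex n (v, a mod p ^ lvl v n)"
proof -
  have "level_class p n a <#\<^bsub>\<Gamma> p n\<^esub> (\<pi> p n ` \<G> v)
      = level_class p n ` {c. c < p ^ n \<and> c mod p ^ lvl v n = a mod p ^ lvl v n}"
    by (rule \<Gamma>_coset[OF p_pos assms(2) lvl_le])
      (use \<G>_levels[OF assms(1)] \<G>_carrier[OF assms(1)] in \<open>simp_all add: lvl_def\<close>)
  then show ?thesis by (simp add: vertex_def)
qed

lemma pow_lvl_le: "p ^ lvl v n \<le> p ^ n"
  using lvl_le[of v n] p_pos by (simp add: power_increasing Suc_leI)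

lemma inj_on_vertex: "inj_on (vertex n) (indices n)"
proof (rule inj_onI)
  fix x y assume xy: "x \<in> indices n" "y \<in> indices n" "vertex n x = vertex n y"
  obtain v c where x: "x = (v, c)" by fastforce
  obtain w d where y: "y = (w, d)" by fastforce
  have w: "w = v" using xy(3) by (simp add: x y vertex_def)
  have c: "c < p ^ lvl v n" using xy(1) by (simp add: x indices_def)
  then have "c < p ^ n" using pow_lvl_le[of v n] by simp
  then have "level_class p n c \<in> level_class p n ` {a. a < p ^ n \<and> a mod p ^ lvl v n = c}" using c by simp
  moreover have "level_class p n ` {a. a < p ^ n \<and> a mod p ^ lvl v n = c}
      = level_class p n ` {a. a < p ^ n \<and> a mod p ^ lvl v n = d}"
    using xy(3) by (simp add: x y w vertex_def)
  ultimately have "level_class p n c \<in> level_class p n ` {a. a < p ^ n \<and> a mod p ^ lvl v n = d}"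
    by (simp only:)
  then obtain a where "a < p ^ n" "a mod p ^ lvl v n = d" "level_class p n a = level_class p n c" by force
  then have "c mod p ^ lvl v n = d" using inj_onD[OF inj_on_level_class[OF p_pos], of n a c] \<open>c < p ^ n\<close> by auto
  then show "x = y" using c by (simp add: x y w)
qed

lemma verts_layer: "verts (layer n) = vertex n ` indices n"
proof -
  have "verts (layer n) = {(v, level_class p n a <#\<^bsub>\<Gamma> p n\<^esub> (\<pi> p n ` \<G> v)) | v a. v \<in> verts X \<and> a < p ^ n}"
    by (auto simp: layer_graph_def voltage_graph_def carrier_\<Gamma>)
  also have "\<dots> = {vertex n (v, a mod p ^ lvl v n) | v a. v \<in> verts X \<and> a < p ^ n}"
    by (metis (no_types, lifting) coset_eq_vertex)
  also have "\<dots> = vertex n ` indices n"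
  proof (intro equalityI subsetI)
    fix x assume "x \<in> {vertex n (v, a mod p ^ lvl v n) | v a. v \<in> verts X \<and> a < p ^ n}"
    then show "x \<in> vertex n ` indices n" by (auto simp: indices_def)
  next
    fix x assume "x \<in> vertex n ` indices n"
    then obtain v c where vc: "x = vertex n (v, c)" "v \<in> verts X" "c < p ^ lvl v n" by (auto simp: indices_def)
    then have "c < p ^ n" "c mod p ^ lvl v n = c" using pow_lvl_le[of v n] by auto
    then show "x \<in> {vertex n (v, a mod p ^ lvl v n) | v a. v \<in> verts X \<and> a < p ^ n}" using vc by force
  qed
  finally show ?thesis .
qed

lemma arcs_layer: "arcs (layer n) = arcs X \<times> level_class p n ` {..<p ^ n}"
  by (simp add: layer_graph_def voltage_graph_def carrier_\<Gamma>)

lemma tail_layer: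
  assumes "s \<in> arcs X" "a < p ^ n"
  shows "tail (layer n) (s, level_class p n a) = vertex n (tail X s, a mod p ^ lvl (tail X s) n)"
  using coset_eq_vertex[of "tail X s" a n] assms by (simp add: layer_graph_def voltage_graph_def)

lemma head_layer:
  assumes "s \<in> arcs X" "a < p ^ n"
  shows "head (layer n) (s, level_class p n a)
    = vertex n (head X s, (a + voltage s n) mod p ^ lvl (head X s) n)"
proof -
  have "(\<pi> p n \<circ> \<alpha>) s = level_class p n (voltage s n)"
    using \<pi>_eq_level_class[OF p_pos \<alpha>_carrier[OF assms(1)]] by (simp add: voltage_def)
  then have "head (layer n) (s, level_class p n a)
      = (head X s, level_class p n ((a + voltage s n) mod p ^ n) <#\<^bsub>\<Gamma> p n\<^esub> (\<pi> p n ` \<G> (head X s)))"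
    using \<Gamma>_mult[OF p_pos assms(2) voltage_less[OF assms(1)]]
    by (simp add: layer_graph_def voltage_graph_def)
  also have "\<dots> = vertex n (head X s, (a + voltage s n) mod p ^ n mod p ^ lvl (head X s) n)"
    using assms by (intro coset_eq_vertex) auto
  also have "(a + voltage s n) mod p ^ n mod p ^ lvl (head X s) n = (a + voltage s n) mod p ^ lvl (head X s) n"
    by (rule mod_mod_cancel) (rule le_imp_power_dvd[OF lvl_le])
  finally show ?thesis .
qed

lemma layer_serre: "finite_serre_graph (layer n) (layer_bar p X bar \<alpha> n)"
proof -
  interpret L: bidirected_digraph "layer n" "layer_bar p X bar \<alpha> n"
    by (rule bidirected_layer_graph) (simp_all add: bidirected_X \<alpha>_carrier \<alpha>_bar)
  show ?thesis by unfold_locales (simp_all add: verts_layer arcs_layer)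
qed

sublocale L: finite_serre_graph "layer n" "layer_bar p X bar \<alpha> n" for n
  by (rule layer_serre)

section \<open>The Laplacian of a layer in residue coordinates and on characters\<close>

definition lift_arcs :: "nat \<Rightarrow> 'v \<Rightarrow> nat \<Rightarrow> ('e \<times> nat) set" where
  "lift_arcs n v c = out_arcs X v \<times> {a. a < p ^ n \<and> a mod p ^ lvl v n = c}"

lemma laplacian_layer:
  assumes x: "(v, c) \<in> indices n" and y: "y \<in> indices n"
  shows "L.laplacian n (vertex n (v, c)) (vertex n y)
    = (\<Sum>(s, a)\<in>lift_arcs n v c. of_bool ((v, c) = y)
        - of_bool ((head X s, (a + voltage s n) mod p ^ lvl (head X s) n) = y) :: complex)"
proof -
  let ?f = "\<lambda>(s, a). (s :: 'e, level_class p n a)"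
  have vertex_eq: "vertex n x = vertex n x' \<longleftrightarrow> x = x'" if "x \<in> indices n" "x' \<in> indices n" for x x'
    using inj_on_vertex that by (auto dest: inj_onD)
  have in_idx: "(u, b mod p ^ lvl u n) \<in> indices n" if "u \<in> verts X" for u b
    using that by (simp add: indices_def)
  have "bij_betw ?f (lift_arcs n v c) (out_arcs (layer n) (vertex n (v, c)))"
    unfolding bij_betw_def
  proof
    show "inj_on ?f (lift_arcs n v c)"
      using inj_on_level_class[OF p_pos, of n] by (auto simp: inj_on_def lift_arcs_def)
    show "?f ` lift_arcs n v c = out_arcs (layer n) (vertex n (v, c))"
    proof (intro equalityI subsetI)
      fix e assume "e \<in> ?f ` lift_arcs n v c"
      then obtain s a where "e = (s, level_class p n a)" "s \<in> arcs X" "tail X s = v" "a < p ^ n" "a mod p ^ lvl v n = c"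
        by (auto simp: lift_arcs_def)
      then show "e \<in> out_arcs (layer n) (vertex n (v, c))"
        by (simp add: out_arcs_def arcs_layer tail_layer)
    next
      fix e assume e: "e \<in> out_arcs (layer n) (vertex n (v, c))"
      then obtain s a where sa: "e = (s, level_class p n a)" "s \<in> arcs X" "a < p ^ n"
        by (auto simp: out_arcs_def arcs_layer)
      then have "vertex n (tail X s, a mod p ^ lvl (tail X s) n) = vertex n (v, c)"
        using e by (simp add: out_arcs_def tail_layer)
      then have "tail X s = v \<and> a mod p ^ lvl v n = c"
        using vertex_eq[OF in_idx x] sa(2) by auto
      then show "e \<in> ?f ` lift_arcs n v c" using sa by (auto simp: lift_arcs_def intro!: rev_image_eqI[of "(s, a)"])
    qed
  qed
  then have "L.laplacian n (vertex n (v, c)) (vertex n y)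
      = (\<Sum>x\<in>lift_arcs n v c. of_bool (vertex n (v, c) = vertex n y) - of_bool (head (layer n) (?f x) = vertex n y) :: complex)"
    unfolding L.laplacian_def by (rule sum.reindex_bij_betw[symmetric])
  also have "\<dots> = (\<Sum>(s, a)\<in>lift_arcs n v c. of_bool ((v, c) = y)
        - of_bool ((head X s, (a + voltage s n) mod p ^ lvl (head X s) n) = y))"
  proof (rule sum.cong[OF refl])
    fix e assume "e \<in> lift_arcs n v c"
    then obtain s a where e: "e = (s, a)" "s \<in> arcs X" "a < p ^ n" by (auto simp: lift_arcs_def)
    then show "of_bool (vertex n (v, c) = vertex n y) - of_bool (head (layer n) (?f e) = vertex n y)
        = (case e of (s, a) \<Rightarrow> (of_bool ((v, c) = y)
          - of_bool ((head X s, (a + voltage s n) mod p ^ lvl (head X s) n) = y) :: complex))"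
      using vertex_eq[OF x y] vertex_eq[OF in_idx y] by (simp add: head_layer)
  qed
  finally show ?thesis .
qed

text \<open>The Laplacian of \<open>X\<close> twisted by the character that sends 1 to
  \<open>z\<close>.\<close>

definition symbol :: "nat \<Rightarrow> complex \<Rightarrow> 'v \<Rightarrow> 'v \<Rightarrow> complex" where
  "symbol n z v w = (\<Sum>s\<in>out_arcs X v. of_bool (v = w) - of_bool (head X s = w) * z ^ voltage s n)"

text \<open>Functions on the fibre over \<open>v\<close> involve exactly the characters trivial on
  the group of \<open>v\<close>.\<close>

definition frequencies :: "nat \<Rightarrow> complex \<Rightarrow> 'v set" where
  "frequencies n z = {v \<in> verts X. z ^ (p ^ lvl v n) = 1}"

text \<open>The trivial character is perturbed at one vertex \<open>r\<close> of the base to make its block invertible.\<close>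

definition block_det :: "'v \<Rightarrow> nat \<Rightarrow> complex \<Rightarrow> complex" where
  "block_det r n z = detS (frequencies n z) (\<lambda>v w. symbol n z v w + of_bool (z = 1 \<and> v = r \<and> w = r))"

lemma root_mono:
  fixes z :: complex
  assumes "z ^ (p ^ i) = 1" "i \<le> j"
  shows "z ^ (p ^ j) = 1"
proof -
  have "p ^ j = p ^ i * p ^ (j - i)" using assms(2) by (simp add: power_add[symmetric])
  then show ?thesis using assms(1) by (simp add: power_mult)
qed

text \<open>Indexes a Fourier basis of the functions on the vertices: \<open>(z, v)\<close> stands
  for \<open>c \<mapsto> z ^ c\<close> on the fibre over \<open>v\<close>, extended by zero.\<close>

definition modes :: "nat \<Rightarrow> (complex \<times> 'v) set" where
  "modes n = (SIGMA z:{z. z ^ (p ^ n) = 1}. frequencies n z)"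

lemma modes_iff: "(z, v) \<in> modes n \<longleftrightarrow> v \<in> verts X \<and> z ^ (p ^ lvl v n) = 1"
  using root_mono[OF _ lvl_le, of z v n] by (auto simp: modes_def frequencies_def)

lemma finite_modes [simp]: "finite (modes n)"
  by (simp add: modes_def frequencies_def)

lemma card_modes: "card (indices n) = card (modes n)"
proof -
  have "bij_betw (\<lambda>(z, v). (v, z)) (modes n) (SIGMA v:verts X. {z. z ^ (p ^ lvl v n) = 1})"
    by (rule bij_betw_byWitness[where f' = "\<lambda>(v, z). (z, v)"]) (auto simp: modes_iff)
  then have "card (modes n) = card (SIGMA v:verts X. {z::complex. z ^ (p ^ lvl v n) = 1})"
    by (rule bij_betw_same_card)
  also have "\<dots> = (\<Sum>v\<in>verts X. p ^ lvl v n)"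
    by (subst card_SigmaI) (simp_all add: card_unity_roots)
  also have "\<dots> = card (indices n)"
    unfolding indices_def by (subst card_SigmaI) simp_all
  finally show ?thesis by simp
qed

text \<open>Each edge leaving \<open>v\<close> has \<open>p ^ (n - lvl v n)\<close> lifts at every
  vertex above \<open>v\<close>; dividing by this number makes the action on characters exactly
  \<open>symbol\<close>. The second summand averages over the fibre of \<open>r\<close> and so acts
  on the trivial character only.\<close>

definition norm_laplacian :: "'v \<Rightarrow> nat \<Rightarrow> 'v \<times> nat \<Rightarrow> 'v \<times> nat \<Rightarrow> complex" where
  "norm_laplacian r n x y = inverse (of_nat (p ^ (n - lvl (fst x) n))) * L.laplacian n (vertex n x) (vertex n y)
    + of_bool (fst x = r) * (of_bool (fst y = r) * inverse (of_nat (p ^ lvl r n)))"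

lemma norm_laplacian_mode:
  assumes x: "(v, c) \<in> indices n" and mode: "(z, w) \<in> modes n" and r: "r \<in> verts X"
  shows "(\<Sum>y\<in>indices n. norm_laplacian r n (v, c) y * (of_bool (fst y = w) * z ^ snd y))
    = (if z ^ (p ^ lvl v n) = 1 then z ^ c * (symbol n z v w + of_bool (z = 1 \<and> v = r \<and> w = r)) else 0)"
proof -
  let ?F = "\<lambda>y :: 'v \<times> nat. of_bool (fst y = w) * z ^ snd y :: complex"
  let ?h = "p ^ (n - lvl v n)" and ?M = "p ^ lvl v n"
  let ?S = "{a. a < p ^ n \<and> a mod ?M = c}"
  have v: "v \<in> verts X" "c < ?M" using x by (auto simp: indices_def)
  have w: "w \<in> verts X" "z ^ (p ^ lvl w n) = 1" using mode by (auto simp: modes_iff)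
  have zn: "z ^ (?M * ?h) = 1" using root_mono[OF w(2) lvl_le] by (simp add: p_pow_lvl)
  have S: "(\<Sum>a\<in>?S. z ^ a) = of_nat ?h * of_bool (z ^ ?M = 1) * z ^ c"
    using sum_residue_class_powers[OF v(2) zn] by (simp only: p_pow_lvl)
  have card_S: "of_nat (card ?S) = (of_nat ?h :: complex)"
    using sum_residue_class[OF v(2), of "\<lambda>_. 1 :: complex" ?h] by (simp add: p_pow_lvl)
  have delta: "(\<Sum>y\<in>indices n. of_bool (x' = y) * ?F y) = ?F x'" if "x' \<in> indices n" for x'
  proof -
    have "(\<Sum>y\<in>indices n. of_bool (x' = y) * ?F y) = (\<Sum>y\<in>indices n. if y = x' then ?F y else 0)"
      by (intro sum.cong) auto
    then show ?thesis using that by simp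
  qed
  have F_head: "?F (head X s, (a + voltage s n) mod p ^ lvl (head X s) n)
      = of_bool (head X s = w) * z ^ voltage s n * z ^ a" for s a
    using power_mod_root[OF w(2), of "a + voltage s n"] by (auto simp: power_add)
  have "(\<Sum>y\<in>indices n. L.laplacian n (vertex n (v, c)) (vertex n y) * ?F y)
      = (\<Sum>y\<in>indices n. \<Sum>(s, a)\<in>lift_arcs n v c. (of_bool ((v, c) = y)
          - of_bool ((head X s, (a + voltage s n) mod p ^ lvl (head X s) n) = y)) * ?F y)"
    by (intro sum.cong refl) (simp only: laplacian_layer[OF x] sum_distrib_right case_prod_unfold)
  also have "\<dots> = (\<Sum>(s, a)\<in>lift_arcs n v c. \<Sum>y\<in>indices n. (of_bool ((v, c) = y)
          - of_bool ((head X s, (a + voltage s n) mod p ^ lvl (head X s) n) = y)) * ?F y)"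
    by (subst sum.swap) (simp only: case_prod_unfold)
  also have "\<dots> = (\<Sum>(s, a)\<in>lift_arcs n v c. of_bool (v = w) * z ^ c
      - of_bool (head X s = w) * z ^ voltage s n * z ^ a)"
  proof (rule sum.cong[OF refl])
    fix e assume "e \<in> lift_arcs n v c"
    then obtain s a where e: "e = (s, a)" "s \<in> arcs X" by (auto simp: lift_arcs_def)
    have idx: "(head X s, (a + voltage s n) mod p ^ lvl (head X s) n) \<in> indices n"
      using e by (simp add: indices_def)
    have "(\<Sum>y\<in>indices n. (of_bool ((v, c) = y)
          - of_bool ((head X s, (a + voltage s n) mod p ^ lvl (head X s) n) = y)) * ?F y)
        = ?F (v, c) - ?F (head X s, (a + voltage s n) mod p ^ lvl (head X s) n)"
      by (simp only: left_diff_distrib sum_subtractf delta[OF x] delta[OF idx])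
    then show "(case e of (s, a) \<Rightarrow> \<Sum>y\<in>indices n. (of_bool ((v, c) = y)
          - of_bool ((head X s, (a + voltage s n) mod p ^ lvl (head X s) n) = y)) * ?F y)
        = (case e of (s, a) \<Rightarrow> of_bool (v = w) * z ^ c - of_bool (head X s = w) * z ^ voltage s n * z ^ a)"
      unfolding e(1) F_head by simp
  qed
  also have "\<dots> = (\<Sum>s\<in>out_arcs X v. \<Sum>a\<in>?S. of_bool (v = w) * z ^ c
      - of_bool (head X s = w) * z ^ voltage s n * z ^ a)"
    unfolding lift_arcs_def by (rule sum.cartesian_product[symmetric])
  also have "\<dots> = (\<Sum>s\<in>out_arcs X v. of_nat ?h * (of_bool (z ^ ?M = 1) * z ^ c
      * (of_bool (v = w) - of_bool (head X s = w) * z ^ voltage s n)))"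
  proof (rule sum.cong[OF refl])
    fix s
    have "(\<Sum>a\<in>?S. of_bool (v = w) * z ^ c - of_bool (head X s = w) * z ^ voltage s n * z ^ a)
        = of_nat (card ?S) * (of_bool (v = w) * z ^ c)
          - of_bool (head X s = w) * z ^ voltage s n * (\<Sum>a\<in>?S. z ^ a)"
      by (simp add: sum_subtractf sum_distrib_left)
    \<comment> \<open>For \<open>v = w\<close> the mode condition gives \<open>z ^ ?M = 1\<close>,
      so the diagonal term has the same indicator factor as the character sum.\<close>
    also have "\<dots> = of_nat ?h * (of_bool (z ^ ?M = 1) * z ^ c
        * (of_bool (v = w) - of_bool (head X s = w) * z ^ voltage s n))"
      unfolding card_S S using w(2) by (cases "v = w") (auto simp: algebra_simps)
    finally show "(\<Sum>a\<in>?S. of_bool (v = w) * z ^ c - of_bool (head X s = w) * z ^ voltage s n * z ^ a)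
        = of_nat ?h * (of_bool (z ^ ?M = 1) * z ^ c
        * (of_bool (v = w) - of_bool (head X s = w) * z ^ voltage s n))" .
  qed
  also have "\<dots> = of_nat ?h * (of_bool (z ^ ?M = 1) * z ^ c * symbol n z v w)"
    by (simp only: symbol_def sum_distrib_left)
  finally have lap: "(\<Sum>y\<in>indices n. L.laplacian n (vertex n (v, c)) (vertex n y) * ?F y)
      = of_nat ?h * (of_bool (z ^ ?M = 1) * z ^ c * symbol n z v w)" .
  have pert: "(\<Sum>y\<in>indices n. of_bool (fst y = r) * inverse (of_nat (p ^ lvl r n)) * ?F y)
      = of_bool (w = r \<and> z = 1)"
  proof -
    have "(\<Sum>y\<in>indices n. of_bool (fst y = r) * inverse (of_nat (p ^ lvl r n)) * ?F y)
        = (\<Sum>u\<in>verts X. \<Sum>d<p ^ lvl u n. of_bool (u = r) * inverse (of_nat (p ^ lvl r n)) * (of_bool (u = w) * z ^ d))"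
      unfolding indices_def by (subst sum.Sigma) (auto intro!: sum.cong)
    also have "\<dots> = (\<Sum>u\<in>verts X. if u = r then inverse (of_nat (p ^ lvl r n)) * of_bool (r = w) * (\<Sum>d<p ^ lvl r n. z ^ d) else 0)"
      by (intro sum.cong) (auto simp: sum_distrib_left)
    also have "\<dots> = inverse (of_nat (p ^ lvl r n)) * of_bool (r = w) * (\<Sum>d<p ^ lvl r n. z ^ d)"
      using r by simp
    also have "\<dots> = of_bool (w = r \<and> z = 1)"
      using w(2) by (cases "r = w") (auto simp: sum_powers_root_of_unity)
    finally show ?thesis .
  qed
  have "(\<Sum>y\<in>indices n. norm_laplacian r n (v, c) y * ?F y)
      = inverse (of_nat ?h) * (\<Sum>y\<in>indices n. L.laplacian n (vertex n (v, c)) (vertex n y) * ?F y)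
        + of_bool (v = r) * (\<Sum>y\<in>indices n. of_bool (fst y = r) * inverse (of_nat (p ^ lvl r n)) * ?F y)"
    by (simp only: norm_laplacian_def distrib_right sum.distrib sum_distrib_left fst_conv mult.assoc)
  also have "\<dots> = of_bool (z ^ ?M = 1) * z ^ c * symbol n z v w + of_bool (z = 1 \<and> v = r \<and> w = r)"
    unfolding lap pert by (auto simp: mult.assoc[symmetric])
  also have "\<dots> = (if z ^ ?M = 1 then z ^ c * (symbol n z v w + of_bool (z = 1 \<and> v = r \<and> w = r)) else 0)"
    by (auto simp: algebra_simps)
  finally show ?thesis .
qed

lemma detS_norm_laplacian:
  assumes r: "r \<in> verts X"
  shows "detS (indices n) (norm_laplacian r n) = (\<Prod>z | z ^ (p ^ n) = 1. block_det r n z)"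
proof -
  let ?F = "\<lambda>y i. of_bool (fst y = snd i) * fst i ^ snd y :: complex"
  let ?F' = "\<lambda>i y. of_bool (snd i = fst y) * (inverse (of_nat (p ^ lvl (fst y) n)) * inverse (fst i) ^ snd y) :: complex"
  let ?B = "\<lambda>i j. if fst i = fst j then symbol n (fst j) (snd i) (snd j)
    + of_bool (fst j = 1 \<and> snd i = r \<and> snd j = r) else 0"
  have "detS (indices n) (norm_laplacian r n) = detS (modes n) ?B"
  \<comment> \<open>\<open>?F'\<close> is the inverse Fourier transform, normalised on each fibre by
    the number of its vertices.\<close>
  proof (rule detS_similar[where F = ?F and F' = ?F'])
    fix i j assume ij: "i \<in> modes n" "j \<in> modes n"
    obtain y u where i: "i = (y, u)" by fastforce
    obtain z w where j: "j = (z, w)" by fastforce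
    have u: "u \<in> verts X" "y ^ (p ^ lvl u n) = 1" and w: "w \<in> verts X" "z ^ (p ^ lvl w n) = 1"
      using ij by (auto simp: i j modes_iff)
    have "(\<Sum>x\<in>indices n. ?F' i x * ?F x j)
        = (\<Sum>v\<in>verts X. \<Sum>c<p ^ lvl v n. of_bool (u = v) * (inverse (of_nat (p ^ lvl v n)) * inverse y ^ c) * (of_bool (v = w) * z ^ c))"
      unfolding indices_def i j by (subst sum.Sigma) (auto intro!: sum.cong)
    also have "\<dots> = (\<Sum>v\<in>verts X. if v = u then of_bool (u = w) * (\<Sum>c<p ^ lvl u n. inverse (of_nat (p ^ lvl u n)) * inverse y ^ c * z ^ c) else 0)"
      by (intro sum.cong) (auto simp: sum_distrib_left)
    also have "\<dots> = of_bool (u = w) * (\<Sum>c<p ^ lvl u n. inverse (of_nat (p ^ lvl u n)) * inverse y ^ c * z ^ c)"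
      using u by simp
    also have "\<dots> = (if i = j then 1 else 0)"
      using u w by (cases "u = w") (auto simp: i j unity_roots_orthogonal simp del: of_nat_power)
    finally show "(\<Sum>x\<in>indices n. ?F' i x * ?F x j) = (if i = j then 1 else 0)" .
  next
    fix x j assume xj: "x \<in> indices n" "j \<in> modes n"
    obtain v c where x: "x = (v, c)" by fastforce
    obtain z w where j: "j = (z, w)" by fastforce
    have v: "v \<in> verts X" using xj by (simp add: x indices_def)
    have "(\<Sum>i\<in>modes n. ?F x i * ?B i j)
        = (\<Sum>i\<in>modes n. if i = (z, v) then z ^ c * (symbol n z v w + of_bool (z = 1 \<and> v = r \<and> w = r)) else 0)"
      by (intro sum.cong) (auto simp: x j)
    also have "\<dots> = (if z ^ (p ^ lvl v n) = 1 then z ^ c * (symbol n z v w + of_bool (z = 1 \<and> v = r \<and> w = r)) else 0)"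
      using v by (simp add: modes_iff)
    finally show "(\<Sum>y\<in>indices n. norm_laplacian r n x y * ?F y j) = (\<Sum>i\<in>modes n. ?F x i * ?B i j)"
      using norm_laplacian_mode[of v c n z w r] xj r by (simp add: x j)
  qed (simp_all add: card_modes)
  also have "\<dots> = (\<Prod>z | z ^ (p ^ n) = 1. detS (frequencies n z) (\<lambda>v w. ?B (z, v) (z, w)))"
    unfolding modes_def by (rule detS_Sigma) (simp_all add: frequencies_def)
  also have "\<dots> = (\<Prod>z | z ^ (p ^ n) = 1. block_det r n z)"
    by (simp add: block_det_def)
  finally show ?thesis .
qed

definition num_trees :: "nat \<Rightarrow> nat" where
  "num_trees n = num_spanning_trees (layer n) (layer_bar p X bar \<alpha> n)"

text \<open>The total exponent of \<open>p\<close> in the orders of the decomposition groups of the vertices of the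
  layer.\<close>

definition ramification :: "nat \<Rightarrow> nat" where
  "ramification n = (\<Sum>v\<in>verts X. (n - lvl v n) * p ^ lvl v n)"

text \<open>The factor \<open>p ^ n\<close> is the total weight of the perturbing vector, and
  \<open>ramification\<close> collects the factors by which the rows were divided.\<close>

lemma num_trees_eq_blocks:
  assumes r: "r \<in> verts X"
  shows "of_nat (num_trees n * p ^ n) = of_nat (p ^ ramification n) * (\<Prod>z | z ^ (p ^ n) = 1. block_det r n z)"
proof -
  let ?V = "verts (layer n)" and ?h = "\<lambda>v. of_nat (p ^ (n - lvl v n)) :: complex"
  let ?lap = "\<lambda>x y. L.laplacian n (vertex n x) (vertex n y) :: complex"
  \<comment> \<open>The weight \<open>?h r\<close> compensates the division of the rows over
    \<open>r\<close>; \<open>?w\<close> is normalised to total weight 1.\<close>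
  let ?u = "\<lambda>x :: 'v \<times> (nat \<Rightarrow> int) set set. of_bool (fst x = r) * ?h r"
  let ?w = "\<lambda>y :: 'v \<times> (nat \<Rightarrow> int) set set. of_bool (fst y = r) * inverse (of_nat (p ^ lvl r n)) :: complex"
  have bij: "bij_betw (vertex n) (indices n) ?V"
    using inj_on_vertex by (simp add: bij_betw_def verts_layer)
  have fst_vertex: "fst (vertex n x) = fst x" for x by (cases x) (simp add: vertex_def)
  have p_c: "of_nat (p ^ k) \<noteq> (0::complex)" for k by simp
  have fiber: "(\<Sum>x\<in>?V. of_bool (fst x = r) * a) = of_nat (p ^ lvl r n) * a" for a :: complex
  proof -
    have "(\<Sum>x\<in>?V. of_bool (fst x = r) * a) = (\<Sum>x\<in>indices n. of_bool (fst x = r) * a)"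
      by (simp only: sum.reindex_bij_betw[OF bij, symmetric] fst_vertex)
    also have "\<dots> = (\<Sum>v\<in>verts X. \<Sum>c<p ^ lvl v n. of_bool (v = r) * a)"
      unfolding indices_def by (subst sum.Sigma) (simp, simp, rule sum.cong[OF refl], auto)
    also have "\<dots> = (\<Sum>v\<in>verts X. if v = r then of_nat (p ^ lvl r n) * a else 0)"
      by (intro sum.cong) auto
    finally show ?thesis using r by simp
  qed
  have sum_u: "(\<Sum>x\<in>?V. ?u x) = of_nat (p ^ n)"
    unfolding fiber by (simp only: of_nat_mult[symmetric] p_pow_lvl)
  have sum_w: "(\<Sum>x\<in>?V. ?w x) = 1"
    unfolding fiber using p_c by simp
  have "(r, 0) \<in> indices n" using r by (simp add: indices_def)
  then have x0: "vertex n (r, 0) \<in> ?V" by (simp add: verts_layer)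
  have "detS ?V (\<lambda>x y. L.laplacian n x y + ?u x * ?w y) = of_nat (p ^ n) * 1 * detS (?V - {vertex n (r, 0)}) (L.laplacian n)"
    unfolding sum_u[symmetric] sum_w[symmetric]
  proof (rule detS_add_rank_one)
    show "(\<Sum>x\<in>?V. ?u x) \<noteq> 0" unfolding sum_u by (rule p_c)
  qed (use x0 in \<open>simp_all add: L.laplacian_row_sum L.laplacian_column_sum\<close>)
  also have "detS (?V - {vertex n (r, 0)}) (L.laplacian n) = (of_nat (num_trees n) :: complex)"
    unfolding num_trees_def by (rule L.matrix_tree[OF x0])
  finally have det: "detS (indices n) (\<lambda>x y. ?lap x y + ?u (vertex n x) * ?w (vertex n y)) = of_nat (num_trees n * p ^ n)"
    using detS_reindex[OF bij, of "\<lambda>x y. L.laplacian n x y + ?u x * ?w y"]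
    by (simp add: fst_vertex mult.commute)
  have "detS (indices n) (\<lambda>x y. ?lap x y + ?u (vertex n x) * ?w (vertex n y))
      = detS (indices n) (\<lambda>x y. ?h (fst x) * norm_laplacian r n x y)"
  proof (rule detS_cong)
    fix x y
    have "?h (fst x) * norm_laplacian r n x y
        = (?h (fst x) * inverse (?h (fst x))) * ?lap x y
          + of_bool (fst x = r) * ?h (fst x) * (of_bool (fst y = r) * inverse (of_nat (p ^ lvl r n)))"
      unfolding norm_laplacian_def by (simp only: algebra_simps)
    also have "?h (fst x) * inverse (?h (fst x)) = 1" using p_c by (rule right_inverse)
    finally show "?lap x y + ?u (vertex n x) * ?w (vertex n y) = ?h (fst x) * norm_laplacian r n x y"
      unfolding fst_vertex by (auto simp: of_bool_def)
  qed
  also have "\<dots> = (\<Prod>x\<in>indices n. ?h (fst x)) * detS (indices n) (norm_laplacian r n)"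
    by (rule detS_scale_rows)
  also have "(\<Prod>x\<in>indices n. ?h (fst x)) = (\<Prod>v\<in>verts X. \<Prod>c<p ^ lvl v n. ?h v)"
    unfolding indices_def by (subst prod.Sigma) (auto intro!: prod.cong)
  also have "\<dots> = of_nat (p ^ ramification n)"
    by (simp add: ramification_def power_sum power_mult)
  finally show ?thesis unfolding det detS_norm_laplacian[OF r] by simp
qed

end

section \<open>Growth of the number of spanning trees\<close>

context graph_tower
begin

text \<open>An integer polynomial representing at level \<open>n\<close> the determinant in the
  Iwasawa algebra, with \<open>x\<close> for the group element 1.\<close>

definition base_poly :: "nat \<Rightarrow> int poly" where
  "base_poly n = detS (verts X - R)
    (\<lambda>v w. \<Sum>s\<in>out_arcs X v. of_bool (v = w) - of_bool (head X s = w) * monom 1 (voltage s n))"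

lemma ev_base_poly: "ev (base_poly n) z = detS (verts X - R) (symbol n z)"
proof -
  have bool: "ev (of_bool b) z = of_bool b" for b by simp
  have "ev (base_poly n) z = detS (verts X - R) (\<lambda>v w. ev (\<Sum>s\<in>out_arcs X v. of_bool (v = w)
      - of_bool (head X s = w) * monom 1 (voltage s n)) z)"
    unfolding base_poly_def by (rule detS_hom) simp_all
  also have "\<dots> = detS (verts X - R) (symbol n z)"
    by (rule detS_cong) (simp add: ev_sum bool symbol_def)
  finally show ?thesis .
qed

text \<open>Voltages at consecutive levels differ by multiples of \<open>p ^ n\<close>, and powers
  of \<open>x^(p^n)\<close> are congruent to 1.\<close>

lemma base_poly_cong: "(monom 1 (p ^ n) - 1) dvd base_poly (Suc n) - base_poly n"
  unfolding base_poly_def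
proof (rule detS_dvd_diff)
  fix v w
  have dvd: "(monom 1 (p ^ n) - 1 :: int poly) dvd monom 1 (voltage s n) - monom 1 (voltage s (Suc n))"
    if "s \<in> arcs X" for s
  proof -
    let ?t = "voltage s (Suc n) div p ^ n" and ?y = "monom 1 (p ^ n) :: int poly"
    have "voltage s (Suc n) = voltage s n + p ^ n * ?t"
      using voltage_mod[OF that, of n] by (metis mod_mult_div_eq)
    then have "monom 1 (voltage s (Suc n)) = monom 1 (voltage s n) * ?y ^ ?t"
      by (simp add: monom_power mult_monom)
    then have "monom 1 (voltage s n) - monom 1 (voltage s (Suc n)) = (?y ^ ?t - 1) * (- monom 1 (voltage s n))"
      by (simp add: algebra_simps)
    moreover have "?y - 1 dvd ?y ^ ?t - 1" unfolding power_diff_1_eq by (rule dvd_triv_left)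
    ultimately show ?thesis by (metis dvd_mult2)
  qed
  have "(monom 1 (p ^ n) - 1 :: int poly) dvd (\<Sum>s\<in>out_arcs X v. of_bool (head X s = w)
      * (monom 1 (voltage s n) - monom 1 (voltage s (Suc n))))"
    by (intro dvd_sum dvd_mult dvd) (simp add: out_arcs_def)
  also have "(\<Sum>s\<in>out_arcs X v. of_bool (head X s = w)
      * (monom 1 (voltage s n) - monom 1 (voltage s (Suc n))))
    = (\<Sum>s\<in>out_arcs X v. of_bool (v = w) - of_bool (head X s = w) * monom 1 (voltage s (Suc n)))
      - (\<Sum>s\<in>out_arcs X v. of_bool (v = w) - of_bool (head X s = w) * monom (1::int) (voltage s n))"
    unfolding sum_subtractf[symmetric] by (intro sum.cong refl) (simp add: algebra_simps)
  finally show "monom 1 (p ^ n) - 1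
      dvd (\<Sum>s\<in>out_arcs X v. of_bool (v = w) - of_bool (head X s = w) * monom 1 (voltage s (Suc n)))
        - (\<Sum>s\<in>out_arcs X v. of_bool (v = w) - of_bool (head X s = w) * monom (1::int) (voltage s n))" .
qed simp

text \<open>With no vertex removed, the matrix at \<open>z = 1\<close> is the Laplacian of
  \<open>X\<close>, which kills constants. This later yields \<open>l >= 1\<close>.\<close>

lemma base_poly_unramified_root:
  assumes "R = {}" "verts X \<noteq> {}"
  shows "poly (base_poly n) 1 = 0"
proof -
  obtain v where v: "v \<in> verts X" using assms(2) by blast
  have "detS (verts X) (symbol n 1) = 0"
  proof (rule detS_eq_0I[where x = "\<lambda>_. 1" and v = v])
    fix u assume "u \<in> verts X"
    then have "(\<Sum>w\<in>verts X. symbol n 1 u w) = (\<Sum>s\<in>out_arcs X u. (\<Sum>w\<in>verts X. of_bool (u = w) - of_bool (head X s = w)))"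
      unfolding symbol_def by (subst sum.swap) simp
    also have "\<dots> = 0"
      using \<open>u \<in> verts X\<close> by (intro sum.neutral) (auto simp: sum_subtractf of_bool_def out_arcs_def)
    finally show "(\<Sum>w\<in>verts X. symbol n 1 u w * 1) = 0" by simp
  qed (use v in simp_all)
  then have "of_int (poly (base_poly n) 1) = (0::complex)"
    using ev_one[of "base_poly n"] ev_base_poly[of n 1] assms(1) by simp
  then show ?thesis by simp
qed

text \<open>Past all depths an old character sees the same vertices at both levels, and it depends
  on voltages only modulo \<open>p ^ n\<close>.\<close>

lemma block_det_Suc:
  assumes n: "\<And>v. v \<in> R \<Longrightarrow> depth v \<le> n" and z: "z ^ (p ^ n) = 1"
  shows "block_det r (Suc n) z = block_det r n z"
proof -
  have "z ^ (p ^ Suc n) = 1" using z by (rule root_mono) simp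
  then have "frequencies (Suc n) z = frequencies n z"
    unfolding frequencies_def using n z by (intro Collect_cong conj_cong refl) (auto simp: lvl_def min_absorb2 le_SucI simp del: power_Suc)
  moreover have "symbol (Suc n) z = symbol n z"
  proof (intro ext)
    fix v w
    have "z ^ voltage s (Suc n) = z ^ voltage s n" if "s \<in> arcs X" for s
      using power_mod_root[OF z, of "voltage s (Suc n)"] voltage_mod[OF that] by simp
    then show "symbol (Suc n) z v w = symbol n z v w"
      unfolding symbol_def by (intro sum.cong refl) (simp add: out_arcs_def)
  qed
  ultimately show ?thesis by (simp add: block_det_def)
qed

text \<open>A character of exact order \<open>p ^ (n + 1)\<close> is nontrivial on all multiples of
  \<open>p ^ depth v\<close> when \<open>depth v <= n\<close>; being different from 1, it also
  avoids the perturbation at \<open>r\<close>.\<close>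

lemma block_det_primitive:
  assumes n: "\<And>v. v \<in> R \<Longrightarrow> depth v \<le> n" and z: "z \<in> primitive_roots p (Suc n)"
  shows "block_det r (Suc n) z = ev (base_poly (Suc n)) z"
proof -
  have z': "z ^ (p ^ Suc n) = 1" "z ^ (p ^ n) \<noteq> 1" using z by (auto simp: primitive_roots_def)
  have "v \<in> frequencies (Suc n) z \<longleftrightarrow> v \<in> verts X - R" for v
  proof (cases "v \<in> R")
    case True
    then have "z ^ (p ^ depth v) \<noteq> 1" using root_mono[of z "depth v" n] n z'(2) by auto
    then show ?thesis using True n[OF True] by (simp add: frequencies_def lvl_def min_absorb2)
  next
    case False
    then show ?thesis using z'(1) by (simp add: frequencies_def lvl_def del: power_Suc)
  qed
  then have "frequencies (Suc n) z = verts X - R" by blast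
  moreover have "z \<noteq> 1" using z' by auto
  ultimately show ?thesis by (simp add: block_det_def ev_base_poly)
qed

text \<open>The number of vertices above \<open>R\<close> in every sufficiently high layer.\<close>

definition ram_count :: nat where
  "ram_count = (\<Sum>v\<in>R. p ^ depth v)"

lemma finite_R [simp]: "finite R"
  by (rule finite_subset[OF R_sub]) simp

text \<open>Past all depths the fibres over \<open>R\<close> stay fixed while each stabiliser there
  grows by a factor \<open>p\<close>.\<close>

lemma ramification_Suc:
  assumes n: "\<And>v. v \<in> R \<Longrightarrow> depth v \<le> n"
  shows "ramification (Suc n) = ramification n + ram_count"
proof -
  have ram: "ramification k = (\<Sum>v\<in>R. (k - depth v) * p ^ depth v)" if "k \<ge> n" for k
  proof -
    have "ramification k = (\<Sum>v\<in>R. (k - lvl v k) * p ^ lvl v k)"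
      unfolding ramification_def using R_sub by (intro sum.mono_neutral_right) (auto simp: lvl_def)
    also have "\<dots> = (\<Sum>v\<in>R. (k - depth v) * p ^ depth v)"
    proof (rule sum.cong[OF refl])
      fix v assume "v \<in> R"
      then have "lvl v k = depth v" using n[of v] that by (simp add: lvl_def min_absorb2)
      then show "(k - lvl v k) * p ^ lvl v k = (k - depth v) * p ^ depth v" by simp
    qed
    finally show ?thesis .
  qed
  show ?thesis
    unfolding ram[OF le_refl] ram[OF le_SucI[OF le_refl]] ram_count_def sum.distrib[symmetric]
    by (intro sum.cong refl) (simp add: Suc_diff_le n)
qed

text \<open>Compares the block formula at consecutive levels: the old blocks reassemble into
  \<open>num_trees n\<close>, and \<open>p ^ (n + 1)\<close> against \<open>p ^ n\<close> leaves the
  factor \<open>p\<close> on the left.\<close>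

lemma num_trees_Suc:
  assumes n: "\<And>v. v \<in> R \<Longrightarrow> depth v \<le> n" and r: "r \<in> verts X"
  shows "of_nat (num_trees (Suc n) * p)
    = of_nat (num_trees n * p ^ ram_count) * prim_norm p (Suc n) (base_poly (Suc n))"
proof -
  let ?P = "prim_norm p (Suc n) (base_poly (Suc n))" and ?B = "\<lambda>n. \<Prod>z | z ^ (p ^ n) = 1. block_det r n z"
  have "?B (Suc n) = (\<Prod>z | z ^ (p ^ n) = 1. block_det r (Suc n) z) * (\<Prod>z\<in>primitive_roots p (Suc n). block_det r (Suc n) z)"
    unfolding unity_roots_Suc(1) using unity_roots_Suc(2) by (intro prod.union_disjoint) auto
  also have "\<dots> = ?B n * ?P"
    using block_det_Suc[OF n] block_det_primitive[OF n] by (simp add: prim_norm_def)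
  finally have "of_nat (num_trees (Suc n) * p ^ Suc n) = of_nat (p ^ ramification (Suc n)) * (?B n * ?P)"
    using num_trees_eq_blocks[OF r, of "Suc n"] by simp
  also have "\<dots> = of_nat (p ^ ram_count) * (of_nat (p ^ ramification n) * ?B n) * ?P"
    by (simp add: ramification_Suc[OF n] power_add)
  also have "of_nat (p ^ ramification n) * ?B n = of_nat (num_trees n * p ^ n)"
    by (rule num_trees_eq_blocks[OF r, symmetric])
  finally have "of_nat (p ^ n) * of_nat (num_trees (Suc n) * p)
      = of_nat (p ^ n) * (of_nat (num_trees n * p ^ ram_count) * ?P)"
    by (simp add: mult_ac)
  then show ?thesis by (subst (asm) mult_cancel_left) simp
qed

lemma multiplicity_num_trees:
  assumes connected: "\<And>n. Digraph_Component.connected (layer n)" and ne: "verts X \<noteq> {}"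
  shows "\<exists>(\<mu>::nat) (l::nat) (\<nu>::int). \<forall>\<^sub>F n in sequentially.
    int (multiplicity p (num_trees n)) = int \<mu> * int p ^ n + int l * int n + \<nu>"
proof -
  obtain r where r: "r \<in> verts X" using ne by blast
  have pos: "num_trees n > 0" for n
    unfolding num_trees_def by (rule L.num_spanning_trees_pos[OF connected])
  define k0 where "k0 = (\<Sum>v\<in>R. depth v)"
  have k0: "depth v \<le> n" if "v \<in> R" "n \<ge> k0" for v n
    using member_le_sum[of v R depth] that by (simp add: k0_def)
  let ?P = "\<lambda>k. prim_norm p (Suc k) (base_poly (Suc k))"
  \<comment> \<open>A vanishing norm would make the next tree number zero, against
    connectedness.\<close>
  have nonzero: "?P k \<noteq> 0" if "k \<ge> k0" for k
  proof
    assume "?P k = 0"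
    then have "of_nat (num_trees (Suc k) * p) = (0::complex)"
      using num_trees_Suc[of k r] k0 that r by simp
    then show False using pos[of "Suc k"] by simp
  qed
  obtain \<mu> l K where val: "\<forall>k\<ge>K. \<exists>U. p_unit p U \<and> ?P k ^ (p ^ Suc k - p ^ k)
        = of_nat p ^ ((\<mu> * (p ^ Suc k - p ^ k) + l) * (p ^ Suc k - p ^ k)) * U"
    and l_pos: "(\<forall>k. poly (base_poly k) 1 = 0) \<longrightarrow> l \<ge> 1"
    using prim_norm_valuation_sequence[where f = base_poly, OF prime_p base_poly_cong nonzero] by metis
  \<comment> \<open>Needed for a natural slope: the factor \<open>p\<close> in
    \<open>num_trees_Suc\<close> takes one away.\<close>
  have "l + ram_count \<ge> 1"
  proof (cases "R = {}")
    case True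
    then show ?thesis using l_pos base_poly_unramified_root[OF True ne] by auto
  next
    case False
    then have "ram_count > 0" unfolding ram_count_def by (intro sum_pos) auto
    then show ?thesis by simp
  qed
  then obtain l' where l': "l + ram_count = Suc l'" by (cases "l + ram_count") auto
  define e where "e n = multiplicity p (num_trees n)" for n
  have pe: "prime_elem p" using prime_p by simp
  \<comment> \<open>The valuation of the norm is available for its \<open>\<phi>\<close>-th power
    only, so the recursion is raised to that power and \<open>\<phi>\<close> is cancelled from the
    multiplicities.\<close>
  have e_Suc: "e (Suc n) = e n + \<mu> * (p ^ Suc n - p ^ n) + l'" if n: "n \<ge> max K k0" for n
  proof -
    define \<phi> where "\<phi> = p ^ Suc n - p ^ n"
    have \<phi>: "\<phi> > 0" using prime_gt_1_nat[OF prime_p] by (simp add: \<phi>_def)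
    obtain U where U: "p_unit p U" "?P n ^ \<phi> = of_nat p ^ ((\<mu> * \<phi> + l) * \<phi>) * U"
      using val n unfolding \<phi>_def by auto
    have "of_nat ((num_trees (Suc n) * p) ^ \<phi>) = (of_nat (num_trees n * p ^ ram_count) * ?P n) ^ \<phi>"
      using num_trees_Suc[of n r] k0 n r by (simp only: of_nat_power max.bounded_iff)
    also have "\<dots> = of_nat ((num_trees n * p ^ ram_count) ^ \<phi>) * of_nat p ^ ((\<mu> * \<phi> + l) * \<phi>) * U"
      by (simp only: power_mult_distrib U(2) of_nat_power of_nat_mult mult.assoc)
    finally have "multiplicity p ((num_trees (Suc n) * p) ^ \<phi>)
        = multiplicity p ((num_trees n * p ^ ram_count) ^ \<phi>) + (\<mu> * \<phi> + l) * \<phi>"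
      using pos by (intro multiplicity_eq_p_unit[OF prime_p U(1)]) simp_all
    moreover have "multiplicity p ((num_trees (Suc n) * p) ^ \<phi>) = \<phi> * (e (Suc n) + 1)"
      using pos[of "Suc n"] pe prime_gt_1_nat[OF prime_p]
      by (simp add: prime_elem_multiplicity_power_distrib prime_elem_multiplicity_mult_distrib e_def)
    moreover have "multiplicity p ((num_trees n * p ^ ram_count) ^ \<phi>) = \<phi> * (e n + ram_count)"
      using pos[of n] pe prime_gt_1_nat[OF prime_p]
      by (simp add: prime_elem_multiplicity_power_distrib prime_elem_multiplicity_mult_distrib e_def)
    ultimately have "\<phi> * (e (Suc n) + 1) = \<phi> * (e n + ram_count + \<mu> * \<phi> + l)"
      by (simp only: algebra_simps)
    then have "e (Suc n) + 1 = e n + ram_count + \<mu> * \<phi> + l" using \<phi> by (simp only: mult_cancel1) simp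
    then show ?thesis using l' by (simp add: \<phi>_def)
  qed
  define N where "N = max K k0"
  \<comment> \<open>Matches the formula at \<open>n = N\<close>; the increments of
    \<open>p^n\<close> telescope from there.\<close>
  define \<nu> where "\<nu> = int (e N) - int \<mu> * int p ^ N - int l' * int N"
  have "int (e n) = int \<mu> * int p ^ n + int l' * int n + \<nu>" if "n \<ge> N" for n
    using that
  proof (induction n rule: dec_induct)
    case base
    then show ?case by (simp add: \<nu>_def)
  next
    case (step n)
    have "p ^ n \<le> p ^ Suc n" using Suc_leI[OF p_pos] by simp
    then have diff: "int (p ^ Suc n - p ^ n) = int p ^ Suc n - int p ^ n"
      by (simp only: of_nat_diff of_nat_power)
    have "n \<ge> max K k0" using step.hyps by (simp add: N_def)
    then have "int (e (Suc n)) = int (e n) + int \<mu> * (int p ^ Suc n - int p ^ n) + int l'"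
      unfolding diff[symmetric] by (simp only: e_Suc of_nat_add of_nat_mult)
    then show ?case using step.IH by (simp add: algebra_simps)
  qed
  then show ?thesis unfolding eventually_sequentially e_def by blast
qed

end

theorem theorem6p12:
  fixes p :: nat
    and X :: "('v, 'e) pre_digraph" and bar :: "'e \<Rightarrow> 'e"
    and \<alpha> :: "'e \<Rightarrow> nat \<Rightarrow> int" and \<G> :: "'v \<Rightarrow> (nat \<Rightarrow> int) set"
  assumes "prime p"
    and "bidirected_digraph X bar" and "fin_digraph X" and "Digraph_Component.connected X"
    and "\<And>s. s \<in> arcs X \<Longrightarrow> \<alpha> s \<in> carrier (Zp p)"
    and "\<And>s. s \<in> arcs X \<Longrightarrow> \<alpha> (bar s) = inv\<^bsub>Zp p\<^esub> (\<alpha> s)"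
    and "\<And>v. v \<in> verts X \<Longrightarrow> subgroup (\<G> v) (Zp p)"
    and "\<And>v. v \<in> verts X \<Longrightarrow> closedin (Zp_topology p) (\<G> v)"
    and "\<And>n. Digraph_Component.connected (layer_graph p X \<G> \<alpha> n)"
    and "\<forall>\<^sub>F n in sequentially. euler_char (layer_graph p X \<G> \<alpha> n) (layer_bar p X bar \<alpha> n) < 0"
  shows "\<exists>(\<mu>::nat) (l::nat) (\<nu>::int). \<forall>\<^sub>F n in sequentially.
    int (multiplicity p (num_spanning_trees (layer_graph p X \<G> \<alpha> n) (layer_bar p X bar \<alpha> n)))
      = int \<mu> * int p ^ n + int l * int n + \<nu>"
proof -
  define has_depth where "has_depth v k \<longleftrightarrow>
    (\<forall>n. (\<lambda>x. x n) ` \<G> v = {c. 0 \<le> c \<and> c < int p ^ n \<and> int p ^ (min n k) dvd c})" for v k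
  define R where "R = {v \<in> verts X. \<exists>k. has_depth v k}"
  define depth where "depth v = (SOME k. has_depth v k)" for v
  have levels: "(\<lambda>x. x n) ` \<G> v
      = {c. 0 \<le> c \<and> c < int p ^ n \<and> int p ^ (if v \<in> R then min n (depth v) else n) dvd c}"
    if v: "v \<in> verts X" for v n
  proof (cases "v \<in> R")
    case True
    then have "has_depth v (depth v)" unfolding depth_def R_def by (auto intro: someI_ex)
    then show ?thesis using True by (simp add: has_depth_def)
  next
    case False
    then have "(\<lambda>x. x n) ` \<G> v = {0}"
      using Zp_subgroup_levels[OF assms(1) assms(7)[OF v]] v unfolding R_def has_depth_def by blast
    \<comment> \<open>The zero group obeys the common formula with exponent \<open>n\<close>, since
      0 is the only multiple of \<open>p ^ n\<close> in the range.\<close>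
    also have "{0} = {c. 0 \<le> c \<and> c < int p ^ n \<and> int p ^ n dvd c}"
      using prime_gt_0_nat[OF assms(1)] by (auto dest: zdvd_imp_le)
    finally show ?thesis using False by simp
  qed
  interpret graph_tower p X bar \<alpha> \<G> R depth
  proof (rule graph_tower.intro)
    show "R \<subseteq> verts X" by (auto simp: R_def)
  qed (fact assms levels subgroup.subset[OF assms(7)])+
  have "verts X \<noteq> {}"
    using assms(4) by (auto simp: Digraph_Component.connected_def strongly_connected_def)
  from multiplicity_num_trees[OF assms(9) this] show ?thesis by (simp only: num_trees_def)
qed

end
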